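(* Let $\mathrm{Defor}(M,\mathcal{T})\subset\mathbb{C}^{24}$ be the deformation variety of the figure eight knot complement $M$ with respect to its standard ideal triangulation $\mathcal{T}$ by two tetrahedra, i.e. the common zero set of the polynomials listed in the context below. Then $\mathrm{Defor}(M,\mathcal{T})$ is the union of $3$ distinct smooth affine irreducible algebraic varieties, each of dimension $2$, and $\mathrm{Defor}(M,\mathcal{T})$ is connected.
   Context: Coordinates: the standard ideal triangulation of the figure eight knot complement consists of two tetrahedra with vertices labelled $1,2,3,4$. To each ordered pair $i\neq j$ in $\{1,2,3,4\}$ one attaches a coordinate $u_{ij}$ for the first tetrahedron and $v_{ij}$ for the second one (these are the edge coordinates of a decorated tetrahedron of flags in $\mathbb{CP}^2$, used to describe decorated representations into $\mathrm{PGL}(3,\mathbb{C})$; the face coordinates have been eliminated using the internal relations). This gives $24$ complex variables. The deformation variety $\mathrm{Defor}(M,\mathcal{T})\subset\mathbb{C}^{24}$ is the set of common zeros of the following polynomials. Internal (cross-ratio) relations for the first tetrahedron: $u_{12}u_{13}-u_{13}+1$, $u_{12}u_{14}-u_{12}+1$, $u_{21}u_{23}-u_{21}+1$, $u_{21}u_{24}-u_{24}+1$, $u_{31}u_{34}-u_{31}+1$, $u_{32}u_{34}-u_{34}+1$, $u_{41}u_{43}-u_{43}+1$, $u_{42}u_{43}-u_{42}+1$; and the same eight polynomials with every $u$ replaced by $v$ for the second tetrahedron. Edge gluing relations: $u_{13}u_{14}u_{23}v_{21}v_{24}v_{31}-1$, $u_{31}u_{32}u_{41}v_{12}v_{13}v_{42}-1$,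 $u_{21}u_{24}u_{34}v_{23}v_{41}v_{43}-1$, $u_{12}u_{42}u_{43}v_{14}v_{32}v_{34}-1$. Face gluing relations: $u_{21}u_{31}u_{41}v_{21}v_{31}v_{41}-1$, $u_{12}u_{32}u_{42}v_{13}v_{23}v_{43}-1$, $u_{13}u_{23}u_{43}v_{12}v_{32}v_{42}-1$, $u_{14}u_{24}u_{34}v_{14}v_{24}v_{34}-1$. Connectedness is with respect to the usual (classical) topology on $\mathbb{C}^{24}$. *)

theory Defs
  imports "HOL-Analysis.Analysis"
begin

inductive_set poly_fun :: "(complex^'n \<Rightarrow> complex) set" where
  pf_const: "(\<lambda>x. c) \<in> poly_fun"
| pf_coord: "(\<lambda>x. x $ i) \<in> poly_fun"
| pf_add: "f \<in> poly_fun \<Longrightarrow> g \<in> poly_fun \<Longrightarrow> (\<lambda>x. f x + g x) \<in> poly_fun"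
| pf_mult: "f \<in> poly_fun \<Longrightarrow> g \<in> poly_fun \<Longrightarrow> (\<lambda>x. f x * g x) \<in> poly_fun"

definition zariski_closed :: "(complex^'n) set \<Rightarrow> bool" where
  "zariski_closed S \<longleftrightarrow> (\<exists>F \<subseteq> poly_fun. S = {x. \<forall>f\<in>F. f x = 0})"

definition irreducible_variety :: "(complex^'n) set \<Rightarrow> bool" where
  "irreducible_variety S \<longleftrightarrow> zariski_closed S \<and> S \<noteq> {} \<and>
     (\<forall>A B. zariski_closed A \<longrightarrow> zariski_closed B \<longrightarrow> S = A \<union> B \<longrightarrow> S = A \<or> S = B)"

definition irr_chain_in :: "(complex^'n) set \<Rightarrow> nat \<Rightarrow> bool" where
  "irr_chain_in S d \<longleftrightarrow> (\<exists>c :: nat \<Rightarrow> (complex^'n) set.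
      (\<forall>i\<le>d. irreducible_variety (c i)) \<and> (\<forall>i<d. c i \<subset> c (Suc i)) \<and> c d \<subseteq> S)"

definition variety_dim_eq :: "(complex^'n) set \<Rightarrow> nat \<Rightarrow> bool" where
  "variety_dim_eq S d \<longleftrightarrow> irr_chain_in S d \<and> \<not> irr_chain_in S (Suc d)"

definition vanishing_ideal :: "(complex^'n) set \<Rightarrow> (complex^'n \<Rightarrow> complex) set" where
  "vanishing_ideal S = {f \<in> poly_fun. \<forall>x\<in>S. f x = 0}"

definition zariski_tangent :: "(complex^'n) set \<Rightarrow> complex^'n \<Rightarrow> (complex^'n) set" where
  "zariski_tangent S p = (\<Inter>f\<in>vanishing_ideal S. {v. frechet_derivative f (at p) v = 0})"

text \<open>Smooth variety of dimension d (Jacobian criterion): at every point the tangent space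
  has complex dimension d, i.e. real dimension 2d.\<close>
definition smooth_variety_dim :: "(complex^'n) set \<Rightarrow> nat \<Rightarrow> bool" where
  "smooth_variety_dim S d \<longleftrightarrow> variety_dim_eq S d \<and>
     (\<forall>p\<in>S. dim (zariski_tangent S p) = 2 * d)"

text \<open>u_ij (i \<noteq> j in {1..4}) is coordinate 3(i-1) + (j-1 if j<i else j-2) in 0..11;
  v_ij is the same shifted by 12.\<close>
definition pidx :: "nat \<Rightarrow> nat \<Rightarrow> nat" where
  "pidx i j = 3 * (i - 1) + (if j < i then j - 1 else j - 2)"

definition ucoord :: "complex^24 \<Rightarrow> nat \<Rightarrow> nat \<Rightarrow> complex" where
  "ucoord x i j = x $ (of_nat (pidx i j) :: 24)"

definition vcoord :: "complex^24 \<Rightarrow> nat \<Rightarrow> nat \<Rightarrow> complex" where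
  "vcoord x i j = x $ (of_nat (12 + pidx i j) :: 24)"

definition internal_rel :: "(nat \<Rightarrow> nat \<Rightarrow> complex) \<Rightarrow> bool" where
  "internal_rel u \<longleftrightarrow>
     u 1 2 * u 1 3 - u 1 3 + 1 = 0 \<and>
     u 1 2 * u 1 4 - u 1 2 + 1 = 0 \<and>
     u 2 1 * u 2 3 - u 2 1 + 1 = 0 \<and>
     u 2 1 * u 2 4 - u 2 4 + 1 = 0 \<and>
     u 3 1 * u 3 4 - u 3 1 + 1 = 0 \<and>
     u 3 2 * u 3 4 - u 3 4 + 1 = 0 \<and>
     u 4 1 * u 4 3 - u 4 3 + 1 = 0 \<and>
     u 4 2 * u 4 3 - u 4 2 + 1 = 0"

definition gluing_rel :: "(nat \<Rightarrow> nat \<Rightarrow> complex) \<Rightarrow> (nat \<Rightarrow> nat \<Rightarrow> complex) \<Rightarrow> bool" where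
  "gluing_rel u v \<longleftrightarrow>
     u 1 3 * u 1 4 * u 2 3 * v 2 1 * v 2 4 * v 3 1 - 1 = 0 \<and>
     u 3 1 * u 3 2 * u 4 1 * v 1 2 * v 1 3 * v 4 2 - 1 = 0 \<and>
     u 2 1 * u 2 4 * u 3 4 * v 2 3 * v 4 1 * v 4 3 - 1 = 0 \<and>
     u 1 2 * u 4 2 * u 4 3 * v 1 4 * v 3 2 * v 3 4 - 1 = 0 \<and>
     u 2 1 * u 3 1 * u 4 1 * v 2 1 * v 3 1 * v 4 1 - 1 = 0 \<and>
     u 1 2 * u 3 2 * u 4 2 * v 1 3 * v 2 3 * v 4 3 - 1 = 0 \<and>
     u 1 3 * u 2 3 * u 4 3 * v 1 2 * v 3 2 * v 4 2 - 1 = 0 \<and>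
     u 1 4 * u 2 4 * u 3 4 * v 1 4 * v 2 4 * v 3 4 - 1 = 0"

definition Defor_fig8 :: "(complex^24) set" where
  "Defor_fig8 = {x. internal_rel (ucoord x) \<and> internal_rel (vcoord x) \<and>
                    gluing_rel (ucoord x) (vcoord x)}"

end

theory Submission
  imports Defs "HOL-Computational_Algebra.Polynomial_Factorial" "HOL-Computational_Algebra.Field_as_Ring"
begin

text \<open>
  On each tetrahedron the internal relations leave one free coordinate per vertex. Solving the edge
  relations, all coordinates become functions of five parameters \<open>t, p, q, r, s\<close>, and with
  \<open>g(x) = (1 - x)(1 - t x)\<close> the face relations read \<open>t p s = g(q) g(r)\<close>, \<open>t q r = g(p) g(s)\<close>,
  \<open>p q g(r) g(s) = t r\<^sup>2 s\<^sup>2\<close>, \<open>r s g(p) g(q) = t p\<^sup>2 q\<^sup>2\<close>. Elimination splits the solutions into the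
  symmetric ones (\<open>p = r\<close>, \<open>q = s\<close>), those for which \<open>p, q\<close> and \<open>r, s\<close> are pairs of roots of two cubics
  \<open>t z\<^sup>3 - (1 + t) z\<^sup>2 + z = const\<close> whose third roots have product \<open>1 / t\<close>, and the image of the latter
  under the involution \<open>(p, q, r, s) \<mapsto> (1/(t r), 1/(t q), 1/(t p), 1/(t s))\<close>.

  Each of the three pieces is isomorphic to a double cover \<open>w\<^sup>2 = a w + b\<close> of the complement of a curve
  \<open>d = 0\<close> in the \<open>(u, v)\<close>-plane. It is irreducible because the discriminant \<open>a\<^sup>2 + 4 b\<close> is not a square:
  the norm to the plane detects zero divisors. The same holds on generic slices \<open>v = const\<close>, which gives
  a chain of length two, while three polynomial functions on the cover are always algebraically
  dependent by counting monomials. A function vanishing on the cover is divisible by \<open>w\<^sup>2 - a w - b\<close>, so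
  the Zariski tangent space is the kernel of its differential. Finally the cover is connected since it
  has a branch point, and the pieces meet.
\<close>


subsection \<open>Polynomial functions and Zariski closed sets\<close>

text \<open>The cubic of the overview is \<open>z * gf t z\<close>. Away from \<open>p = r\<close>
  and \<open>q = s\<close>, differences of the face relations can be divided by
  \<open>q - s\<close>. This leaves three relations between \<open>A\<close>, \<open>B\<close>,
  \<open>a\<close>, \<open>b\<close> and the ratio \<open>k\<close> of the two differences, and
  their elimination ends in \<open>a = b\<close> or \<open>A^2 * b^3 = B^2 * a^3\<close>. The first
  says \<open>p * gf t p = q * gf t q\<close>, so \<open>p\<close> and \<open>q\<close> lie in one
  fibre of the cubic; the second is the first read after the involution. Hence one treatment of the
  cubic component, run in two charts, serves both twisted components. The parametrisations have
  denominators, while irreducibility and tangent spaces are tested against polynomial functions. So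
  each component gets a single polynomial \<open>d\<close> whose inverse supplies every inverse that
  is needed. The remainder modulo \<open>w^2 - a w - b\<close> is always kept together with its
  cofactor, because a tangent computation has to leave the cover. Classical connectedness is not
  derived from irreducibility: the base is connected, and one point where the two sheets meet ties
  them together.\<close>

lemma poly_fun_uminus: "f \<in> poly_fun \<Longrightarrow> (\<lambda>x. - f x) \<in> poly_fun"
  using pf_mult[OF pf_const[of "-1"], of f] by simp

lemma poly_fun_diff: "f \<in> poly_fun \<Longrightarrow> g \<in> poly_fun \<Longrightarrow> (\<lambda>x. f x - g x) \<in> poly_fun"
  using pf_add[OF _ poly_fun_uminus, of f g] by simp

lemma poly_fun_power: "f \<in> poly_fun \<Longrightarrow> (\<lambda>x. f x ^ n) \<in> poly_fun"
  by (induction n) (simp_all add: pf_const pf_mult)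

lemmas poly_fun_intros = pf_const pf_coord pf_add pf_mult poly_fun_uminus poly_fun_diff poly_fun_power

lemma poly_fun_differentiable: "f \<in> poly_fun \<Longrightarrow> f differentiable (at x)"
proof (induction rule: poly_fun.induct)
  case (pf_coord i)
  show ?case
    using bounded_linear_imp_has_derivative[OF bounded_linear_vec_nth] differentiable_def by blast
qed simp_all

lemma zariski_closedI: "F \<subseteq> poly_fun \<Longrightarrow> zariski_closed {x. \<forall>f\<in>F. f x = 0}"
  unfolding zariski_closed_def by blast

lemma zariski_closed_zero: "f \<in> poly_fun \<Longrightarrow> zariski_closed {x. f x = 0}"
  using zariski_closedI[of "{f}"] by simp

lemma zariski_closed_Int:
  assumes "zariski_closed S" "zariski_closed T" shows "zariski_closed (S \<inter> T)"
proof -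
  obtain F where F: "F \<subseteq> poly_fun" "S = {x. \<forall>f\<in>F. f x = 0}"
    using assms(1) unfolding zariski_closed_def by blast
  obtain G where G: "G \<subseteq> poly_fun" "T = {x. \<forall>f\<in>G. f x = 0}"
    using assms(2) unfolding zariski_closed_def by blast
  have "S \<inter> T = {x. \<forall>f\<in>F\<union>G. f x = 0}" using F G by auto
  then show ?thesis using zariski_closedI[of "F \<union> G"] F G by simp
qed

lemma zariski_closed_singleton: "zariski_closed {p}"
proof -
  have eq: "{p} = {x. \<forall>f\<in>range (\<lambda>i x. x $ i - p $ i). f x = 0}"
    by (auto simp: vec_eq_iff)
  show ?thesis
    by (subst eq, rule zariski_closedI) (auto intro!: poly_fun_diff pf_coord pf_const)
qed

lemma irreducible_variety_singleton: "irreducible_variety {p}"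
  unfolding irreducible_variety_def
proof (intro conjI allI impI)
  fix A B assume "{p} = A \<union> B"
  then have "A \<subseteq> {p}" "B \<subseteq> {p}" "p \<in> A \<or> p \<in> B" by auto
  then show "{p} = A \<or> {p} = B" by blast
qed (simp_all add: zariski_closed_singleton)

lemma zariski_closed_separate:
  assumes "zariski_closed A" "z \<notin> A"
  obtains f where "f \<in> poly_fun" "\<And>x. x \<in> A \<Longrightarrow> f x = 0" "f z \<noteq> 0"
  using assms unfolding zariski_closed_def by blast

lemma irreducible_varietyI:
  assumes "zariski_closed S" "S \<noteq> {}"
    and "\<And>f g. f \<in> poly_fun \<Longrightarrow> g \<in> poly_fun \<Longrightarrow> (\<And>x. x \<in> S \<Longrightarrow> f x * g x = 0) \<Longrightarrow>
           (\<forall>x\<in>S. f x = 0) \<or> (\<forall>x\<in>S. g x = 0)"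
  shows "irreducible_variety S"
  unfolding irreducible_variety_def
proof (intro conjI allI impI)
  fix A B assume AB: "zariski_closed A" "zariski_closed B" "S = A \<union> B"
  show "S = A \<or> S = B"
  proof (rule ccontr)
    assume "\<not> (S = A \<or> S = B)"
    then obtain z w where "z \<in> S" "z \<notin> A" "w \<in> S" "w \<notin> B" using AB by blast
    obtain f where f: "f \<in> poly_fun" "\<And>x. x \<in> A \<Longrightarrow> f x = 0" "f z \<noteq> 0"
      using zariski_closed_separate[OF AB(1) \<open>z \<notin> A\<close>] by blast
    obtain g where g: "g \<in> poly_fun" "\<And>x. x \<in> B \<Longrightarrow> g x = 0" "g w \<noteq> 0"
      using zariski_closed_separate[OF AB(2) \<open>w \<notin> B\<close>] by blast
    have "f x * g x = 0" if "x \<in> S" for x using that AB(3) f(2) g(2) by auto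
    from assms(3)[OF f(1) g(1) this] \<open>z \<in> S\<close> \<open>w \<in> S\<close> f(3) g(3) show False by blast
  qed
qed (use assms in auto)

lemma irreducible_variety_mult:
  assumes S: "irreducible_variety S" and fg: "f \<in> poly_fun" "g \<in> poly_fun"
    and 0: "\<And>x. x \<in> S \<Longrightarrow> f x * g x = 0"
  shows "(\<forall>x\<in>S. f x = 0) \<or> (\<forall>x\<in>S. g x = 0)"
proof -
  have "zariski_closed (S \<inter> {x. f x = 0})" "zariski_closed (S \<inter> {x. g x = 0})"
    using S fg by (auto simp: irreducible_variety_def intro!: zariski_closed_Int zariski_closed_zero)
  moreover have "S = (S \<inter> {x. f x = 0}) \<union> (S \<inter> {x. g x = 0})" using 0 by auto
  ultimately have "S = S \<inter> {x. f x = 0} \<or> S = S \<inter> {x. g x = 0}"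
    using S unfolding irreducible_variety_def by blast
  then show ?thesis by blast
qed

subsection \<open>Chains of irreducible sets and algebraic dependence\<close>

text \<open>Gaussian elimination by induction on the equations: an unknown \<open>i0\<close> with
  nonzero coefficient is solved for, which costs one equation and one unknown. It drives the
  monomial count behind algebraic dependence.\<close>

lemma homogeneous_system_nontrivial:
  fixes M :: "'i \<Rightarrow> 'j \<Rightarrow> 'a::field"
  assumes "finite J" "finite I" "card J < card I"
  shows "\<exists>c. (\<exists>i\<in>I. c i \<noteq> 0) \<and> (\<forall>j\<in>J. (\<Sum>i\<in>I. c i * M i j) = 0)"
  using assms
proof (induction J arbitrary: I M rule: finite_induct)
  case empty
  then have "I \<noteq> {}" by auto
  then show ?case by (intro exI[of _ "\<lambda>_. 1"]) auto
next
  case (insert j J)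
  show ?case
  proof (cases "\<forall>i\<in>I. M i j = 0")
    case True
    have "card J < card I" using insert by simp
    from insert.IH[OF insert.prems(1) this] obtain c where
      "\<exists>i\<in>I. c i \<noteq> 0" "\<forall>j\<in>J. (\<Sum>i\<in>I. c i * M i j) = 0" by blast
    then show ?thesis using True by (intro exI[of _ c]) auto
  next
    case False
    then obtain i0 where i0: "i0 \<in> I" "M i0 j \<noteq> 0" by auto
    define I' where "I' = I - {i0}"
    have I': "finite I'" "card J < card I'" using insert i0 by (auto simp: I'_def)
    define M' where "M' i l = M i l - M i j / M i0 j * M i0 l" for i l
    from insert.IH[OF I', of M'] obtain c where c: "\<exists>i\<in>I'. c i \<noteq> 0"
      "\<And>l. l \<in> J \<Longrightarrow> (\<Sum>i\<in>I'. c i * M' i l) = 0" by blast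
    define c0 where "c0 = - (\<Sum>i\<in>I'. c i * M i j) / M i0 j"
    define c' where "c' = c(i0 := c0)"
    have sum: "(\<Sum>i\<in>I. c' i * M i l) = (\<Sum>i\<in>I'. c i * M i l) + c0 * M i0 l" for l
    proof -
      have "(\<Sum>i\<in>I. c' i * M i l) = c' i0 * M i0 l + (\<Sum>i\<in>I'. c' i * M i l)"
        unfolding I'_def by (rule sum.remove) (use insert i0 in auto)
      also have "(\<Sum>i\<in>I'. c' i * M i l) = (\<Sum>i\<in>I'. c i * M i l)"
        by (rule sum.cong) (auto simp: c'_def I'_def)
      finally show ?thesis by (simp add: c'_def)
    qed
    have "(\<Sum>i\<in>I. c' i * M i l) = 0" if "l \<in> insert j J" for l
    proof (cases "l = j")
      case True then show ?thesis using i0 by (simp add: sum c0_def)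
    next
      case False
      then have "0 = (\<Sum>i\<in>I'. c i * M' i l)" using that c by simp
      also have "\<dots> = (\<Sum>i\<in>I'. c i * M i l) - (\<Sum>i\<in>I'. c i * M i j) / M i0 j * M i0 l"
        by (simp add: M'_def algebra_simps sum_subtractf sum_distrib_left sum_divide_distrib)
      finally show ?thesis by (simp add: sum c0_def)
    qed
    moreover have "\<exists>i\<in>I. c' i \<noteq> 0" using c(1) by (auto simp: c'_def I'_def)
    ultimately show ?thesis by blast
  qed
qed

text \<open>A relation between the powers of \<open>f\<close> on \<open>W\<close>, divided by the highest possible power of \<open>f\<close>,
  restricts to its lowest coefficient on \<open>V\<close>.\<close>
lemma power_relation_trivial:
  assumes W: "irreducible_variety W" and V: "V \<subseteq> W"
    and f: "f \<in> poly_fun" "\<And>x. x \<in> V \<Longrightarrow> f x = 0" "\<exists>x\<in>W. f x \<noteq> 0"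
    and g: "\<And>j. g j \<in> poly_fun"
    and Z: "\<And>j. j \<le> N \<Longrightarrow> (\<And>x. x \<in> V \<Longrightarrow> g j x = 0) \<Longrightarrow> Z j"
      "\<And>j x. j \<le> N \<Longrightarrow> Z j \<Longrightarrow> g j x = 0"
    and rel: "\<And>x. x \<in> W \<Longrightarrow> (\<Sum>j\<le>N. g j x * f x ^ j) = 0"
    and j: "j \<le> N"
  shows "Z j"
  using j
proof (induction j rule: less_induct)
  case (less j)
  \<comment> \<open>\<open>Z j\<close> expresses that the coefficient \<open>g j\<close> vanishes
    formally, hence on all of \<open>W\<close> and not only on \<open>V\<close>. So the terms below
    \<open>j\<close> disappear and \<open>f ^ j\<close> can be cancelled by irreducibility.\<close>
  define h where "h x = (\<Sum>i\<in>{j..N}. g i x * f x ^ (i - j))" for x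
  have "(\<lambda>x. \<Sum>i\<in>I. g i x * f x ^ (i - j)) \<in> poly_fun" if "finite I" for I
    using that by (induction I rule: finite_induct) (auto intro!: poly_fun_intros f g)
  then have hp: "h \<in> poly_fun" unfolding h_def by simp
  have "f x ^ j * h x = 0" if "x \<in> W" for x
  proof -
    have "(\<Sum>i\<le>N. g i x * f x ^ i) = (\<Sum>i\<in>{j..N}. g i x * f x ^ i)"
      by (rule sum.mono_neutral_right) (use less Z(2) in auto)
    also have "\<dots> = f x ^ j * h x"
      unfolding h_def sum_distrib_left by (rule sum.cong) (auto simp: algebra_simps simp flip: power_add)
    finally show ?thesis using rel[OF that] by simp
  qed
  then have "\<forall>x\<in>W. h x = 0"
    using irreducible_variety_mult[OF W poly_fun_power[OF f(1)] hp, of j] f(3) by auto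
  moreover have "h x = g j x" if "x \<in> V" for x
  proof -
    have "h x = (\<Sum>i\<in>{j}. g i x * f x ^ (i - j))"
      unfolding h_def by (rule sum.mono_neutral_right) (use less f(2)[OF that] in auto)
    then show ?thesis by simp
  qed
  ultimately show "Z j" using Z(1)[OF less.prems] V by (metis subsetD)
qed

lemma sum_poly_fun: "(\<And>i. i \<in> I \<Longrightarrow> f i \<in> poly_fun) \<Longrightarrow> (\<lambda>x. \<Sum>i\<in>I. f i x) \<in> poly_fun"
  by (induction I rule: infinite_finite_induct) (simp_all add: pf_const pf_add)

text \<open>Strictness gives \<open>F i\<close> vanishing on \<open>W i\<close> but not on
  \<open>W (Suc i)\<close>. In a relation between \<open>F 0\<close>, \<open>F 1\<close>,
  \<open>F 2\<close> on \<open>W 3\<close>, restricting step by step to \<open>W 2\<close>,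
  \<open>W 1\<close>, \<open>W 0\<close> kills all coefficients, so the three functions would be
  algebraically independent.\<close>

lemma no_chain_of_dependent:
  assumes dep: "\<And>f g h :: complex^'n \<Rightarrow> complex. f \<in> poly_fun \<Longrightarrow> g \<in> poly_fun \<Longrightarrow> h \<in> poly_fun \<Longrightarrow>
    \<exists>N c. (\<exists>i\<le>N. \<exists>j\<le>N. \<exists>k\<le>N. c i j k \<noteq> 0) \<and>
      (\<forall>x\<in>S. (\<Sum>k\<le>N. (\<Sum>j\<le>N. (\<Sum>i\<le>N. c i j k * f x ^ i) * g x ^ j) * h x ^ k) = 0)"
  shows "\<not> irr_chain_in S 3"
proof
  assume "irr_chain_in S 3"
  then obtain W :: "nat \<Rightarrow> (complex^'n) set" where
    irr: "\<And>i. i \<le> 3 \<Longrightarrow> irreducible_variety (W i)" and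
    sub: "\<And>i. i < 3 \<Longrightarrow> W i \<subset> W (Suc i)" and top: "W 3 \<subseteq> S"
    unfolding irr_chain_in_def by blast
  have "\<exists>f\<in>poly_fun. (\<forall>x\<in>W i. f x = 0) \<and> (\<exists>x\<in>W (Suc i). f x \<noteq> 0)" if "i < 3" for i
  proof -
    obtain z where z: "z \<in> W (Suc i)" "z \<notin> W i" using sub[OF \<open>i < 3\<close>] by blast
    have "zariski_closed (W i)" using irr[of i] \<open>i < 3\<close> unfolding irreducible_variety_def by simp
    from zariski_closed_separate[OF this z(2)] obtain f
      where "f \<in> poly_fun" "\<And>x. x \<in> W i \<Longrightarrow> f x = 0" "f z \<noteq> 0" by blast
    then show ?thesis using z(1) by blast
  qed
  then obtain F where F: "\<And>i. i < 3 \<Longrightarrow> F i \<in> poly_fun" "\<And>i x. i < 3 \<Longrightarrow> x \<in> W i \<Longrightarrow> F i x = 0"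
    "\<And>i. i < 3 \<Longrightarrow> \<exists>x\<in>W (Suc i). F i x \<noteq> 0" by metis
  have ne: "\<exists>x. x \<in> W 0" using irr[of 0] unfolding irreducible_variety_def by auto
  have step: "Z j" if "n < 3" "\<And>j. g j \<in> poly_fun"
      "\<And>j. j \<le> N \<Longrightarrow> (\<And>x. x \<in> W n \<Longrightarrow> g j x = 0) \<Longrightarrow> Z j"
      "\<And>j x. j \<le> N \<Longrightarrow> Z j \<Longrightarrow> g j x = 0"
      "\<And>x. x \<in> W (Suc n) \<Longrightarrow> (\<Sum>j\<le>N. g j x * F n x ^ j) = 0" "j \<le> N"
    for n g N Z j
  proof (rule power_relation_trivial[of "W (Suc n)" "W n" "F n" g N Z j])
    show "irreducible_variety (W (Suc n))" "W n \<subseteq> W (Suc n)" using irr[of "Suc n"] sub[of n] that(1) by auto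
  qed (use that F in blast)+
  have pf: "F 0 \<in> poly_fun" "F 1 \<in> poly_fun" "F 2 \<in> poly_fun" using F(1) by auto
  obtain N c where c: "\<exists>i\<le>N. \<exists>j\<le>N. \<exists>k\<le>N. c i j k \<noteq> 0"
    "\<And>x. x \<in> S \<Longrightarrow> (\<Sum>k\<le>N. (\<Sum>j\<le>N. (\<Sum>i\<le>N. c i j k * F 0 x ^ i) * F 1 x ^ j) * F 2 x ^ k) = 0"
    using dep[OF pf] by blast
  have one: "\<forall>i\<le>N. e i = 0" if "\<And>x. x \<in> W 1 \<Longrightarrow> (\<Sum>i\<le>N. e i * F 0 x ^ i) = 0" for e
  proof (intro allI impI, rule step[of 0 "\<lambda>i _. e i" N "\<lambda>i. e i = 0"])
    show "e j = 0" if "\<And>x. x \<in> W 0 \<Longrightarrow> e j = 0" for j using that ne by blast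
  qed (use that in \<open>auto intro: pf_const\<close>)
  have two: "\<forall>j\<le>N. \<forall>i\<le>N. e i j = 0"
    if "\<And>x. x \<in> W 2 \<Longrightarrow> (\<Sum>j\<le>N. (\<Sum>i\<le>N. e i j * F 0 x ^ i) * F 1 x ^ j) = 0" for e
  proof (intro allI impI, rule step[of 1 "\<lambda>j x. \<Sum>i\<le>N. e i j * F 0 x ^ i" N "\<lambda>j. \<forall>i\<le>N. e i j = 0",
        rule_format])
    fix j i assume "\<And>x. x \<in> W 1 \<Longrightarrow> (\<Sum>i\<le>N. e i j * F 0 x ^ i) = 0" "i \<le> N"
    with one[of "\<lambda>i. e i j"] show "e i j = 0" by blast
  qed (use that in \<open>auto simp: numeral_2_eq_2 intro!: sum_poly_fun pf_mult pf_const poly_fun_power pf\<close>)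
  have "\<forall>k\<le>N. \<forall>j\<le>N. \<forall>i\<le>N. c i j k = 0"
  proof (intro allI impI, rule step[of 2 "\<lambda>k x. \<Sum>j\<le>N. (\<Sum>i\<le>N. c i j k * F 0 x ^ i) * F 1 x ^ j" N
        "\<lambda>k. \<forall>j\<le>N. \<forall>i\<le>N. c i j k = 0", rule_format])
    fix k j i
    assume "\<And>x. x \<in> W 2 \<Longrightarrow> (\<Sum>j\<le>N. (\<Sum>i\<le>N. c i j k * F 0 x ^ i) * F 1 x ^ j) = 0" "j \<le> N" "i \<le> N"
    with two[of "\<lambda>i j. c i j k"] show "c i j k = 0" by blast
  next
    fix x assume "x \<in> W (Suc 2)"
    then show "(\<Sum>k\<le>N. (\<Sum>j\<le>N. (\<Sum>i\<le>N. c i j k * F 0 x ^ i) * F 1 x ^ j) * F 2 x ^ k) = 0"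
      using c(2) top by (auto simp: eval_nat_numeral)
  qed (auto intro!: sum_poly_fun pf_mult pf_const poly_fun_power pf simp del: One_nat_def)
  with c(1) show False by blast
qed

subsection \<open>Bivariate polynomials\<close>

text \<open>The outer variable is \<open>v\<close> and the coefficients are polynomials in
  \<open>u\<close>. Thus \<open>poly P [:v:]\<close> is the restriction of \<open>P\<close> to a
  slice \<open>v = const\<close>, again a polynomial.\<close>

definition ev2 :: "complex poly poly \<Rightarrow> complex \<Rightarrow> complex \<Rightarrow> complex" where
  "ev2 P u v = poly (poly P [:v:]) u"

lemma ev2_simps [simp]:
  "ev2 0 u v = 0" "ev2 1 u v = 1" "ev2 (P + Q) u v = ev2 P u v + ev2 Q u v"
  "ev2 (P - Q) u v = ev2 P u v - ev2 Q u v" "ev2 (- P) u v = - ev2 P u v"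
  "ev2 (P * Q) u v = ev2 P u v * ev2 Q u v" "ev2 (P ^ n) u v = ev2 P u v ^ n"
  "ev2 (numeral k) u v = numeral k" "ev2 (of_nat m) u v = of_nat m"
  "ev2 (pCons p P) u v = poly p u + v * ev2 P u v"
  by (simp_all add: ev2_def)

lemma ev2_eq_0D:
  assumes "\<And>u v. ev2 P u v = 0" shows "P = 0"
proof (rule ccontr)
  assume "P \<noteq> 0"
  have "poly P [:v:] = 0" for v
    using assms poly_all_0_iff_0 unfolding ev2_def by blast
  then have "range (\<lambda>v::complex. [:v:]) \<subseteq> {x. poly P x = 0}" by auto
  moreover have "infinite (range (\<lambda>v::complex. [:v:]))"
    by (subst finite_image_iff) (auto simp: inj_on_def infinite_UNIV_char_0)
  ultimately show False using poly_roots_finite[OF \<open>P \<noteq> 0\<close>] infinite_super by blast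
qed

lemma ev2_eq_0_off:
  assumes "d \<noteq> 0" "\<And>u v. ev2 d u v \<noteq> 0 \<Longrightarrow> ev2 P u v = 0" shows "P = 0"
proof -
  have "ev2 (d * P) u v = 0" for u v using assms(2)[of u v] by auto
  then have "d * P = 0" by (rule ev2_eq_0D)
  with assms(1) show ?thesis by simp
qed

text \<open>One bound for both degrees, so that \<open>(n + 1)^2\<close> coefficients determine the
  polynomial.\<close>

definition bideg :: "nat \<Rightarrow> complex poly poly \<Rightarrow> bool" where
  "bideg n P \<longleftrightarrow> degree P \<le> n \<and> (\<forall>i. degree (coeff P i) \<le> n)"

lemma bideg_mono: "bideg m P \<Longrightarrow> m \<le> n \<Longrightarrow> bideg n P"
  by (auto simp: bideg_def intro: le_trans)

lemma bideg_exists: "\<exists>n. bideg n P"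
proof -
  define n where "n = degree P + (\<Sum>i\<le>degree P. degree (coeff P i))"
  have "degree (coeff P i) \<le> n" for i
  proof (cases "i \<le> degree P")
    case True
    then have "degree (coeff P i) \<le> (\<Sum>i\<le>degree P. degree (coeff P i))" by (intro member_le_sum) auto
    then show ?thesis by (simp add: n_def)
  qed (simp add: coeff_eq_0)
  moreover have "degree P \<le> n" by (simp add: n_def)
  ultimately show ?thesis unfolding bideg_def by blast
qed

lemma bideg_add: "bideg n P \<Longrightarrow> bideg n Q \<Longrightarrow> bideg n (P + Q)"
  by (auto simp: bideg_def intro!: degree_add_le)

lemma bideg_mult: assumes "bideg m P" "bideg n Q" shows "bideg (m + n) (P * Q)"
proof -
  have "degree (coeff P i * coeff Q j) \<le> m + n" for i j
    using assms degree_mult_le[of "coeff P i" "coeff Q j"] unfolding bideg_def by (meson add_mono le_trans)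
  moreover have "degree (P * Q) \<le> m + n"
    using assms degree_mult_le[of P Q] unfolding bideg_def by linarith
  ultimately show ?thesis unfolding bideg_def coeff_mult by (auto intro!: degree_sum_le)
qed

subsection \<open>Irreducibility of quadratic covers\<close>

text \<open>The factor \<open>\<beta>^2\<close> makes this "not a square in the fraction field"
  without forming that field; it also excludes \<open>D = 0\<close>.\<close>

definition nonsquare :: "'r::idom \<Rightarrow> bool" where
  "nonsquare D \<longleftrightarrow> (\<forall>h \<beta>. h^2 = \<beta>^2 * D \<longrightarrow> \<beta> = 0)"

text \<open>The expression is the norm of \<open>\<alpha> + \<beta> w\<close> for a root
  \<open>w\<close> of \<open>w^2 = a w + b\<close>. Completing the square turns its vanishing into a
  square equal to \<open>\<beta>^2\<close> times the discriminant.\<close>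

lemma norm_eq_0D:
  fixes a b \<alpha> \<beta> :: "'r::idom"
  assumes "nonsquare (a^2 + 4 * b)" "\<alpha>^2 + \<alpha> * \<beta> * a - \<beta>^2 * b = 0"
  shows "\<alpha> = 0 \<and> \<beta> = 0"
proof -
  have "(2 * \<alpha> + \<beta> * a)^2 = 4 * (\<alpha>^2 + \<alpha> * \<beta> * a - \<beta>^2 * b) + \<beta>^2 * (a^2 + 4 * b)"
    by (simp add: power2_eq_square algebra_simps)
  then have "\<beta> = 0" using assms unfolding nonsquare_def by simp
  with assms(2) show ?thesis by simp
qed

lemma complex_quadratic_root: "\<exists>w. w^2 = a * w + (b::complex)"
proof
  define s where "s = csqrt (a^2 + 4 * b)"
  have "s^2 = a^2 + 4 * b" by (simp add: s_def)
  then have "(a + s)^2 = 4 * (a * ((a + s) / 2) + b)" by (simp add: power2_eq_square algebra_simps)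
  then show "((a + s) / 2)^2 = a * ((a + s) / 2) + b" by (simp add: power_divide)
qed

text \<open>Up to a factor without zeros every function is \<open>\<alpha> + \<beta> w\<close>. If a
  product vanishes on \<open>S\<close>, the product of the norms vanishes on the base, so one norm
  is zero and with it that function. The ring is left abstract because the argument is needed over
  two variables for surfaces and over one variable for slices.\<close>

lemma irreducible_quadratic_cover:
  fixes ev :: "'r::idom \<Rightarrow> 'b \<Rightarrow> complex" and S :: "(complex^'n) set"
  assumes S: "zariski_closed S"
    and ev: "\<And>x y p. ev (x + y) p = ev x p + ev y p" "\<And>x y p. ev (x - y) p = ev x p - ev y p"
      "\<And>x y p. ev (x * y) p = ev x p * ev y p"
    and D: "D \<noteq> {}" "\<And>x. (\<And>p. p \<in> D \<Longrightarrow> ev x p = 0) \<Longrightarrow> x = 0"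
    and ns: "nonsquare (a^2 + 4 * b)"
    and red: "\<And>f. f \<in> poly_fun \<Longrightarrow> \<exists>\<alpha> \<beta> e. \<forall>z\<in>S. e z \<noteq> 0 \<and> e z * f z = ev \<alpha> (\<pi> z) + ev \<beta> (\<pi> z) * w z"
    and surj: "\<And>p y. p \<in> D \<Longrightarrow> y^2 = ev a p * y + ev b p \<Longrightarrow> \<exists>z\<in>S. \<pi> z = p \<and> w z = y"
  shows "irreducible_variety S"
proof (rule irreducible_varietyI)
  obtain p where "p \<in> D" using D by blast
  then show "S \<noteq> {}" using surj complex_quadratic_root by blast
next
  fix f g assume fg: "f \<in> poly_fun" "g \<in> poly_fun" "\<And>x. x \<in> S \<Longrightarrow> f x * g x = 0"
  obtain \<alpha> \<beta> e where 1: "\<And>z. z \<in> S \<Longrightarrow> e z \<noteq> (0::complex) \<and> e z * f z = ev \<alpha> (\<pi> z) + ev \<beta> (\<pi> z) * w z"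
    using red[OF fg(1)] by blast
  obtain \<alpha>' \<beta>' e' where 2: "\<And>z. z \<in> S \<Longrightarrow> e' z \<noteq> (0::complex) \<and> e' z * g z = ev \<alpha>' (\<pi> z) + ev \<beta>' (\<pi> z) * w z"
    using red[OF fg(2)] by blast
  define n where "n = (\<lambda>\<alpha> \<beta>. \<alpha>^2 + \<alpha> * \<beta> * a - \<beta>^2 * b)"
  have n0: "ev (n \<alpha> \<beta>) p = 0" if "y^2 = ev a p * y + ev b p" "ev \<alpha> p + ev \<beta> p * y = 0" for \<alpha> \<beta> p y
  proof -
    have "ev (n \<alpha> \<beta>) p = (ev \<alpha> p + ev \<beta> p * y) * (ev \<alpha> p + ev \<beta> p * (ev a p - y))
        + (ev \<beta> p)^2 * (y^2 - ev a p * y - ev b p)"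
      unfolding n_def by (simp add: ev power2_eq_square algebra_simps)
    then show ?thesis using that by simp
  qed
  have "n \<alpha> \<beta> * n \<alpha>' \<beta>' = 0"
  proof (rule D(2))
    fix p assume "p \<in> D"
    obtain y where y: "y^2 = ev a p * y + ev b p" using complex_quadratic_root by blast
    then obtain z where z: "z \<in> S" "\<pi> z = p" "w z = y" using surj[OF \<open>p \<in> D\<close>] by blast
    have "(ev \<alpha> p + ev \<beta> p * y) * (ev \<alpha>' p + ev \<beta>' p * y) = e z * e' z * (f z * g z)"
      using 1[OF z(1)] 2[OF z(1)] z by (metis mult.assoc mult.left_commute)
    then have "ev \<alpha> p + ev \<beta> p * y = 0 \<or> ev \<alpha>' p + ev \<beta>' p * y = 0"
      using fg(3)[OF z(1)] by simp
    then show "ev (n \<alpha> \<beta> * n \<alpha>' \<beta>') p = 0" using n0[OF y] ev(3) by auto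
  qed
  moreover have ev0: "ev 0 p = 0" for p using ev(1)[of 0 0] by simp
  ultimately have "\<alpha> = 0 \<and> \<beta> = 0 \<or> \<alpha>' = 0 \<and> \<beta>' = 0"
    using norm_eq_0D[OF ns] unfolding n_def by auto
  then show "(\<forall>x\<in>S. f x = 0) \<or> (\<forall>x\<in>S. g x = 0)"
  proof (elim disjE conjE)
    assume "\<alpha> = 0" "\<beta> = 0"
    then show ?thesis using 1 ev0 by (simp, metis)
  next
    assume "\<alpha>' = 0" "\<beta>' = 0"
    then show ?thesis using 2 ev0 by (simp, metis)
  qed
qed (fact S)

subsection \<open>Regular functions on the complement of a plane curve\<close>

text \<open>These are total functions, with \<open>inverse\<close> equal to 0 on the curve
  \<open>d = 0\<close>; identities between them are asserted only where \<open>d\<close> is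
  nonzero.\<close>

inductive_set good :: "complex poly poly \<Rightarrow> (complex \<Rightarrow> complex \<Rightarrow> complex \<Rightarrow> complex) set"
  for d :: "complex poly poly" where
  good_const: "(\<lambda>u v w. c) \<in> good d"
| good_u: "(\<lambda>u v w. u) \<in> good d"
| good_v: "(\<lambda>u v w. v) \<in> good d"
| good_w: "(\<lambda>u v w. w) \<in> good d"
| good_inverse: "(\<lambda>u v w. inverse (ev2 d u v)) \<in> good d"
| good_add: "f \<in> good d \<Longrightarrow> g \<in> good d \<Longrightarrow> (\<lambda>u v w. f u v w + g u v w) \<in> good d"
| good_mult: "f \<in> good d \<Longrightarrow> g \<in> good d \<Longrightarrow> (\<lambda>u v w. f u v w * g u v w) \<in> good d"

lemma good_uminus: "f \<in> good d \<Longrightarrow> (\<lambda>u v w. - f u v w) \<in> good d"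
  using good_mult[OF good_const[of "-1"], of f] by simp

lemma good_diff: "f \<in> good d \<Longrightarrow> g \<in> good d \<Longrightarrow> (\<lambda>u v w. f u v w - g u v w) \<in> good d"
  using good_add[OF _ good_uminus, of f d g] by simp

lemma good_power: "f \<in> good d \<Longrightarrow> (\<lambda>u v w. f u v w ^ n) \<in> good d"
  by (induction n) (simp_all add: good_const good_mult)

lemma good_poly: "(\<lambda>u v w. poly p u) \<in> good d"
  by (induction p) (simp_all add: good_const good_u good_add good_mult)

lemma good_ev2: "(\<lambda>u v w. ev2 P u v) \<in> good d"
  by (induction P) (simp_all add: good_const good_poly good_v good_add good_mult)

lemma good_poly_fun:
  assumes "f \<in> poly_fun" "\<And>i. (\<lambda>u v w. \<Phi> u v w $ i) \<in> good d"
  shows "(\<lambda>u v w. f (\<Phi> u v w)) \<in> good d"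
  using assms(1) by induction (simp_all add: good_const good_add good_mult assms(2))

lemma poly_fun_poly: "X \<in> poly_fun \<Longrightarrow> (\<lambda>z. poly p (X z)) \<in> poly_fun"
  by (induction p) (simp_all add: pf_const pf_add pf_mult)

lemma poly_fun_ev2: "X \<in> poly_fun \<Longrightarrow> Y \<in> poly_fun \<Longrightarrow> (\<lambda>z. ev2 P (X z) (Y z)) \<in> poly_fun"
  by (induction P) (simp_all add: pf_const pf_add pf_mult poly_fun_poly)

text \<open>Tangent vectors of \<open>S\<close> are tested against polynomial functions only, so a
  regular function of the three coordinates has to be made polynomial on the ambient space by a
  power of \<open>d\<close>.\<close>

lemma good_clear_denominator:
  assumes XYZ: "X \<in> poly_fun" "Y \<in> poly_fun" "Z \<in> poly_fun" and "h \<in> good d"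
  shows "\<exists>N. \<exists>f\<in>poly_fun. \<forall>z. ev2 d (X z) (Y z) \<noteq> 0 \<longrightarrow>
           ev2 d (X z) (Y z) ^ N * h (X z) (Y z) (Z z) = f z"
  using assms(4)
proof induction
  case (good_const c)
  show ?case by (intro exI[of _ 0] bexI[of _ "\<lambda>z. c"]) (auto intro: pf_const)
next
  case good_u
  show ?case by (intro exI[of _ 0] bexI[of _ X]) (auto intro: XYZ)
next
  case good_v
  show ?case by (intro exI[of _ 0] bexI[of _ Y]) (auto intro: XYZ)
next
  case good_w
  show ?case by (intro exI[of _ 0] bexI[of _ Z]) (auto intro: XYZ)
next
  case good_inverse
  show ?case by (intro exI[of _ 1] bexI[of _ "\<lambda>z. 1"]) (auto intro: pf_const)
next
  case (good_add f g)
  then obtain N M F G where *: "F \<in> poly_fun" "G \<in> poly_fun"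
    "\<And>z. ev2 d (X z) (Y z) \<noteq> 0 \<Longrightarrow> ev2 d (X z) (Y z) ^ N * f (X z) (Y z) (Z z) = F z"
    "\<And>z. ev2 d (X z) (Y z) \<noteq> 0 \<Longrightarrow> ev2 d (X z) (Y z) ^ M * g (X z) (Y z) (Z z) = G z" by blast
  have "(\<lambda>z. ev2 d (X z) (Y z) ^ M * F z + ev2 d (X z) (Y z) ^ N * G z) \<in> poly_fun"
    by (intro pf_add pf_mult poly_fun_power poly_fun_ev2 XYZ *)
  then show ?case
    by (intro exI[of _ "N + M"], elim bexI[rotated])
       (auto simp: power_add distrib_left *(3,4)[symmetric])
next
  case (good_mult f g)
  then obtain N M F G where *: "F \<in> poly_fun" "G \<in> poly_fun"
    "\<And>z. ev2 d (X z) (Y z) \<noteq> 0 \<Longrightarrow> ev2 d (X z) (Y z) ^ N * f (X z) (Y z) (Z z) = F z"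
    "\<And>z. ev2 d (X z) (Y z) \<noteq> 0 \<Longrightarrow> ev2 d (X z) (Y z) ^ M * g (X z) (Y z) (Z z) = G z" by blast
  from pf_mult[OF *(1,2)] show ?case
    by (intro exI[of _ "N + M"], elim bexI[rotated])
       (auto simp: power_add *(3,4)[symmetric])
qed

text \<open>Division by the monic polynomial \<open>w^2 - a w - b\<close>. The identity holds off
  the cover as well, with a regular cofactor \<open>C\<close>, so it can be differentiated at points
  of the cover.\<close>

lemma good_reduce:
  assumes "h \<in> good d"
  shows "\<exists>N \<alpha> \<beta>. \<exists>C\<in>good d. \<forall>u v w. ev2 d u v \<noteq> 0 \<longrightarrow>
    ev2 d u v ^ N * h u v w
      = ev2 \<alpha> u v + ev2 \<beta> u v * w + (w^2 - ev2 a u v * w - ev2 b u v) * C u v w"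
  using assms
proof induction
  case (good_const c)
  show ?case
    by (intro exI[of _ 0] exI[of _ "[:[:c:]:]"] bexI[of _ "\<lambda>u v w. 0"]) (auto intro: good.good_const)
next
  case good_u
  show ?case
    by (rule exI[of _ 0], rule exI[of _ "[:[:0,1:]:]"], rule exI[of _ 0], rule bexI[of _ "\<lambda>u v w. 0"])
       (auto intro: good.good_const)
next
  case good_v
  show ?case
    by (rule exI[of _ 0], rule exI[of _ "[:0,1:]"], rule exI[of _ 0], rule bexI[of _ "\<lambda>u v w. 0"])
       (auto intro: good.good_const)
next
  case good_w
  show ?case
    by (rule exI[of _ 0], rule exI[of _ 0], rule exI[of _ 1], rule bexI[of _ "\<lambda>u v w. 0"])
       (auto intro: good.good_const)
next
  case good_inverse
  show ?case
    by (rule exI[of _ 1], rule exI[of _ 1], rule exI[of _ 0], rule bexI[of _ "\<lambda>u v w. 0"])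
       (auto intro: good.good_const)
next
  case (good_add f g)
  from good_add.IH(1) obtain N \<alpha> \<beta> C where 1: "C \<in> good d" 
    "\<And>u v w. ev2 d u v \<noteq> 0 \<Longrightarrow> ev2 d u v ^ N * f u v w
      = ev2 \<alpha> u v + ev2 \<beta> u v * w + (w^2 - ev2 a u v * w - ev2 b u v) * C u v w" by blast
  from good_add.IH(2) obtain M \<alpha>' \<beta>' C' where 2: "C' \<in> good d"
    "\<And>u v w. ev2 d u v \<noteq> 0 \<Longrightarrow> ev2 d u v ^ M * g u v w
      = ev2 \<alpha>' u v + ev2 \<beta>' u v * w + (w^2 - ev2 a u v * w - ev2 b u v) * C' u v w" by blast
  have "(\<lambda>u v w. ev2 d u v ^ M * C u v w + ev2 d u v ^ N * C' u v w) \<in> good d"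
    by (intro good.good_add good.good_mult good_power good_ev2 1(1) 2(1))
  moreover have "ev2 d u v ^ (N + M) * (f u v w + g u v w)
      = ev2 (d ^ M * \<alpha> + d ^ N * \<alpha>') u v + ev2 (d ^ M * \<beta> + d ^ N * \<beta>') u v * w
        + (w^2 - ev2 a u v * w - ev2 b u v) * (ev2 d u v ^ M * C u v w + ev2 d u v ^ N * C' u v w)"
    if "ev2 d u v \<noteq> 0" for u v w
  proof -
    have "ev2 d u v ^ (N + M) * (f u v w + g u v w)
       = ev2 d u v ^ M * (ev2 d u v ^ N * f u v w) + ev2 d u v ^ N * (ev2 d u v ^ M * g u v w)"
      by (simp add: power_add algebra_simps)
    then show ?thesis unfolding 1(2)[OF that] 2(2)[OF that] by (simp add: algebra_simps)
  qed
  ultimately show ?case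
    by (intro exI[of _ "N + M"] exI[of _ "d ^ M * \<alpha> + d ^ N * \<alpha>'"] exI[of _ "d ^ M * \<beta> + d ^ N * \<beta>'"]
        bexI[of _ "\<lambda>u v w. ev2 d u v ^ M * C u v w + ev2 d u v ^ N * C' u v w"] allI impI)
next
  case (good_mult f g)
  from good_mult.IH(1) obtain N \<alpha> \<beta> C where 1: "C \<in> good d" 
    "\<And>u v w. ev2 d u v \<noteq> 0 \<Longrightarrow> ev2 d u v ^ N * f u v w
      = ev2 \<alpha> u v + ev2 \<beta> u v * w + (w^2 - ev2 a u v * w - ev2 b u v) * C u v w" by blast
  from good_mult.IH(2) obtain M \<alpha>' \<beta>' C' where 2: "C' \<in> good d"
    "\<And>u v w. ev2 d u v \<noteq> 0 \<Longrightarrow> ev2 d u v ^ M * g u v w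
      = ev2 \<alpha>' u v + ev2 \<beta>' u v * w + (w^2 - ev2 a u v * w - ev2 b u v) * C' u v w" by blast
  \<comment> \<open>The last summand comes from \<open>\<beta> * \<beta>' * w^2\<close>, where
    \<open>w^2\<close> is the modulus plus \<open>a w + b\<close>.\<close>
  define K where "K u v w = C u v w * (ev2 \<alpha>' u v + ev2 \<beta>' u v * w) + C' u v w * (ev2 \<alpha> u v + ev2 \<beta> u v * w)
    + (w^2 - ev2 a u v * w - ev2 b u v) * C u v w * C' u v w + ev2 \<beta> u v * ev2 \<beta>' u v" for u v w
  have "K \<in> good d" unfolding K_def
    by (intro good.good_add good.good_mult good_diff good_power good_ev2 good.good_w 1(1) 2(1))
  moreover have "ev2 d u v ^ (N + M) * (f u v w * g u v w)
      = ev2 (\<alpha> * \<alpha>' + \<beta> * \<beta>' * b) u v + ev2 (\<alpha> * \<beta>' + \<beta> * \<alpha>' + \<beta> * \<beta>' * a) u v * w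
        + (w^2 - ev2 a u v * w - ev2 b u v) * K u v w"
    if "ev2 d u v \<noteq> 0" for u v w
  proof -
    have "ev2 d u v ^ (N + M) * (f u v w * g u v w)
       = (ev2 d u v ^ N * f u v w) * (ev2 d u v ^ M * g u v w)"
      by (simp add: power_add algebra_simps)
    then show ?thesis unfolding 1(2)[OF that] 2(2)[OF that] K_def
      by (simp add: algebra_simps power2_eq_square)
  qed
  ultimately show ?case
    by (intro exI[of _ "N + M"] exI[of _ "\<alpha> * \<alpha>' + \<beta> * \<beta>' * b"] exI[of _ "\<alpha> * \<beta>' + \<beta> * \<alpha>' + \<beta> * \<beta>' * a"]
        bexI[of _ K] allI impI)
qed

lemma poly_differentiable:
  fixes X :: "'a::real_normed_vector \<Rightarrow> complex"
  shows "X differentiable (at x) \<Longrightarrow> (\<lambda>z. poly p (X z)) differentiable (at x)"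
  by (induction p) simp_all

lemma ev2_differentiable:
  fixes X :: "'a::real_normed_vector \<Rightarrow> complex"
  shows "X differentiable (at x) \<Longrightarrow> Y differentiable (at x) \<Longrightarrow> (\<lambda>z. ev2 P (X z) (Y z)) differentiable (at x)"
  by (induction P) (simp_all add: poly_differentiable)

lemma good_differentiable:
  assumes "h \<in> good d" "ev2 d (fst x) (fst (snd x)) \<noteq> 0"
  shows "(\<lambda>x. h (fst x) (fst (snd x)) (snd (snd x))) differentiable (at x)"
proof -
  have fst: "(\<lambda>x :: complex \<times> complex \<times> complex. fst x) differentiable (at x)"
    and snd: "(\<lambda>x :: complex \<times> complex \<times> complex. snd x) differentiable (at x)"
    by (auto intro!: bounded_linear_imp_differentiable bounded_linear_fst bounded_linear_snd)
  have fs: "(\<lambda>x :: complex \<times> complex \<times> complex. fst (snd x)) differentiable (at x)"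
    and ss: "(\<lambda>x :: complex \<times> complex \<times> complex. snd (snd x)) differentiable (at x)"
    by (auto intro!: bounded_linear_imp_differentiable bounded_linear_fst_comp bounded_linear_snd_comp bounded_linear_snd)
  show ?thesis using assms(1)
  proof induction
    case good_inverse
    show ?case
      by (intro differentiable_inverse ev2_differentiable fst fs) (use assms(2) in auto)
  qed (simp_all add: fst fs ss)
qed

subsection \<open>Surfaces that are double covers of the complement of a plane curve\<close>

text \<open>\<open>S\<close> is identified with the cover by the polynomial map
  \<open>(X, Y, Z)\<close> and its inverse \<open>\<phi>\<close>, which has to be regular only along
  the cover. The assumption \<open>smooth\<close> is the Jacobian criterion for
  \<open>w^2 - a w - b\<close>: where the \<open>w\<close>-derivative \<open>2 w - a\<close>
  vanishes, another partial derivative must not.\<close>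

locale double_plane =
  fixes a b d :: "complex poly poly" and S :: "(complex^'n) set"
    and \<phi> :: "complex \<Rightarrow> complex \<Rightarrow> complex \<Rightarrow> complex^'n" and X Y Z :: "complex^'n \<Rightarrow> complex"
  fixes on_W :: "complex \<Rightarrow> complex \<Rightarrow> complex \<Rightarrow> bool"
  defines on_W_def: "on_W u v w \<equiv> ev2 d u v \<noteq> 0 \<and> w^2 = ev2 a u v * w + ev2 b u v"
  assumes closed: "zariski_closed S"
    and XYZ: "X \<in> poly_fun" "Y \<in> poly_fun" "Z \<in> poly_fun"
    and S_onto: "\<And>z. z \<in> S \<Longrightarrow> on_W (X z) (Y z) (Z z) \<and> \<phi> (X z) (Y z) (Z z) = z"
    and S_into: "\<And>u v w. on_W u v w \<Longrightarrow> \<phi> u v w \<in> S"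
    and inv: "\<And>u v w. on_W u v w \<Longrightarrow> X (\<phi> u v w) = u \<and> Y (\<phi> u v w) = v \<and> Z (\<phi> u v w) = w"
    and regular: "\<And>i. \<exists>g\<in>good d. \<forall>u v w. on_W u v w \<longrightarrow> \<phi> u v w $ i = g u v w"
    and slices: "infinite {v. nonsquare (poly (a^2 + 4 * b) [:v:])}"
    and d_nonzero: "d \<noteq> 0"
    and smooth: "\<And>u v w au av bu bv. on_W u v w \<Longrightarrow> 2 * w = ev2 a u v \<Longrightarrow>
      ((\<lambda>u. ev2 a u v) has_field_derivative au) (at u) \<Longrightarrow>
      ((\<lambda>v. ev2 a u v) has_field_derivative av) (at v) \<Longrightarrow>
      ((\<lambda>u. ev2 b u v) has_field_derivative bu) (at u) \<Longrightarrow>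
      ((\<lambda>v. ev2 b u v) has_field_derivative bv) (at v) \<Longrightarrow>
      au * w + bu \<noteq> 0 \<or> av * w + bv \<noteq> 0"
begin

lemma onW_root: "ev2 d u v \<noteq> 0 \<Longrightarrow> \<exists>w. on_W u v w"
  unfolding on_W_def using complex_quadratic_root by blast

text \<open>A relation over two variables restricts to every slice, and on a nonsquare slice it
  forces \<open>\<beta>\<close> to vanish. A nonzero \<open>\<beta>\<close> has only finitely many
  roots \<open>[:v:]\<close>.\<close>

lemma nonsquare_disc: "nonsquare (a^2 + 4 * b)"
  unfolding nonsquare_def
proof (intro allI impI, rule ccontr)
  fix h \<beta> assume eq: "h^2 = \<beta>^2 * (a^2 + 4 * b)" and "\<beta> \<noteq> 0"
  have "poly \<beta> [:v:] = 0" if "nonsquare (poly (a^2 + 4 * b) [:v:])" for v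
  proof -
    have "(poly h [:v:])^2 = (poly \<beta> [:v:])^2 * poly (a^2 + 4 * b) [:v:]"
      using arg_cong[OF eq, of "\<lambda>P. poly P [:v:]"] by simp
    with that show ?thesis unfolding nonsquare_def by blast
  qed
  then have "(\<lambda>v. [:v:]) ` {v. nonsquare (poly (a^2 + 4 * b) [:v:])} \<subseteq> {x. poly \<beta> x = 0}" by auto
  moreover have "infinite ((\<lambda>v. [:v:]) ` {v. nonsquare (poly (a^2 + 4 * b) [:v:])})"
    using slices by (subst finite_image_iff) (auto simp: inj_on_def)
  ultimately show False using poly_roots_finite[OF \<open>\<beta> \<noteq> 0\<close>] infinite_super by blast
qed

lemma good_on_W:
  assumes "h \<in> good d"
  shows "\<exists>N \<alpha> \<beta>. \<forall>u v w. on_W u v w \<longrightarrow> ev2 d u v ^ N * h u v w = ev2 \<alpha> u v + ev2 \<beta> u v * w"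
proof -
  obtain N \<alpha> \<beta> C where "\<And>u v w. ev2 d u v \<noteq> 0 \<Longrightarrow> ev2 d u v ^ N * h u v w
      = ev2 \<alpha> u v + ev2 \<beta> u v * w + (w^2 - ev2 a u v * w - ev2 b u v) * C u v w"
    using good_reduce[OF assms] by blast
  then show ?thesis unfolding on_W_def by (intro exI[of _ N] exI[of _ \<alpha>] exI[of _ \<beta>]) auto
qed

definition G :: "'n \<Rightarrow> complex \<Rightarrow> complex \<Rightarrow> complex \<Rightarrow> complex" where
  "G i = (SOME g. g \<in> good d \<and> (\<forall>u v w. on_W u v w \<longrightarrow> \<phi> u v w $ i = g u v w))"

lemma G: "G i \<in> good d" "on_W u v w \<Longrightarrow> \<phi> u v w $ i = G i u v w"
  using someI_ex[of "\<lambda>g. g \<in> good d \<and> (\<forall>u v w. on_W u v w \<longrightarrow> \<phi> u v w $ i = g u v w)"] regular[of i]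
  unfolding G_def by blast+

text \<open>\<open>\<phi>\<close> is controlled only on the cover; \<open>\<Phi>\<close> agrees with
  it there and is regular in a neighbourhood, so it has a differential in all three
  directions.\<close>

definition \<Phi> :: "complex \<Rightarrow> complex \<Rightarrow> complex \<Rightarrow> complex^'n" where
  "\<Phi> u v w = (\<chi> i. G i u v w)"

lemma \<Phi>_eq: "on_W u v w \<Longrightarrow> \<Phi> u v w = \<phi> u v w"
  by (simp add: \<Phi>_def vec_eq_iff G(2))

lemma good_pullback: "f \<in> poly_fun \<Longrightarrow> (\<lambda>u v w. f (\<Phi> u v w)) \<in> good d"
  by (rule good_poly_fun) (simp_all add: \<Phi>_def G(1))

lemma poly_fun_on_S:
  assumes "f \<in> poly_fun"
  shows "\<exists>N \<alpha> \<beta>. \<forall>z\<in>S. ev2 d (X z) (Y z) ^ N * f z = ev2 \<alpha> (X z) (Y z) + ev2 \<beta> (X z) (Y z) * Z z"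
proof -
  obtain N \<alpha> \<beta> where *: "\<And>u v w. on_W u v w \<Longrightarrow>
      ev2 d u v ^ N * f (\<Phi> u v w) = ev2 \<alpha> u v + ev2 \<beta> u v * w"
    using good_on_W[OF good_pullback[OF assms]] by blast
  have "ev2 d (X z) (Y z) ^ N * f z = ev2 \<alpha> (X z) (Y z) + ev2 \<beta> (X z) (Y z) * Z z" if "z \<in> S" for z
    using *[of "X z" "Y z" "Z z"] S_onto[OF that] \<Phi>_eq[of "X z" "Y z" "Z z"] by simp
  then show ?thesis by blast
qed

lemma on_S_d: "z \<in> S \<Longrightarrow> ev2 d (X z) (Y z) \<noteq> 0"
  using S_onto unfolding on_W_def by blast

theorem irreducible: "irreducible_variety S"
proof (rule irreducible_quadratic_cover[where ev = "\<lambda>P (u, v). ev2 P u v" and a = a and b = b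
      and D = "{(u, v). ev2 d u v \<noteq> 0}" and \<pi> = "\<lambda>z. (X z, Y z)" and w = Z])
  show "{(u, v). ev2 d u v \<noteq> 0} \<noteq> {}" using ev2_eq_0D[of d] d_nonzero by auto
  show "x = 0" if "\<And>p. p \<in> {(u, v). ev2 d u v \<noteq> 0} \<Longrightarrow> (case p of (u, v) \<Rightarrow> ev2 x u v) = 0" for x
    by (rule ev2_eq_0_off[OF d_nonzero]) (use that in force)
  fix f assume "f \<in> (poly_fun :: (complex^'n \<Rightarrow> complex) set)"
  then obtain N \<alpha> \<beta> where "\<And>z. z \<in> S \<Longrightarrow>
      ev2 d (X z) (Y z) ^ N * f z = ev2 \<alpha> (X z) (Y z) + ev2 \<beta> (X z) (Y z) * Z z"
    using poly_fun_on_S by blast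
  then show "\<exists>\<alpha> \<beta> e. \<forall>z\<in>S. e z \<noteq> 0 \<and> e z * f z =
      (case (X z, Y z) of (u, v) \<Rightarrow> ev2 \<alpha> u v) + (case (X z, Y z) of (u, v) \<Rightarrow> ev2 \<beta> u v) * Z z"
    using on_S_d by (intro exI[of _ \<alpha>] exI[of _ \<beta>] exI[of _ "\<lambda>z. ev2 d (X z) (Y z) ^ N"]) auto
next
  fix p y assume "p \<in> {(u, v). ev2 d u v \<noteq> 0}"
    "y^2 = (case p of (u, v) \<Rightarrow> ev2 a u v) * y + (case p of (u, v) \<Rightarrow> ev2 b u v)"
  then have "on_W (fst p) (snd p) y" unfolding on_W_def by (auto simp: case_prod_unfold)
  then show "\<exists>z\<in>S. (X z, Y z) = p \<and> Z z = y" using S_into inv by (intro bexI[of _ "\<phi> (fst p) (snd p) y"]) auto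
qed (auto simp: closed nonsquare_disc)

lemma irreducible_slice:
  assumes ns: "nonsquare (poly (a^2 + 4 * b) [:v:])" and d: "poly d [:v:] \<noteq> 0"
  shows "irreducible_variety (S \<inter> {z. Y z = v})"
proof (rule irreducible_quadratic_cover[where ev = poly and a = "poly a [:v:]" and b = "poly b [:v:]"
      and D = "{u. ev2 d u v \<noteq> 0}" and \<pi> = X and w = Z])
  have "zariski_closed {z. Y z - v = 0}" by (intro zariski_closed_zero poly_fun_intros XYZ)
  then show "zariski_closed (S \<inter> {z. Y z = v})" by (intro zariski_closed_Int closed) simp
  have "\<exists>u. ev2 d u v \<noteq> 0" using d poly_all_0_iff_0 unfolding ev2_def by blast
  then show "{u. ev2 d u v \<noteq> 0} \<noteq> {}" by blast
  show "x = 0" if "\<And>u. u \<in> {u. ev2 d u v \<noteq> 0} \<Longrightarrow> poly x u = 0" for x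
  proof -
    have "poly (poly d [:v:] * x) u = 0" for u using that[of u] by (auto simp: ev2_def)
    then have "poly d [:v:] * x = 0" using poly_all_0_iff_0 by blast
    with d show ?thesis by simp
  qed
  show "nonsquare ((poly a [:v:])^2 + 4 * poly b [:v:])" using ns by simp
  fix f assume "f \<in> (poly_fun :: (complex^'n \<Rightarrow> complex) set)"
  then obtain N \<alpha> \<beta> where "\<And>z. z \<in> S \<Longrightarrow>
      ev2 d (X z) (Y z) ^ N * f z = ev2 \<alpha> (X z) (Y z) + ev2 \<beta> (X z) (Y z) * Z z"
    using poly_fun_on_S by blast
  then show "\<exists>\<alpha> \<beta> e. \<forall>z\<in>S \<inter> {z. Y z = v}. e z \<noteq> 0 \<and> e z * f z = poly \<alpha> (X z) + poly \<beta> (X z) * Z z"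
    using on_S_d by (intro exI[of _ "poly \<alpha> [:v:]"] exI[of _ "poly \<beta> [:v:]"] exI[of _ "\<lambda>z. ev2 d (X z) (Y z) ^ N"])
      (auto simp: ev2_def)
next
  fix u y assume "u \<in> {u. ev2 d u v \<noteq> 0}" "y^2 = poly (poly a [:v:]) u * y + poly (poly b [:v:]) u"
  then have "on_W u v y" unfolding on_W_def by (simp add: ev2_def)
  then show "\<exists>z\<in>S \<inter> {z. Y z = v}. X z = u \<and> Z z = y"
    using S_into inv by (intro bexI[of _ "\<phi> u v y"]) auto
qed auto

lemma finite_bad_slices: "finite {v. poly d [:v:] = 0}"
proof -
  have "finite {v. [:v:] \<in> {x. poly d x = 0}}"
    using finite_vimageI[OF poly_roots_finite[OF d_nonzero], of "\<lambda>v. [:v:]"]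
    by (simp add: vimage_def inj_on_def)
  then show ?thesis by simp
qed

lemma chain_2: "irr_chain_in S 2"
proof -
  have inf: "infinite ({v. nonsquare (poly (a^2 + 4 * b) [:v:])} - {v. poly d [:v:] = 0})" (is "infinite ?I")
    using slices finite_bad_slices by simp
  then obtain v where v: "nonsquare (poly (a^2 + 4 * b) [:v:])" "poly d [:v:] \<noteq> 0"
    using infinite_imp_nonempty[OF inf] by blast
  have "infinite (?I - {v})" using inf by simp
  then obtain v' where v': "v' \<noteq> v" "poly d [:v':] \<noteq> 0"
    using infinite_imp_nonempty[of "?I - {v}"] by blast
  have pt: "\<exists>w. on_W u x w" if "ev2 d u x \<noteq> 0" for u x using onW_root[OF that] .
  have "infinite {u. ev2 d u v \<noteq> 0}"
  proof -
    have "finite {u. ev2 d u v = 0}" using poly_roots_finite[OF v(2)] by (simp add: ev2_def)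
    moreover have "{u. ev2 d u v \<noteq> 0} = UNIV - {u. ev2 d u v = 0}" by auto
    ultimately show ?thesis by (simp add: infinite_UNIV_char_0)
  qed
  then obtain u where u: "ev2 d u v \<noteq> 0" using infinite_imp_nonempty by blast
  have "infinite ({u. ev2 d u v \<noteq> 0} - {u})" using \<open>infinite {u. ev2 d u v \<noteq> 0}\<close> by simp
  then obtain u' where u': "u' \<noteq> u" "ev2 d u' v \<noteq> 0"
    using infinite_imp_nonempty[of "{u. ev2 d u v \<noteq> 0} - {u}"] by blast
  have "\<exists>u. ev2 d u v' \<noteq> 0" using v'(2) poly_all_0_iff_0 unfolding ev2_def by blast
  then obtain u'' where u'': "ev2 d u'' v' \<noteq> 0" by blast
  \<comment> \<open>The second point lies on the same slice, the third on another one; they make the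
    inclusions point, slice, surface strict.\<close>
  obtain w w' w'' where w: "on_W u v w" "on_W u' v w'" "on_W u'' v' w''"
    using pt u u'(2) u'' by metis
  define c where "c i = (if i = 0 then {\<phi> u v w} else if i = 1 then S \<inter> {z. Y z = v} else S)" for i :: nat
  have "irreducible_variety (c i)" for i
    using irreducible irreducible_slice[OF v] by (auto simp: c_def irreducible_variety_singleton)
  moreover have "c i \<subset> c (Suc i)" if "i < 2" for i
  proof -
    have "\<phi> u v w \<in> c 1" "\<phi> u' v w' \<in> c 1" "\<phi> u' v w' \<notin> c 0" "\<phi> u'' v' w'' \<in> c 2" "\<phi> u'' v' w'' \<notin> c 1"
      using inv[OF w(1)] inv[OF w(2)] inv[OF w(3)] S_into w u'(1) v'(1) by (auto simp: c_def)
    moreover have "c 0 = {\<phi> u v w}" "c 1 \<subseteq> c 2" by (auto simp: c_def)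
    moreover have "i = 0 \<or> i = 1" using that by auto
    ultimately show ?thesis by (auto simp: numeral_2_eq_2)
  qed
  moreover have "c 2 \<subseteq> S" by (simp add: c_def)
  ultimately show ?thesis unfolding irr_chain_in_def by blast
qed

end

subsection \<open>Connectedness of double covers with a branch point\<close>

lemma closedin_sequentialI:
  fixes U :: "'a::first_countable_topology set"
  assumes "S \<subseteq> U" "\<And>x l. (\<And>n. x n \<in> S) \<Longrightarrow> x \<longlonglongrightarrow> l \<Longrightarrow> l \<in> U \<Longrightarrow> l \<in> S"
  shows "closedin (top_of_set U) S"
proof -
  have "S = U \<inter> closure S"
  proof
    show "U \<inter> closure S \<subseteq> S"
    proof
      fix l assume "l \<in> U \<inter> closure S"
      then obtain x where "\<And>n. x n \<in> S" "x \<longlonglongrightarrow> l" "l \<in> U"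
        using closure_sequential[of l S] by auto
      then show "l \<in> S" by (rule assms(2))
    qed
  qed (use assms(1) closure_subset[of S] in auto)
  then show ?thesis using closedin_closed by blast
qed

lemma quadratic_root_bound:
  fixes w a b :: complex
  assumes "w^2 = a * w + b" shows "norm w \<le> norm a + norm b + 1"
proof (rule ccontr)
  assume "\<not> ?thesis"
  then have big: "norm w > norm a + norm b + 1" by simp
  have "norm w * norm w \<le> norm a * norm w + norm b"
    using norm_triangle_ineq[of "a * w" b] assms by (metis norm_mult power2_eq_square)
  also have "\<dots> \<le> norm a * norm w + norm b * norm w"
    using mult_left_mono[of 1 "norm w" "norm b"] less_imp_le[OF big] norm_ge_zero[of a] norm_ge_zero[of b] by simp
  also have "\<dots> = (norm a + norm b) * norm w" by (simp add: algebra_simps)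
  also have "\<dots> < norm w * norm w"
  proof (rule mult_strict_right_mono)
    show "norm a + norm b < norm w" using big by simp
    then show "0 < norm w" using norm_ge_zero[of a] norm_ge_zero[of b] by linarith
  qed
  finally show False by simp
qed

text \<open>The base points with the whole fibre in the open set \<open>A\<close> form a clopen subset of the base,
  because roots stay bounded; at a branch point the fibre cannot be split.\<close>
lemma connected_quadratic_cover:
  fixes a b :: "'a::real_normed_vector \<Rightarrow> complex"
  assumes U: "connected U" and cont: "continuous_on UNIV a" "continuous_on UNIV b"
    and branch: "p0 \<in> U" "(a p0)^2 + 4 * b p0 = 0"
  shows "connected {(p, w). p \<in> U \<and> w^2 = a p * w + b p}" (is "connected ?W")
proof (rule connectedI)
  fix A B assume AB: "open A" "open B" "A \<inter> ?W \<noteq> {}" "B \<inter> ?W \<noteq> {}" "A \<inter> B \<inter> ?W = {}" "?W \<subseteq> A \<union> B"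
  \<comment> \<open>Bounded roots accumulate. A limit in the open set \<open>B\<close> would draw
    points of the sequence into \<open>B\<close>, against disjointness, so the limit stays in
    \<open>A\<close>.\<close>
  have lim: "\<exists>r w. strict_mono r \<and> (y \<circ> r) \<longlonglongrightarrow> w \<and> w^2 = a l * w + b l \<and> (l, w) \<in> A"
    if x: "x \<longlonglongrightarrow> l" "l \<in> U" "\<And>n. x n \<in> U" "\<And>n. (y n)^2 = a (x n) * y n + b (x n)" "\<And>n. (x n, y n) \<in> A"
      and AB: "open A" "open B" "A \<inter> B \<inter> ?W = {}" "?W \<subseteq> A \<union> B" for x y l A B
  proof -
    have ax: "(\<lambda>n. a (x n)) \<longlonglongrightarrow> a l" and bx: "(\<lambda>n. b (x n)) \<longlonglongrightarrow> b l"
      using cont x(1) by (auto intro: continuous_on_tendsto_compose)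
    then obtain K L where "\<And>n. norm (a (x n)) \<le> K" "\<And>n. norm (b (x n)) \<le> L"
      by (meson Bseq_def convergentI convergent_imp_Bseq)
    then have "norm (y n) \<le> K + L + 1" for n
      using quadratic_root_bound[OF x(4)[of n]] by (meson add_mono order_trans order_refl)
    then have "bounded (range y)" by (auto intro: boundedI)
    then obtain r w where r: "strict_mono r" "(y \<circ> r) \<longlonglongrightarrow> w"
      using bounded_imp_convergent_subsequence by blast
    have "(\<lambda>n. (y (r n))^2) \<longlonglongrightarrow> w^2" using r(2) unfolding comp_def by (intro tendsto_intros)
    moreover have "(\<lambda>n. a (x (r n)) * y (r n) + b (x (r n))) \<longlonglongrightarrow> a l * w + b l"
      using LIMSEQ_subseq_LIMSEQ[OF ax r(1)] LIMSEQ_subseq_LIMSEQ[OF bx r(1)] r(2) unfolding comp_def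
      by (intro tendsto_intros)
    ultimately have w: "w^2 = a l * w + b l" using x(4) LIMSEQ_unique by (metis (no_types, lifting) ext)
    have "(l, w) \<in> A"
    proof (rule ccontr)
      assume "(l, w) \<notin> A"
      then have "(l, w) \<in> B" using w x(2) AB by auto
      moreover have "(\<lambda>n. (x (r n), y (r n))) \<longlonglongrightarrow> (l, w)"
        using LIMSEQ_subseq_LIMSEQ[OF x(1) r(1)] r(2) unfolding comp_def by (intro tendsto_Pair)
      ultimately have "eventually (\<lambda>n. (x (r n), y (r n)) \<in> B) sequentially"
        using AB(2) by (intro topological_tendstoD)
      then obtain n where "(x (r n), y (r n)) \<in> B" unfolding eventually_sequentially by blast
      then show False using x(3,4,5) AB(3) by blast
    qed
    with r w show ?thesis by blast
  qed
  have clopen: "openin (top_of_set U) {p \<in> U. \<forall>w. w^2 = a p * w + b p \<longrightarrow> (p, w) \<in> A} \<and>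
      closedin (top_of_set U) {p \<in> U. \<forall>w. w^2 = a p * w + b p \<longrightarrow> (p, w) \<in> A}"
    if AB: "open A" "open B" "A \<inter> B \<inter> ?W = {}" "?W \<subseteq> A \<union> B" for A B
  proof
    have "closedin (top_of_set U) {p \<in> U. \<exists>w. w^2 = a p * w + b p \<and> (p, w) \<in> B}"
    proof (rule closedin_sequentialI)
      fix x l assume x: "\<And>n. x n \<in> {p \<in> U. \<exists>w. w^2 = a p * w + b p \<and> (p, w) \<in> B}" "x \<longlonglongrightarrow> l" "l \<in> U"
      then have "\<forall>n. \<exists>w. w^2 = a (x n) * w + b (x n) \<and> (x n, w) \<in> B" by blast
      then obtain y where "\<And>n. (y n)^2 = a (x n) * y n + b (x n)" "\<And>n. (x n, y n) \<in> B" by metis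
      with lim[OF x(2,3), of y B A] x(1) AB
      show "l \<in> {p \<in> U. \<exists>w. w^2 = a p * w + b p \<and> (p, w) \<in> B}" using x(3) by (auto simp: Int_ac Un_ac)
    qed auto
    moreover have "{p \<in> U. \<forall>w. w^2 = a p * w + b p \<longrightarrow> (p, w) \<in> A}
        = U - {p \<in> U. \<exists>w. w^2 = a p * w + b p \<and> (p, w) \<in> B}" using AB by auto
    ultimately show "openin (top_of_set U) {p \<in> U. \<forall>w. w^2 = a p * w + b p \<longrightarrow> (p, w) \<in> A}"
      by (simp add: openin_diff)
    show "closedin (top_of_set U) {p \<in> U. \<forall>w. w^2 = a p * w + b p \<longrightarrow> (p, w) \<in> A}"
    proof (rule closedin_sequentialI)
      fix x l assume x: "\<And>n. x n \<in> {p \<in> U. \<forall>w. w^2 = a p * w + b p \<longrightarrow> (p, w) \<in> A}" "x \<longlonglongrightarrow> l" "l \<in> U"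
      have "\<forall>n. \<exists>w. w^2 = a (x n) * w + b (x n)" using complex_quadratic_root by blast
      then obtain y where y: "\<And>n. (y n)^2 = a (x n) * y n + b (x n)" by metis
      \<comment> \<open>\<open>a - y\<close> is the second root. Following \<open>y\<close> and
        \<open>a - y\<close> along a common subsequence accounts for the whole fibre over the
        limit.\<close>
      have y': "(a (x n) - y n)^2 = a (x n) * (a (x n) - y n) + b (x n)" for n
        using y[of n] by (simp add: power2_eq_square algebra_simps)
      obtain r w where r: "strict_mono r" "(y \<circ> r) \<longlonglongrightarrow> w" and w: "w^2 = a l * w + b l" "(l, w) \<in> A"
        using lim[OF x(2,3), of y A B] x(1) y AB by auto
      have xr: "(x \<circ> r) \<longlonglongrightarrow> l" using LIMSEQ_subseq_LIMSEQ[OF x(2) r(1)] .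
      obtain r' w' where r': "strict_mono r'" "((\<lambda>n. a (x (r n)) - y (r n)) \<circ> r') \<longlonglongrightarrow> w'" and w': "(l, w') \<in> A"
        using lim[OF xr x(3), of "\<lambda>n. a (x (r n)) - y (r n)" A B] x(1) y' AB by auto
      have "(\<lambda>n. a ((x \<circ> r) n)) \<longlonglongrightarrow> a l" by (rule continuous_on_tendsto_compose[OF cont(1) xr]) auto
      with r(2) have "(\<lambda>n. a (x (r n)) - y (r n)) \<longlonglongrightarrow> a l - w" unfolding comp_def by (intro tendsto_diff)
      from LIMSEQ_unique[OF LIMSEQ_subseq_LIMSEQ[OF this r'(1)] r'(2)] have "w' = a l - w" by simp
      moreover have "v = w \<or> v = a l - w" if "v^2 = a l * v + b l" for v
      proof -
        have "(v - w) * (v - (a l - w)) = 0" using that w(1) by (simp add: power2_eq_square algebra_simps)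
        then show ?thesis by simp
      qed
      ultimately show "l \<in> {p \<in> U. \<forall>w. w^2 = a p * w + b p \<longrightarrow> (p, w) \<in> A}" using w w' x(3) by auto
    qed auto
  qed
  have all: "{p \<in> U. \<forall>w. w^2 = a p * w + b p \<longrightarrow> (p, w) \<in> A} = U"
    if AB: "open A" "open B" "A \<inter> B \<inter> ?W = {}" "?W \<subseteq> A \<union> B" and "(p0, a p0 / 2) \<in> A" for A B
  proof -
    have "w = a p0 / 2" if "w^2 = a p0 * w + b p0" for w
    proof -
      have "(2 * w - a p0)^2 = 4 * (w^2 - a p0 * w) + (a p0)^2"
        by (simp add: power2_eq_square algebra_simps)
      then have "(2 * w - a p0)^2 = 0" using that branch(2) by (simp add: add.commute)
      then show ?thesis by (simp add: mult.commute)
    qed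
    with branch(1) that(5) have "p0 \<in> {p \<in> U. \<forall>w. w^2 = a p * w + b p \<longrightarrow> (p, w) \<in> A}" by blast
    then show ?thesis using clopen[OF AB] U unfolding connected_clopen by blast
  qed
  define c where "c = a p0 / 2"
  have "a p0 = 2 * c" by (simp add: c_def)
  with branch(2) have "4 * (b p0 + c^2) = 0" by (simp add: power2_eq_square algebra_simps)
  then have "b p0 = - c\<^sup>2" by (simp add: add_eq_0_iff2)
  then have "(a p0 / 2)^2 = a p0 * (a p0 / 2) + b p0"
    unfolding \<open>a p0 = 2 * c\<close> by (simp add: power2_eq_square)
  then have "(p0, a p0 / 2) \<in> A \<or> (p0, a p0 / 2) \<in> B" using AB branch(1) by blast
  then show False
  proof
    assume "(p0, a p0 / 2) \<in> A"
    from all[OF AB(1,2,5,6) this] show False using AB(4,5) by blast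
  next
    assume "(p0, a p0 / 2) \<in> B"
    from all[of B A, OF AB(2,1) _ _ this] show False using AB(3,5,6) by (auto simp: Int_ac Un_ac)
  qed
qed

lemma ev2_on_line: "\<exists>q. \<forall>s. ev2 P (u + s * u') (v + s * v') = poly q s"
proof (induction P)
  case 0
  show ?case by (intro exI[of _ 0]) simp
next
  case (pCons p P)
  then obtain q where "\<And>s. ev2 P (u + s * u') (v + s * v') = poly q s" by blast
  then have "ev2 (pCons p P) (u + s * u') (v + s * v') = poly (pcompose p [:u, u':] + [:v, v':] * q) s" for s
    by (simp add: poly_pcompose algebra_simps)
  then show ?case by blast
qed

text \<open>On the complex line through two points of the complement \<open>d\<close> becomes a
  nonzero polynomial in one variable, and the complex plane minus finitely many points is
  connected.\<close>

lemma connected_curve_complement: "connected {p. ev2 d (fst p) (snd p) \<noteq> 0}" (is "connected ?U")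
  unfolding connected_iff_connected_component
proof (intro ballI)
  fix x y assume x: "x \<in> ?U" and y: "y \<in> ?U"
  define \<gamma> where "\<gamma> s = (fst x + s * (fst y - fst x), snd x + s * (snd y - snd x))" for s
  obtain q where q: "\<And>s. ev2 d (fst (\<gamma> s)) (snd (\<gamma> s)) = poly q s"
    using ev2_on_line[of d "fst x" "fst y - fst x" "snd x" "snd y - snd x"] by (auto simp: \<gamma>_def)
  have \<gamma>01: "\<gamma> 0 = x" "\<gamma> 1 = y" by (simp_all add: \<gamma>_def)
  have "q \<noteq> 0" using q[of 0] x \<gamma>01 by auto
  then have "connected (UNIV - {s. poly q s = 0})"
    by (intro connected_open_delete_finite poly_roots_finite) auto
  moreover have "continuous_on A \<gamma>" for A unfolding \<gamma>_def by (intro continuous_intros)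
  ultimately have "connected (\<gamma> ` (UNIV - {s. poly q s = 0}))" by (rule connected_continuous_image[rotated])
  moreover have "\<gamma> ` (UNIV - {s. poly q s = 0}) \<subseteq> ?U" using q by auto
  moreover have "x = \<gamma> 0" "y = \<gamma> 1" "poly q 0 \<noteq> 0" "poly q 1 \<noteq> 0"
    using q[of 0] q[of 1] x y \<gamma>01 by auto
  ultimately show "connected_component ?U x y"
    unfolding connected_component_def by (intro exI[of _ "\<gamma> ` (UNIV - {s. poly q s = 0})"]) auto
qed

lemma ev2_continuous_on:
  "continuous_on A f \<Longrightarrow> continuous_on A g \<Longrightarrow> continuous_on A (\<lambda>x. ev2 P (f x) (g x))"
  by (induction P) (auto intro!: continuous_intros)

subsection \<open>Dimension\<close>

text \<open>The same numbers \<open>pu\<close>, \<open>pv\<close> serve as partial derivatives and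
  as coefficients of the total derivative in \<open>(u, v, w)\<close>. This links the assumption
  \<open>smooth\<close>, phrased by partial derivatives, to the differential of the equation of the
  cover.\<close>

lemma ev2_total_derivative:
  "\<exists>pu pv. ((\<lambda>u. ev2 P u v) has_field_derivative pu) (at u) \<and>
     ((\<lambda>v. ev2 P u v) has_field_derivative pv) (at v) \<and>
     (\<forall>w. ((\<lambda>x. ev2 P (fst x) (fst (snd x))) has_derivative (\<lambda>\<xi>. pu * fst \<xi> + pv * fst (snd \<xi>)))
        (at (u, v, w :: complex)))"
proof (induction P)
  case 0
  show ?case by (intro exI[of _ 0]) auto
next
  case (pCons p P)
  then obtain pu pv where IH: "((\<lambda>u. ev2 P u v) has_field_derivative pu) (at u)"
    "((\<lambda>v. ev2 P u v) has_field_derivative pv) (at v)"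
    "\<And>w. ((\<lambda>x. ev2 P (fst x) (fst (snd x))) has_derivative (\<lambda>\<xi>. pu * fst \<xi> + pv * fst (snd \<xi>)))
        (at (u, v, w :: complex))" by blast
  let ?u = "poly (pderiv p) u + v * pu" and ?v = "ev2 P u v + v * pv"
  have "((\<lambda>u. ev2 (pCons p P) u v) has_field_derivative ?u) (at u)"
    by (auto intro!: derivative_eq_intros IH(1))
  moreover have "((\<lambda>v. ev2 (pCons p P) u v) has_field_derivative ?v) (at v)"
    by (auto intro!: derivative_eq_intros IH(2))
  moreover have "((\<lambda>x. ev2 (pCons p P) (fst x) (fst (snd x))) has_derivative (\<lambda>\<xi>. ?u * fst \<xi> + ?v * fst (snd \<xi>)))
      (at (u, v, w :: complex))" for w
  proof -
    have "(poly p has_derivative (*) (poly (pderiv p) u)) (at (fst (u, v, w)))"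
      using poly_DERIV[of p u] by (simp add: has_field_derivative_def)
    from has_derivative_compose[OF has_derivative_fst[OF has_derivative_ident] this]
    have p: "((\<lambda>x. poly p (fst x)) has_derivative (\<lambda>\<xi>. poly (pderiv p) u * fst \<xi>)) (at (u, v, w))" .
    show ?thesis unfolding ev2_simps
      by (rule has_derivative_eq_rhs[OF has_derivative_add[OF p has_derivative_mult[OF
            has_derivative_fst[OF has_derivative_snd[OF has_derivative_ident]] IH(3)]]])
         (auto simp: fun_eq_iff algebra_simps)
  qed
  ultimately show ?case by blast
qed

context double_plane
begin

text \<open>A filtration of the functions on \<open>S\<close> with explicit bounds: denominator
  \<open>d ^ M\<close> and bidegree \<open>D\<close>, hence at most \<open>2 (D + 1)^2\<close>
  coefficients.\<close>

definition represented :: "nat \<Rightarrow> nat \<Rightarrow> (complex^'n \<Rightarrow> complex) \<Rightarrow> bool" where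
  "represented M D f \<longleftrightarrow> (\<exists>\<alpha> \<beta>. bideg D \<alpha> \<and> bideg D \<beta> \<and>
     (\<forall>z\<in>S. ev2 d (X z) (Y z) ^ M * f z = ev2 \<alpha> (X z) (Y z) + ev2 \<beta> (X z) (Y z) * Z z))"

lemma represented_mono:
  assumes "represented M D f" "D \<le> D'" shows "represented M D' f"
proof -
  obtain \<alpha> \<beta> where *: "bideg D \<alpha>" "bideg D \<beta>" "\<forall>z\<in>S.
      ev2 d (X z) (Y z) ^ M * f z = ev2 \<alpha> (X z) (Y z) + ev2 \<beta> (X z) (Y z) * Z z"
    using assms(1) unfolding represented_def by (elim exE conjE)
  have "bideg D' \<alpha>" "bideg D' \<beta>" using bideg_mono[OF *(1) assms(2)] bideg_mono[OF *(2) assms(2)] .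
  with *(3) show ?thesis unfolding represented_def by blast
qed

lemma represented_shift:
  assumes "represented M D f" shows "\<exists>D'. represented (M + K) D' f"
proof -
  obtain \<alpha> \<beta> where *: "\<And>z. z \<in> S \<Longrightarrow>
      ev2 d (X z) (Y z) ^ M * f z = ev2 \<alpha> (X z) (Y z) + ev2 \<beta> (X z) (Y z) * Z z"
    using assms unfolding represented_def by blast
  have "ev2 d (X z) (Y z) ^ (M + K) * f z
      = ev2 (d ^ K * \<alpha>) (X z) (Y z) + ev2 (d ^ K * \<beta>) (X z) (Y z) * Z z" if "z \<in> S" for z
  proof -
    have "ev2 d (X z) (Y z) ^ (M + K) * f z = ev2 d (X z) (Y z) ^ K * (ev2 d (X z) (Y z) ^ M * f z)"
      by (simp add: power_add)
    then show ?thesis unfolding *[OF that] by (simp add: algebra_simps)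
  qed
  moreover obtain m n where "bideg m (d ^ K * \<alpha>)" "bideg n (d ^ K * \<beta>)" using bideg_exists by blast
  then have "bideg (m + n) (d ^ K * \<alpha>)" "bideg (m + n) (d ^ K * \<beta>)" by (auto intro: bideg_mono)
  ultimately show ?thesis unfolding represented_def by blast
qed

lemma represented_common:
  assumes "finite Q" "Q \<subseteq> poly_fun" shows "\<exists>M D. \<forall>f\<in>Q. represented M D f"
  using assms
proof (induction Q rule: finite_induct)
  case (insert f Q)
  then obtain M D where MD: "\<And>g. g \<in> Q \<Longrightarrow> represented M D g" by auto
  obtain N \<alpha> \<beta> where N: "\<forall>z\<in>S. ev2 d (X z) (Y z) ^ N * f z = ev2 \<alpha> (X z) (Y z) + ev2 \<beta> (X z) (Y z) * Z z"
    using poly_fun_on_S insert.prems by blast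
  obtain m n where "bideg m \<alpha>" "bideg n \<beta>" using bideg_exists by blast
  then have "bideg (m + n) \<alpha>" "bideg (m + n) \<beta>" by (auto intro: bideg_mono)
  with N have "represented N (m + n) f" unfolding represented_def by blast
  then obtain D' where D': "represented (M + N) D' f"
    using represented_shift[of N _ f M] by (auto simp: add.commute)
  have "\<exists>D'. represented (M + N) D' g" if "g \<in> Q" for g
    using represented_shift[OF MD[OF that]] by blast
  then obtain E where E: "\<And>g. g \<in> Q \<Longrightarrow> represented (M + N) (E g) g" by metis
  have "represented (M + N) (D' + (\<Sum>g\<in>Q. E g)) h" if "h \<in> insert f Q" for h
  proof (cases "h = f")
    case True with D' show ?thesis by (auto intro: represented_mono)
  next
    case False
    with that have "h \<in> Q" by simp
    then have "E h \<le> D' + (\<Sum>g\<in>Q. E g)" using insert.hyps(1) by (auto intro: trans_le_add2 member_le_sum)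
    with E[OF \<open>h \<in> Q\<close>] show ?thesis by (rule represented_mono)
  qed
  then show ?case by blast
qed simp

text \<open>Replacing \<open>w^2\<close> by \<open>a w + b\<close> costs only the fixed amount
  \<open>F\<close>, so the bounds for a monomial grow linearly in its degree.\<close>

lemma represented_mult:
  assumes f: "represented M D f" and g: "represented N E g" and ab: "bideg F a" "bideg F b"
  shows "represented (M + N) (D + E + F) (\<lambda>z. f z * g z)"
proof -
  obtain \<alpha> \<beta> where 1: "bideg D \<alpha>" "bideg D \<beta>" "\<And>z. z \<in> S \<Longrightarrow>
      ev2 d (X z) (Y z) ^ M * f z = ev2 \<alpha> (X z) (Y z) + ev2 \<beta> (X z) (Y z) * Z z"
    using f unfolding represented_def by blast
  obtain \<alpha>' \<beta>' where 2: "bideg E \<alpha>'" "bideg E \<beta>'" "\<And>z. z \<in> S \<Longrightarrow>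
      ev2 d (X z) (Y z) ^ N * g z = ev2 \<alpha>' (X z) (Y z) + ev2 \<beta>' (X z) (Y z) * Z z"
    using g unfolding represented_def by blast
  have "ev2 d (X z) (Y z) ^ (M + N) * (f z * g z)
      = ev2 (\<alpha> * \<alpha>' + \<beta> * \<beta>' * b) (X z) (Y z) + ev2 (\<alpha> * \<beta>' + \<beta> * \<alpha>' + \<beta> * \<beta>' * a) (X z) (Y z) * Z z"
    if "z \<in> S" for z
  proof -
    have Z: "Z z * Z z = ev2 a (X z) (Y z) * Z z + ev2 b (X z) (Y z)"
      using S_onto[OF that] unfolding on_W_def by (simp add: power2_eq_square)
    have "ev2 d (X z) (Y z) ^ (M + N) * (f z * g z)
       = (ev2 d (X z) (Y z) ^ M * f z) * (ev2 d (X z) (Y z) ^ N * g z)"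
      by (simp add: power_add algebra_simps)
    also have "\<dots> = ev2 \<alpha> (X z) (Y z) * ev2 \<alpha>' (X z) (Y z)
        + (ev2 \<alpha> (X z) (Y z) * ev2 \<beta>' (X z) (Y z) + ev2 \<beta> (X z) (Y z) * ev2 \<alpha>' (X z) (Y z)) * Z z
        + ev2 \<beta> (X z) (Y z) * ev2 \<beta>' (X z) (Y z) * (Z z * Z z)"
      unfolding 1(3)[OF that] 2(3)[OF that] by (simp add: algebra_simps)
    finally show ?thesis unfolding Z by (simp add: algebra_simps)
  qed
  moreover have "bideg (D + E + F) (\<alpha> * \<alpha>' + \<beta> * \<beta>' * b)"
    "bideg (D + E + F) (\<alpha> * \<beta>' + \<beta> * \<alpha>' + \<beta> * \<beta>' * a)"
    using bideg_mult[OF 1(1) 2(1)] bideg_mult[OF 1(1) 2(2)] bideg_mult[OF 1(2) 2(1)]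
      bideg_mult[OF bideg_mult[OF 1(2) 2(2)] ab(1)] bideg_mult[OF bideg_mult[OF 1(2) 2(2)] ab(2)]
    by (auto intro!: bideg_add elim: bideg_mono)
  ultimately show ?thesis unfolding represented_def by blast
qed

text \<open>The \<open>(N + 1)\<^sup>3\<close> monomials of degree at most \<open>N\<close> in each of \<open>f\<close>, \<open>g\<close>, \<open>h\<close> live in a space
  whose dimension grows only like \<open>N\<^sup>2\<close>.\<close>
lemma three_functions_dependent:
  fixes f g h :: "complex^'n \<Rightarrow> complex"
  assumes "f \<in> poly_fun" "g \<in> poly_fun" "h \<in> poly_fun"
  shows "\<exists>N c. (\<exists>i\<le>N. \<exists>j\<le>N. \<exists>k\<le>N. c i j k \<noteq> 0) \<and>
      (\<forall>x\<in>S. (\<Sum>k\<le>N. (\<Sum>j\<le>N. (\<Sum>i\<le>N. c i j k * f x ^ i) * g x ^ j) * h x ^ k) = 0)"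
proof -
  \<comment> \<open>The constant 1 pads every monomial to exactly \<open>3 * N\<close> factors, so
    that all of them share the denominator \<open>d ^ (3 * N * M)\<close> and the bidegree bound
    \<open>3 * N * E\<close>.\<close>
  let ?Q = "{f, g, h, \<lambda>z. 1}"
  obtain M D where MD: "\<And>q. q \<in> ?Q \<Longrightarrow> represented M D q"
    using represented_common[of ?Q] assms by (auto intro: pf_const)
  obtain F1 F2 where "bideg F1 a" "bideg F2 b" using bideg_exists by blast
  then have ab: "bideg (F1 + F2) a" "bideg (F1 + F2) b" by (auto intro: bideg_mono)
  define E where "E = D + (F1 + F2)"
  have step: "represented (Suc n * M) (Suc n * E) (\<lambda>z. p z * q z)"
    if "represented (n * M) (n * E) p" "q \<in> ?Q" for n p q
    using represented_mult[OF that(1) MD[OF that(2)] ab] by (simp add: E_def add_ac)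
  have pow: "represented ((n + k) * M) ((n + k) * E) (\<lambda>z. p z * q z ^ k)"
    if "represented (n * M) (n * E) p" "q \<in> ?Q" for n k p q
  proof (induction k)
    case (Suc k)
    from step[OF this that(2)] show ?case by (simp add: algebra_simps)
  qed (use that in simp)
  have "represented 0 0 (\<lambda>z. 1)"
    unfolding represented_def by (intro exI[of _ 1] exI[of _ 0]) (simp add: bideg_def)
  then have mono: "represented ((i + j + k + l) * M) ((i + j + k + l) * E)
      (\<lambda>z. f z ^ i * g z ^ j * h z ^ k)" for i j k l
  proof -
    have "represented ((0 + i) * M) ((0 + i) * E) (\<lambda>z. 1 * f z ^ i)"
      by (rule pow) (use \<open>represented 0 0 _\<close> in simp_all)
    then have "represented ((0 + i + j) * M) ((0 + i + j) * E) (\<lambda>z. 1 * f z ^ i * g z ^ j)" by (rule pow) simp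
    then have "represented ((0 + i + j + k) * M) ((0 + i + j + k) * E) (\<lambda>z. 1 * f z ^ i * g z ^ j * h z ^ k)"
      by (rule pow) simp
    then have "represented ((0 + i + j + k + l) * M) ((0 + i + j + k + l) * E)
      (\<lambda>z. 1 * f z ^ i * g z ^ j * h z ^ k * 1 ^ l)" by (rule pow) simp
    then show ?thesis by simp
  qed
  \<comment> \<open>Since \<open>K + 1 \<le> (3 * E + 1) * (N + 1)\<close>, this choice leaves at
    most \<open>N * (N + 1)^2\<close> equations for the \<open>(N + 1)^3\<close> unknown
    coefficients.\<close>
  define N where "N = 2 * (3 * E + 1)^2"
  define K where "K = 3 * N * E"
  let ?d = "\<lambda>z. ev2 d (X z) (Y z) ^ (3 * N * M)"
  have "\<forall>t\<in>{..N} \<times> {..N} \<times> {..N}. \<exists>\<alpha> \<beta>. bideg K \<alpha> \<and> bideg K \<beta> \<and> (\<forall>z\<in>S.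
      ?d z * (f z ^ snd (snd t) * g z ^ fst (snd t) * h z ^ fst t) = ev2 \<alpha> (X z) (Y z) + ev2 \<beta> (X z) (Y z) * Z z)"
  proof
    fix t assume t: "t \<in> {..N} \<times> {..N} \<times> {..N}"
    define i j k where "i = snd (snd t)" and "j = fst (snd t)" and "k = fst t"
    have "i + j + k + (3 * N - (i + j + k)) = 3 * N" using t by (auto simp: i_def j_def k_def)
    with mono[of i j k "3 * N - (i + j + k)"]
    have "represented (3 * N * M) (3 * N * E) (\<lambda>z. f z ^ i * g z ^ j * h z ^ k)" by simp
    then show "\<exists>\<alpha> \<beta>. bideg K \<alpha> \<and> bideg K \<beta> \<and> (\<forall>z\<in>S.
      ?d z * (f z ^ snd (snd t) * g z ^ fst (snd t) * h z ^ fst t) = ev2 \<alpha> (X z) (Y z) + ev2 \<beta> (X z) (Y z) * Z z)"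
      unfolding represented_def K_def i_def j_def k_def .
  qed
  from bchoice[OF this] obtain \<alpha> where "\<forall>t\<in>{..N} \<times> {..N} \<times> {..N}. \<exists>\<beta>. bideg K (\<alpha> t) \<and> bideg K \<beta> \<and> (\<forall>z\<in>S.
      ?d z * (f z ^ snd (snd t) * g z ^ fst (snd t) * h z ^ fst t) = ev2 (\<alpha> t) (X z) (Y z) + ev2 \<beta> (X z) (Y z) * Z z)"
    by (elim exE)
  from bchoice[OF this] obtain \<beta> where \<beta>: "\<forall>t\<in>{..N} \<times> {..N} \<times> {..N}. bideg K (\<alpha> t) \<and> bideg K (\<beta> t) \<and> (\<forall>z\<in>S.
      ?d z * (f z ^ snd (snd t) * g z ^ fst (snd t) * h z ^ fst t) = ev2 (\<alpha> t) (X z) (Y z) + ev2 (\<beta> t) (X z) (Y z) * Z z)"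
    by (elim exE)
  note \<alpha>\<beta> = bspec[OF \<beta>]
  let ?I = "{..N} \<times> {..N} \<times> {..N}" and ?J = "{..K} \<times> {..K} \<times> (UNIV :: bool set)"
  define C where "C t j = coeff (coeff (if snd (snd j) then \<alpha> t else \<beta> t) (fst j)) (fst (snd j))"
    for t :: "nat \<times> nat \<times> nat" and j :: "nat \<times> nat \<times> bool"
  have "card ?J = 2 * (K + 1)^2" by (simp add: card_cartesian_product power2_eq_square)
  also have "K + 1 \<le> (3 * E + 1) * (N + 1)" by (simp add: K_def algebra_simps)
  then have "2 * (K + 1)^2 \<le> 2 * ((3 * E + 1) * (N + 1))^2" by (intro mult_le_mono2 power_mono) auto
  also have "\<dots> = N * (N + 1)^2" by (simp only: N_def power_mult_distrib mult.assoc)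
  also have "\<dots> < (N + 1) * (N + 1)^2" by (intro mult_strict_right_mono) auto
  also have "\<dots> = card ?I" by (simp add: card_cartesian_product power2_eq_square)
  finally obtain c where c: "\<exists>t\<in>?I. c t \<noteq> 0" "\<And>j. j \<in> ?J \<Longrightarrow> (\<Sum>t\<in>?I. c t * C t j) = 0"
    using homogeneous_system_nontrivial[of ?J ?I C] by auto
  have zero: "(\<Sum>t\<in>?I. smult [:c t:] (\<gamma> t)) = 0"
    if "\<gamma> = (if bl then \<alpha> else \<beta>)" for \<gamma> and bl :: bool
  proof (intro poly_eqI)
    fix r s
    have \<gamma>: "bideg K (\<gamma> t)" if "t \<in> ?I" for t using \<alpha>\<beta>[OF that] \<open>\<gamma> = _\<close> by (cases bl) auto
    have "coeff (coeff (\<Sum>t\<in>?I. smult [:c t:] (\<gamma> t)) r) s = (\<Sum>t\<in>?I. c t * coeff (coeff (\<gamma> t) r) s)"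
      by (simp add: coeff_sum)
    also have "\<dots> = 0"
    proof (cases "r \<le> K \<and> s \<le> K")
      case True
      then show ?thesis using c(2)[of "(r, s, bl)"] \<open>\<gamma> = _\<close> by (cases bl) (auto simp: C_def)
    next
      case False
      have "coeff (coeff (\<gamma> t) r) s = 0" if "t \<in> ?I" for t
        using False \<gamma>[OF that] unfolding bideg_def
        by (metis coeff_0 coeff_eq_0 le_trans not_le)
      then show ?thesis by (intro sum.neutral) auto
    qed
    finally show "coeff (coeff (\<Sum>t\<in>?I. smult [:c t:] (\<gamma> t)) r) s = coeff (coeff 0 r) s" by simp
  qed
  have ev: "(\<Sum>t\<in>?I. c t * ev2 (\<gamma> t) u v) = ev2 (\<Sum>t\<in>?I. smult [:c t:] (\<gamma> t)) u v" for \<gamma> u v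
    by (simp add: ev2_def poly_sum)
  have rel: "(\<Sum>t\<in>?I. c t * (f z ^ snd (snd t) * g z ^ fst (snd t) * h z ^ fst t)) = 0" if "z \<in> S" for z
  proof -
    have "?d z * (\<Sum>t\<in>?I. c t * (f z ^ snd (snd t) * g z ^ fst (snd t) * h z ^ fst t))
        = (\<Sum>t\<in>?I. c t * (?d z * (f z ^ snd (snd t) * g z ^ fst (snd t) * h z ^ fst t)))"
      unfolding sum_distrib_left by (simp add: mult.left_commute)
    also have "\<dots> = (\<Sum>t\<in>?I. c t * (ev2 (\<alpha> t) (X z) (Y z) + ev2 (\<beta> t) (X z) (Y z) * Z z))"
      by (rule sum.cong) (use \<alpha>\<beta> that in auto)
    also have "\<dots> = (\<Sum>t\<in>?I. c t * ev2 (\<alpha> t) (X z) (Y z)) + (\<Sum>t\<in>?I. c t * ev2 (\<beta> t) (X z) (Y z)) * Z z"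
      by (simp add: distrib_left sum.distrib sum_distrib_right mult.assoc)
    also have "\<dots> = 0" unfolding ev using zero[of \<alpha> True] zero[of \<beta> False] by simp
    finally show ?thesis using on_S_d[OF that] by simp
  qed
  have "(\<Sum>k\<le>N. (\<Sum>j\<le>N. (\<Sum>i\<le>N. c (k, j, i) * f z ^ i) * g z ^ j) * h z ^ k)
      = (\<Sum>t\<in>?I. c t * (f z ^ snd (snd t) * g z ^ fst (snd t) * h z ^ fst t))" for z
    by (simp add: sum_distrib_right sum.cartesian_product mult.assoc case_prod_unfold)
  with rel c(1) show ?thesis
    by (intro exI[of _ N] exI[of _ "\<lambda>i j k. c (k, j, i)"]) fastforce
qed

theorem dimension: "variety_dim_eq S 2"
proof -
  have "\<not> irr_chain_in S 3" using three_functions_dependent by (rule no_chain_of_dependent)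
  moreover have "Suc 2 = (3 :: nat)" by simp
  ultimately show ?thesis using chain_2 unfolding variety_dim_eq_def by simp
qed

end

subsection \<open>Tangent spaces and connectedness\<close>

lemma dim_complex_functional_kernel:
  assumes "c1 \<noteq> 0 \<or> c2 \<noteq> 0 \<or> (c3 :: complex) \<noteq> 0"
  shows "dim {\<xi> :: complex \<times> complex \<times> complex. c1 * fst \<xi> + c2 * fst (snd \<xi>) + c3 * snd (snd \<xi>) = 0} = 4"
    (is "dim ?K = 4")
proof -
  have *: "dim ?K = 4" if "linear f" "inj f" "range f = ?K"
    for f :: "complex \<times> complex \<Rightarrow> complex \<times> complex \<times> complex"
  proof -
    have "dim (range f) = dim (UNIV :: (complex \<times> complex) set)"
      using that(1,2) by (intro dim_image_eq) (auto intro: inj_on_subset)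
    then show ?thesis using that(3) by simp
  qed
  consider "c1 \<noteq> 0" | "c2 \<noteq> 0" | "c3 \<noteq> 0" using assms by blast
  then show ?thesis
  proof cases
    case 1
    define k l where "k = - c2 / c1" and "l = - c3 / c1"
    have e: "c1 * x + c2 * y + c3 * z = 0 \<longleftrightarrow> x = k * y + l * z" for x y z
    proof -
      have "c1 * k = - c2" "c1 * l = - c3" using 1 by (simp_all add: k_def l_def)
      then have "c1 * x + c2 * y + c3 * z = c1 * (x - (k * y + l * z))" by algebra
      then show ?thesis using 1 by simp
    qed
    show ?thesis
    proof (rule *)
      let ?f = "\<lambda>x :: complex \<times> complex. (k * fst x + l * snd x, fst x, snd x)"
      show "linear ?f" by (rule linearI) (auto simp: prod_eq_iff algebra_simps)
      show "inj ?f" by (auto simp: inj_on_def)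
      have "x = ?f (snd x)" if "x \<in> ?K" for x using that unfolding e by (auto simp: prod_eq_iff)
      moreover have "?f x \<in> ?K" for x unfolding e by simp
      ultimately show "range ?f = ?K" by blast
    qed
  next
    case 2
    define k l where "k = - c1 / c2" and "l = - c3 / c2"
    have e: "c1 * x + c2 * y + c3 * z = 0 \<longleftrightarrow> y = k * x + l * z" for x y z
    proof -
      have "c2 * k = - c1" "c2 * l = - c3" using 2 by (simp_all add: k_def l_def)
      then have "c1 * x + c2 * y + c3 * z = c2 * (y - (k * x + l * z))" by algebra
      then show ?thesis using 2 by simp
    qed
    show ?thesis
    proof (rule *)
      let ?f = "\<lambda>x :: complex \<times> complex. (fst x, k * fst x + l * snd x, snd x)"
      show "linear ?f" by (rule linearI) (auto simp: prod_eq_iff algebra_simps)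
      show "inj ?f" by (auto simp: inj_on_def)
      have "x = ?f ((fst x, snd (snd x)))" if "x \<in> ?K" for x using that unfolding e by (auto simp: prod_eq_iff)
      moreover have "?f x \<in> ?K" for x unfolding e by simp
      ultimately show "range ?f = ?K" by blast
    qed
  next
    case 3
    define k l where "k = - c1 / c3" and "l = - c2 / c3"
    have e: "c1 * x + c2 * y + c3 * z = 0 \<longleftrightarrow> z = k * x + l * y" for x y z
    proof -
      have "c3 * k = - c1" "c3 * l = - c2" using 3 by (simp_all add: k_def l_def)
      then have "c1 * x + c2 * y + c3 * z = c3 * (z - (k * x + l * y))" by algebra
      then show ?thesis using 3 by simp
    qed
    show ?thesis
    proof (rule *)
      let ?f = "\<lambda>x :: complex \<times> complex. (fst x, snd x, k * fst x + l * snd x)"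
      show "linear ?f" by (rule linearI) (auto simp: prod_eq_iff algebra_simps)
      show "inj ?f" by (auto simp: inj_on_def)
      have "x = ?f ((fst x, fst (snd x)))" if "x \<in> ?K" for x using that unfolding e by (auto simp: prod_eq_iff)
      moreover have "?f x \<in> ?K" for x unfolding e by simp
      ultimately show "range ?f = ?K" by blast
    qed
  qed
qed

lemma has_derivative_vec:
  fixes f :: "'a::real_normed_vector \<Rightarrow> complex^'n"
  assumes "\<And>i. ((\<lambda>x. f x $ i) has_derivative (\<lambda>\<xi>. f' \<xi> $ i)) (at x)"
  shows "(f has_derivative f') (at x)"
proof (rule has_derivative_componentwise_within[THEN iffD2], rule ballI)
  fix b :: "complex^'n" assume "b \<in> Basis"
  then have "\<exists>i c. b = axis i c" unfolding Basis_vec_def by (simp only: UN_iff singleton_iff bex_UNIV) (erule exE, erule bexE, intro exI)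
  then obtain i c where b: "b = axis i c" by (elim exE)
  have "((\<lambda>x. f x $ i \<bullet> c) has_derivative (\<lambda>\<xi>. f' \<xi> $ i \<bullet> c)) (at x)"
    by (rule has_derivative_inner_left[OF assms])
  then show "((\<lambda>x. f x \<bullet> b) has_derivative (\<lambda>\<xi>. f' \<xi> \<bullet> b)) (at x)"
    by (simp only: b inner_axis)
qed

context double_plane
begin

lemma vanish_on_W:
  assumes "\<And>u v w. on_W u v w \<Longrightarrow> ev2 \<alpha> u v + ev2 \<beta> u v * w = 0"
  shows "\<alpha> = 0 \<and> \<beta> = 0"
proof (rule norm_eq_0D[OF nonsquare_disc], rule ev2_eq_0_off[OF d_nonzero])
  fix u v assume "ev2 d u v \<noteq> 0"
  then obtain w where w: "on_W u v w" using onW_root by blast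
  have "ev2 (\<alpha>^2 + \<alpha> * \<beta> * a - \<beta>^2 * b) u v
      = (ev2 \<alpha> u v + ev2 \<beta> u v * w) * (ev2 \<alpha> u v + ev2 \<beta> u v * (ev2 a u v - w))
        + (ev2 \<beta> u v)^2 * (w^2 - ev2 a u v * w - ev2 b u v)"
    by (simp add: power2_eq_square algebra_simps)
  then show "ev2 (\<alpha>^2 + \<alpha> * \<beta> * a - \<beta>^2 * b) u v = 0"
    using assms[OF w] w unfolding on_W_def by simp
qed

lemma open_base: "open {x :: complex \<times> complex \<times> complex. ev2 d (fst x) (fst (snd x)) \<noteq> 0}"
proof -
  have "continuous_on UNIV (\<lambda>x :: complex \<times> complex \<times> complex. ev2 d (fst x) (fst (snd x)))"
    by (intro ev2_continuous_on continuous_intros)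
  from open_Collect_neq[OF this continuous_on_const[of _ 0]] show ?thesis by simp
qed

lemma vanishing_derivative:
  assumes h: "h \<in> good d" "\<And>u v w. on_W u v w \<Longrightarrow> h u v w = 0" and W: "on_W u v w"
    and h': "((\<lambda>x. h (fst x) (fst (snd x)) (snd (snd x))) has_derivative h') (at (u, v, w))"
    and Q': "((\<lambda>x. (snd (snd x))^2 - ev2 a (fst x) (fst (snd x)) * snd (snd x) - ev2 b (fst x) (fst (snd x)))
        has_derivative Q') (at (u, v, w))" and \<xi>: "Q' \<xi> = 0"
  shows "h' \<xi> = 0"
proof -
  obtain N \<alpha> \<beta> C where C: "C \<in> good d" and *: "\<And>u v w. ev2 d u v \<noteq> 0 \<Longrightarrow> ev2 d u v ^ N * h u v w
      = ev2 \<alpha> u v + ev2 \<beta> u v * w + (w^2 - ev2 a u v * w - ev2 b u v) * C u v w"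
    using good_reduce[OF h(1)] by blast
  have "ev2 \<alpha> u v + ev2 \<beta> u v * w = 0" if "on_W u v w" for u v w
    using *[of u v w] that h(2)[OF that] unfolding on_W_def by auto
  then have "\<alpha> = 0" "\<beta> = 0" using vanish_on_W by blast+
  let ?D = "\<lambda>x. ev2 d (fst x) (fst (snd x)) ^ N" and ?h = "\<lambda>x. h (fst x) (fst (snd x)) (snd (snd x))"
    and ?Q = "\<lambda>x. (snd (snd x))^2 - ev2 a (fst x) (fst (snd x)) * snd (snd x) - ev2 b (fst x) (fst (snd x))"
    and ?C = "\<lambda>x. C (fst x) (fst (snd x)) (snd (snd x))" and ?p = "(u, v, w)"
  have d0: "ev2 d u v \<noteq> 0" and Q0: "?Q ?p = 0" and h0: "?h ?p = 0"
    using W h(2) unfolding on_W_def by auto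
  have "?C differentiable (at ?p)" by (rule good_differentiable[OF C]) (simp add: d0)
  then obtain C' where C': "(?C has_derivative C') (at ?p)" unfolding differentiable_def by blast
  have "?D differentiable (at ?p)"
    using good_differentiable[OF good_power[OF good_ev2[of d]], of d ?p N] d0 by simp
  then obtain D' where D': "(?D has_derivative D') (at ?p)" unfolding differentiable_def by blast
  \<comment> \<open>Near the point \<open>d^N * h\<close> equals \<open>Q * C\<close>. In both
    product rules the terms with the values of \<open>h\<close> and \<open>Q\<close> drop out,
    leaving \<open>d^N * h' = Q' * C\<close>.\<close>
  have "((\<lambda>x. ?D x * ?h x) has_derivative (\<lambda>\<xi>. ?D ?p * h' \<xi> + D' \<xi> * ?h ?p)) (at ?p)"
    by (rule has_derivative_mult[OF D' h'])
  moreover have "((\<lambda>x. ?D x * ?h x) has_derivative (\<lambda>\<xi>. ?Q ?p * C' \<xi> + Q' \<xi> * ?C ?p)) (at ?p)"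
    by (rule has_derivative_transform_within_open[OF has_derivative_mult[OF Q' C'] open_base])
       (use d0 in \<open>auto simp: * \<open>\<alpha> = 0\<close> \<open>\<beta> = 0\<close>\<close>)
  ultimately have "(\<lambda>\<xi>. ?D ?p * h' \<xi> + D' \<xi> * ?h ?p) = (\<lambda>\<xi>. ?Q ?p * C' \<xi> + Q' \<xi> * ?C ?p)"
    by (rule has_derivative_unique)
  from fun_cong[OF this, of \<xi>] show ?thesis using Q0 h0 d0 \<xi> by simp
qed

lemma S_cases: assumes "z \<in> S" obtains u v w where "on_W u v w" "z = \<phi> u v w" "X z = u" "Y z = v" "Z z = w"
  by (rule that[of "X z" "Y z" "Z z"]) (use S_onto[OF assms] in auto)

text \<open>The differential \<open>L\<close> of \<open>\<Phi>\<close> maps the kernel of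
  \<open>Q'\<close> isomorphically onto the Zariski tangent space, the inverse being the
  differential of \<open>(X, Y, Z)\<close>. The kernel is a complex plane, of real dimension
  4.\<close>

lemma tangent_dim:
  assumes "z \<in> S" shows "dim (zariski_tangent S z) = 4"
proof -
  obtain u v w where W: "on_W u v w" and z: "z = \<phi> u v w" and uvw: "X z = u" "Y z = v" "Z z = w"
    using S_cases[OF assms] .
  have z\<Phi>: "z = \<Phi> u v w" using z \<Phi>_eq[OF W] by simp
  have d0: "ev2 d u v \<noteq> 0" using W unfolding on_W_def by blast
  let ?p = "(u, v, w)"
  let ?T = "\<lambda>x. (X x, Y x, Z x)"
  obtain au av where da: "((\<lambda>u. ev2 a u v) has_field_derivative au) (at u)"
    "((\<lambda>v. ev2 a u v) has_field_derivative av) (at v)"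
    "((\<lambda>x. ev2 a (fst x) (fst (snd x))) has_derivative (\<lambda>\<xi>. au * fst \<xi> + av * fst (snd \<xi>))) (at ?p)"
    using ev2_total_derivative[of a v u] by blast
  obtain bu bv where db: "((\<lambda>u. ev2 b u v) has_field_derivative bu) (at u)"
    "((\<lambda>v. ev2 b u v) has_field_derivative bv) (at v)"
    "((\<lambda>x. ev2 b (fst x) (fst (snd x))) has_derivative (\<lambda>\<xi>. bu * fst \<xi> + bv * fst (snd \<xi>))) (at ?p)"
    using ev2_total_derivative[of b v u] by blast
  define c1 c2 c3 where "c1 = - (au * w + bu)" and "c2 = - (av * w + bv)" and "c3 = 2 * w - ev2 a u v"
  define Q' where "Q' \<xi> = c1 * fst \<xi> + c2 * fst (snd \<xi>) + c3 * snd (snd \<xi>)"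
    for \<xi> :: "complex \<times> complex \<times> complex"
  let ?Q = "\<lambda>x. (snd (snd x))^2 - ev2 a (fst x) (fst (snd x)) * snd (snd x) - ev2 b (fst x) (fst (snd x))"
  have w': "((\<lambda>x :: complex \<times> complex \<times> complex. snd (snd x)) has_derivative (\<lambda>\<xi>. snd (snd \<xi>))) (at ?p)"
    by (intro has_derivative_snd has_derivative_ident)
  have Q': "(?Q has_derivative Q') (at ?p)"
    unfolding power2_eq_square
    by (rule has_derivative_eq_rhs[OF has_derivative_diff[OF has_derivative_diff[OF
            has_derivative_mult[OF w' w'] has_derivative_mult[OF da(3) w']] db(3)]])
       (auto simp: Q'_def c1_def c2_def c3_def fun_eq_iff algebra_simps)
  have "c1 \<noteq> 0 \<or> c2 \<noteq> 0 \<or> c3 \<noteq> 0"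
    using smooth[OF W _ da(1,2) db(1,2)] unfolding c1_def c2_def c3_def by (metis eq_iff_diff_eq_0 neg_equal_0_iff_equal)
  then have dimK: "dim {\<xi>. Q' \<xi> = 0} = 4" unfolding Q'_def by (rule dim_complex_functional_kernel)
  have G': "\<exists>g'. ((\<lambda>x. G i (fst x) (fst (snd x)) (snd (snd x))) has_derivative g') (at ?p)" for i
    using good_differentiable[OF G(1), of ?p i] d0 unfolding differentiable_def by simp
  then obtain g' where g': "\<And>i. ((\<lambda>x. G i (fst x) (fst (snd x)) (snd (snd x))) has_derivative g' i) (at ?p)"
    by metis
  define L where "L \<xi> = (\<chi> i. g' i \<xi>)" for \<xi>
  have L: "((\<lambda>x. \<Phi> (fst x) (fst (snd x)) (snd (snd x))) has_derivative L) (at ?p)"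
    by (rule has_derivative_vec) (simp add: L_def \<Phi>_def g')
  have deriv: "(f has_derivative frechet_derivative f (at x)) (at x)" if "f \<in> poly_fun" for f and x :: "complex^'n"
    using poly_fun_differentiable[OF that] frechet_derivative_works by blast
  define X' Y' Z' where "X' = frechet_derivative X (at z)" and "Y' = frechet_derivative Y (at z)"
    and "Z' = frechet_derivative Z (at z)"
  have XYZ': "(X has_derivative X') (at z)" "(Y has_derivative Y') (at z)" "(Z has_derivative Z') (at z)"
    unfolding X'_def Y'_def Z'_def using deriv XYZ by auto
  have comp: "((\<lambda>x. f (\<Phi> (fst x) (fst (snd x)) (snd (snd x)))) has_derivative (\<lambda>\<xi>. f' (L \<xi>))) (at ?p)"
    if "(f has_derivative f') (at z)" for f f'
    by (rule has_derivative_compose[OF L]) (use that z\<Phi> in simp)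
  \<comment> \<open>The function \<open>f (\<Phi> u v w) - k u v w\<close> vanishes on the cover, so
    its differential vanishes on the kernel of \<open>Q'\<close>. For the three coordinates this
    inverts \<open>L\<close>; with \<open>k = 0\<close> it shows that \<open>L\<close> lands in the
    tangent space.\<close>
  have left_inverse: "f' (L \<xi>) = k' \<xi>"
    if "f \<in> poly_fun" "(f has_derivative f') (at z)" "k \<in> good d"
      "((\<lambda>x. k (fst x) (fst (snd x)) (snd (snd x))) has_derivative k') (at ?p)"
      "\<And>u v w. on_W u v w \<Longrightarrow> f (\<phi> u v w) = k u v w" "Q' \<xi> = 0" for f f' k k' \<xi>
  proof -
    have "(\<lambda>\<xi>. f' (L \<xi>) - k' \<xi>) \<xi> = 0"
      by (rule vanishing_derivative[OF good_diff[OF good_pullback[OF that(1)] that(3)] _ W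
            has_derivative_diff[OF comp[OF that(2)] that(4)] Q' that(6)])
         (simp add: \<Phi>_eq that(5))
    then show ?thesis by simp
  qed
  have proj: "((\<lambda>x :: complex \<times> complex \<times> complex. fst x) has_derivative (\<lambda>\<xi>. fst \<xi>)) (at ?p)"
    "((\<lambda>x :: complex \<times> complex \<times> complex. fst (snd x)) has_derivative (\<lambda>\<xi>. fst (snd \<xi>))) (at ?p)"
    by (intro has_derivative_fst has_derivative_snd has_derivative_ident)+
  have retract: "(X' (L \<xi>), Y' (L \<xi>), Z' (L \<xi>)) = \<xi>" if "Q' \<xi> = 0" for \<xi>
    using left_inverse[OF XYZ(1) XYZ'(1) good_u proj(1) _ that]
      left_inverse[OF XYZ(2) XYZ'(2) good_v proj(2) _ that]
      left_inverse[OF XYZ(3) XYZ'(3) good_w w' _ that] inv by simp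
  have "zariski_tangent S z = L ` {\<xi>. Q' \<xi> = 0}"
  proof (intro set_eqI iffI)
    fix t assume t: "t \<in> zariski_tangent S z"
    have tan: "f' t = 0" if "f \<in> poly_fun" "\<And>x. x \<in> S \<Longrightarrow> f x = 0" "(f has_derivative f') (at z)" for f f'
      using t that frechet_derivative_at[OF that(3)] unfolding zariski_tangent_def vanishing_ideal_def by auto
    define \<xi> where "\<xi> = (X' t, Y' t, Z' t)"
    have XYZ'': "(?T has_derivative (\<lambda>t. (X' t, Y' t, Z' t))) (at z)"
      by (intro has_derivative_Pair XYZ')
    have "Q' \<xi> = 0"
    proof -
      have "(?Q has_derivative Q') (at (?T z))" using Q' uvw by simp
      from has_derivative_compose[OF XYZ'' this]
      have "((\<lambda>x. ?Q (?T x)) has_derivative (\<lambda>t. Q' (X' t, Y' t, Z' t))) (at z)" .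
      moreover have "(\<lambda>x. ?Q (?T x)) \<in> poly_fun"
        by (simp, intro poly_fun_diff pf_mult poly_fun_power poly_fun_ev2 XYZ)
      moreover have "?Q (?T x) = 0" if "x \<in> S" for x using S_onto[OF that] unfolding on_W_def by simp
      ultimately show ?thesis unfolding \<xi>_def by (rule tan[rotated -1])
    qed
    \<comment> \<open>The test function is \<open>x $ i - G i (X x) (Y x) (Z x)\<close> times a
      power of \<open>d\<close>: it is polynomial, vanishes on \<open>S\<close>, and its
      differential determines \<open>t $ i\<close> from \<open>\<xi>\<close>.\<close>
    moreover have "t $ i = L \<xi> $ i" for i
    proof -
      obtain N f where f: "f \<in> poly_fun" "\<And>z. ev2 d (X z) (Y z) \<noteq> 0 \<Longrightarrow>
           ev2 d (X z) (Y z) ^ N * G i (X z) (Y z) (Z z) = f z"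
        using good_clear_denominator[OF XYZ G(1)] by blast
      let ?D = "\<lambda>x. ev2 d (X x) (Y x) ^ N"
      have Dp: "?D \<in> poly_fun" by (intro poly_fun_power poly_fun_ev2 XYZ)
      then have Fp: "(\<lambda>x. ?D x * x $ i - f x) \<in> poly_fun" by (intro poly_fun_diff pf_mult pf_coord f(1))
      have F0: "?D x * x $ i - f x = 0" if "x \<in> S" for x
        using f(2)[OF on_S_d[OF that]] S_onto[OF that] G(2)[of "X x" "Y x" "Z x" i] by simp
      have open_d: "open {x. ev2 d (X x) (Y x) \<noteq> 0}"
      proof -
        have "continuous_on UNIV (\<lambda>x. ev2 d (X x) (Y x))"
          using poly_fun_differentiable[OF poly_fun_ev2[OF XYZ(1,2)]]
          by (simp add: continuous_at_imp_continuous_on differentiable_imp_continuous_within)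
        from open_Collect_neq[OF this continuous_on_const[of _ 0]] show ?thesis by simp
      qed
      have "((\<lambda>x. G i (fst x) (fst (snd x)) (snd (snd x))) has_derivative g' i) (at (?T z))"
        using g'[of i] uvw by simp
      from has_derivative_compose[OF XYZ'' this]
      have Gz: "((\<lambda>x. G i (X x) (Y x) (Z x)) has_derivative (\<lambda>t. g' i (X' t, Y' t, Z' t))) (at z)" by simp
      have xi: "((\<lambda>x. x $ i) has_derivative (\<lambda>t. t $ i)) (at z)"
        by (rule bounded_linear_imp_has_derivative[OF bounded_linear_vec_nth])
      have "((\<lambda>x. ?D x * (x $ i - G i (X x) (Y x) (Z x))) has_derivative
          (\<lambda>t. ?D z * (t $ i - g' i (X' t, Y' t, Z' t))
             + frechet_derivative ?D (at z) t * (z $ i - G i (X z) (Y z) (Z z)))) (at z)"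
        by (rule has_derivative_mult[OF deriv[OF Dp] has_derivative_diff[OF xi Gz]])
      then have "((\<lambda>x. ?D x * x $ i - f x) has_derivative
          (\<lambda>t. ?D z * (t $ i - g' i (X' t, Y' t, Z' t))
             + frechet_derivative ?D (at z) t * (z $ i - G i (X z) (Y z) (Z z)))) (at z)"
        by (rule has_derivative_transform_within_open[OF _ open_d])
           (use d0 uvw f(2) in \<open>auto simp: algebra_simps\<close>)
      from tan[OF Fp F0 this] show ?thesis
        using d0 uvw G(2)[OF W, of i] z unfolding L_def \<xi>_def by simp
    qed
    ultimately show "t \<in> L ` {\<xi>. Q' \<xi> = 0}" by (auto simp: vec_eq_iff)
  next
    fix t assume "t \<in> L ` {\<xi>. Q' \<xi> = 0}"
    then obtain \<xi> where \<xi>: "t = L \<xi>" "Q' \<xi> = 0" by blast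
    have "frechet_derivative f (at z) t = 0" if "f \<in> vanishing_ideal S" for f
    proof -
      have f: "f \<in> poly_fun" "\<And>x. x \<in> S \<Longrightarrow> f x = 0" using that unfolding vanishing_ideal_def by auto
      have "frechet_derivative f (at z) (L \<xi>) = (\<lambda>_. 0) \<xi>"
        by (rule left_inverse[OF f(1) deriv[OF f(1)] good_const[of 0] has_derivative_const _ \<xi>(2)])
           (simp add: f(2) S_into)
      then show ?thesis by (simp add: \<xi>(1))
    qed
    then show "t \<in> zariski_tangent S z" unfolding zariski_tangent_def by blast
  qed
  moreover have "dim (L ` {\<xi>. Q' \<xi> = 0}) = dim {\<xi>. Q' \<xi> = 0}"
  proof (rule dim_image_eq)
    show "linear L" using L by (rule has_derivative_linear)
    have "linear Q'" using Q' by (rule has_derivative_linear)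
    then have "subspace {\<xi>. Q' \<xi> = 0}" by (rule linear_subspace_kernel)
    then have span: "span {\<xi>. Q' \<xi> = 0} = {\<xi>. Q' \<xi> = 0}" by (simp only: span_eq_iff)
    have "inj_on L {\<xi>. Q' \<xi> = 0}" 
    proof (rule inj_onI)
      fix \<xi> \<eta> assume "\<xi> \<in> {\<xi>. Q' \<xi> = 0}" "\<eta> \<in> {\<xi>. Q' \<xi> = 0}" and eq: "L \<xi> = L \<eta>"
      then have Q: "Q' \<xi> = 0" "Q' \<eta> = 0" by simp_all
      from retract[OF Q(1), symmetric] show "\<xi> = \<eta>" unfolding eq using retract[OF Q(2)] by (rule trans)
    qed
    then show "inj_on L (span {\<xi>. Q' \<xi> = 0})" unfolding span .
  qed
  ultimately show ?thesis using dimK by simp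
qed

theorem smooth_variety: "smooth_variety_dim S 2"
  unfolding smooth_variety_dim_def using dimension tangent_dim by simp

theorem connected_S:
  assumes branch: "ev2 d u0 v0 \<noteq> 0" "ev2 (a^2 + 4 * b) u0 v0 = 0"
  shows "connected S"
proof -
  let ?U = "{p. ev2 d (fst p) (snd p) \<noteq> 0}"
  let ?W = "{(p, w). p \<in> ?U \<and> w^2 = ev2 a (fst p) (snd p) * w + ev2 b (fst p) (snd p)}"
  have "connected ?W"
    by (rule connected_quadratic_cover[OF connected_curve_complement, of _ _ "(u0, v0)"])
       (use branch in \<open>auto intro!: ev2_continuous_on continuous_intros\<close>)
  moreover have "continuous_on ?W (\<lambda>x. \<Phi> (fst (fst x)) (snd (fst x)) (snd x))"
    unfolding \<Phi>_def
  proof (rule continuous_on_vec_lambda)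
    fix i
    have "isCont (\<lambda>x. G i (fst x) (fst (snd x)) (snd (snd x))) x" if "ev2 d (fst x) (fst (snd x)) \<noteq> 0" for x
      using good_differentiable[OF G(1) that] differentiable_imp_continuous_within by blast
    then have "continuous_on {x. ev2 d (fst x) (fst (snd x)) \<noteq> 0} (\<lambda>x. G i (fst x) (fst (snd x)) (snd (snd x)))"
      by (simp add: continuous_at_imp_continuous_on)
    moreover have "continuous_on ?W (\<lambda>x. (fst (fst x), snd (fst x), snd x))" by (intro continuous_intros)
    ultimately have "continuous_on ?W (\<lambda>x. G i (fst (fst (fst x), snd (fst x), snd x))
        (fst (snd (fst (fst x), snd (fst x), snd x))) (snd (snd (fst (fst x), snd (fst x), snd x))))"
      by (rule continuous_on_compose2) auto
    then show "continuous_on ?W (\<lambda>x. G i (fst (fst x)) (snd (fst x)) (snd x))" by simp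
  qed
  ultimately have "connected ((\<lambda>x. \<Phi> (fst (fst x)) (snd (fst x)) (snd x)) ` ?W)"
    by (rule connected_continuous_image[rotated])
  moreover have "(\<lambda>x. \<Phi> (fst (fst x)) (snd (fst x)) (snd x)) ` ?W = S"
  proof (intro set_eqI iffI)
    fix z assume "z \<in> S"
    then obtain u v w where "on_W u v w" "z = \<phi> u v w" using S_cases by blast
    then show "z \<in> (\<lambda>x. \<Phi> (fst (fst x)) (snd (fst x)) (snd x)) ` ?W"
      using \<Phi>_eq unfolding on_W_def by (intro image_eqI[of _ _ "((u, v), w)"]) (auto simp: on_W_def)
  next
    fix z assume "z \<in> (\<lambda>x. \<Phi> (fst (fst x)) (snd (fst x)) (snd x)) ` ?W"
    then obtain u v w where "on_W u v w" "z = \<Phi> u v w" unfolding on_W_def by auto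
    then show "z \<in> S" using S_into \<Phi>_eq by simp
  qed
  ultimately show ?thesis by simp
qed

end

subsection \<open>Decomposition of the gluing equations\<close>

lemma cancel_two: "2 * x = 0 \<Longrightarrow> x = (0::complex)"
  by simp

text \<open>The case \<open>k = 1\<close>, \<open>c = 0\<close> of \<open>key_alternative\<close>,
  where the linear relation between \<open>a\<close> and \<open>b\<close> is empty. The multipliers
  place four times the difference in the ideal of the two equations.\<close>

lemma key_special_unit:
  fixes a b A B :: complex
  assumes e1: "(b - B) * (a + A) = (a - A)^2 - 2 * A * b"
    and e2: "(a - A) * (b + B) = (b - B)^2 - 2 * B * a"
  shows "A^2 * b ^ 3 = B^2 * a ^ 3"
proof -
  have "4 * (A^2 * b ^ 3 - B^2 * a ^ 3)
    = ((b - B) * (a + A) - ((a - A)^2 - 2 * A * b))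
        * (B^2 * a - B^2 * b + 2 * B * a * b + 2 * B * b^2 + a * b^2 - b ^ 3)
      + ((a - A) * (b + B) - ((b - B)^2 - 2 * B * a))
        * (- (A * B * a) + A * B * b - A * a * b - 3 * A * b^2 - B * a^2 + B * a * b + a^2 * b - a * b^2)"
    by algebra
  then show ?thesis using e1 e2 by simp
qed

text \<open>The case \<open>U = W = 0\<close> of \<open>key_alternative\<close>, where the linear
  relation is again empty. The equations force \<open>a = k^3 * b\<close> and then make
  \<open>k\<close> a primitive cube root of unity.\<close>

lemma key_special_degenerate:
  fixes a b A B k c :: complex
  assumes nz: "b \<noteq> 0" "B \<noteq> 0" "k \<noteq> 0" and c: "c = k * (k - 1) * B" and A: "A = - (k ^ 3 * B)"
    and e1: "k ^ 3 * (b - B) * (a + A) - 2 * k^2 * a * c = (a - A)^2 - 2 * k^2 * A * b"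
    and e2: "(a - A) * (b + B) - 2 * k * b * c = k ^ 3 * (b - B)^2 - 2 * k * B * a"
  shows "a = b"
proof -
  have "(a - k ^ 3 * b)^2 = 0" using e1 e2 unfolding c A by algebra
  then have a: "a = k ^ 3 * b" by simp
  have "2 * k^2 * B * b * (k^2 + k + 1) = 0" using e2 unfolding a c A by algebra
  then have "k^2 + k + 1 = 0" using nz by simp
  then have "k ^ 3 = 1" by algebra
  then show ?thesis using a by simp
qed

text \<open>The first relation is linear in \<open>a, b\<close>, so \<open>a = \<theta> U\<close> and \<open>b = \<theta> W\<close>; the other two become quadratic
  equations for \<open>\<theta>\<close>, and their resultant is a multiple of \<open>(U - W) (A\<^sup>2 W\<^sup>3 - B\<^sup>2 U\<^sup>3)\<close>.\<close>
lemma key_alternative: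
  fixes a b A B k c :: complex
  assumes nz: "a \<noteq> 0" "b \<noteq> 0" "A \<noteq> 0" "B \<noteq> 0" "k \<noteq> 0" and c: "c = A * B + 1"
    and J: "k^2 * (b * c + a * B) + k * (A * b - a * B) - (a * c + A * b) = 0"
    and e1: "k ^ 3 * (b - B) * (a + A) - 2 * k^2 * a * c = (a - A)^2 - 2 * k^2 * A * b"
    and e2: "(a - A) * (b + B) - 2 * k * b * c = k ^ 3 * (b - B)^2 - 2 * k * B * a"
  shows "a = b \<or> A^2 * b ^ 3 = B^2 * a ^ 3"
proof (cases "k = 1")
  case True
  have "c * (b - a) = 0" using J True by algebra
  then consider "a = b" | "c = 0" by auto
  then show ?thesis
  proof cases
    case 2
    then have "A^2 * b ^ 3 = B^2 * a ^ 3" using e1 e2 unfolding True by (intro key_special_unit) auto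
    then show ?thesis ..
  qed simp
next
  case False
  define U W where "U = k^2 * c + (k - 1) * A" and "W = c - k * (k - 1) * B"
  have UW: "b * U = a * W" using J unfolding U_def W_def by algebra
  show ?thesis
  proof (cases "U = 0")
    case True
    then have "W = 0" using UW nz by simp
    then have c': "c = k * (k - 1) * B" by (simp add: W_def)
    have "(k - 1) * (A + k ^ 3 * B) = 0" using True unfolding U_def c' by algebra
    then have "A = - (k ^ 3 * B)" using False by (simp add: eq_neg_iff_add_eq_0)
    then show ?thesis using key_special_degenerate[OF nz(2,4,5) c' _ e1 e2] by blast
  next
    case U: False
    then have W: "W \<noteq> 0" using UW nz by auto
    define \<theta> where "\<theta> = a / U"
    have a: "a = \<theta> * U" using U by (simp add: \<theta>_def)
    have b: "b = \<theta> * W" using UW U by (simp add: \<theta>_def field_simps)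
    have \<theta>: "\<theta> \<noteq> 0" using a nz by auto
    define Z \<beta> \<gamma> T V where "Z = k^2 * c - k ^ 4 * B - A"
      and "\<beta> = W * (3 * k^2 * A - k ^ 4 * c) + U * (2 * A - k^2 * c - k ^ 4 * B)"
      and "\<gamma> = W * (2 * k ^ 4 * B - k^2 * c - A) + U * (3 * k^2 * B - c)"
      and "T = B * U + A * W" and "V = A + k ^ 3 * B"
    have E1: "\<theta>^2 * U * (k - 1) * Z + \<theta> * \<beta> = A * V"
      using e1 unfolding a b \<beta>_def Z_def V_def U_def W_def by algebra
    have E2: "- (k * \<theta>^2 * W * (k - 1) * Z) + \<theta> * \<gamma> = k * B * V"
      using e2 unfolding a b \<gamma>_def Z_def V_def U_def W_def by algebra
    \<comment> \<open>Cancelling the right-hand sides of \<open>E1\<close> and \<open>E2\<close>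
      leaves \<open>M\<close>, cancelling their \<open>\<theta>^2\<close> terms leaves
      \<open>N\<close>. The product of the two results no longer contains
      \<open>\<theta>\<close>.\<close>
    define M where "M = A * \<gamma> - k * B * \<beta>"
    define N where "N = - 2 * c^2 * k^2 - 2 * c^2 * k - c * A * k + c * A + c * B * k ^ 3 - c * B * k^2
      - A * B * k ^ 3 + A * B * k^2 + A * B * k - A * B"
    have N: "k * W * \<beta> + U * \<gamma> = k * Z * N"
      unfolding \<beta>_def \<gamma>_def Z_def N_def U_def W_def by algebra
    have "\<theta> * (\<theta> * (k - 1) * k * Z * T - M) = 0" using E1 E2 unfolding T_def M_def by algebra
    then have F1: "\<theta> * (k - 1) * k * Z * T = M" using \<theta> by simp
    have "k * (\<theta> * Z * N - V * T) = 0" using E1 E2 N unfolding T_def by algebra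
    then have F2: "\<theta> * Z * N = V * T" using nz by simp
    have "M * N = (k - 1) * k * T * (\<theta> * Z * N)" unfolding F1[symmetric] by (simp add: mult_ac)
    then have MN: "M * N = (k - 1) * k * V * T^2" unfolding F2 by (simp add: power2_eq_square mult_ac)
    \<comment> \<open>The factors of the resultant: \<open>U - W\<close> is a multiple of
      \<open>X0\<close>, which leads to \<open>a = b\<close>, and
      \<open>A^2 * W^3 - B^2 * U^3\<close> is a multiple of \<open>Q\<close>.\<close>
    define X0 Q where "X0 = (k + 1) * c + A + k * B"
      and "Q = (A - k ^ 3 * B) * c ^ 3 - 3 * k * (k - 1) * A * B * c^2 - (k - 1) ^ 3 * A^2 * B^2"
    have id: "M * N = (k - 1) * k * V * T^2 + 4 * k ^ 3 * X0 * Q"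
      unfolding M_def N_def V_def T_def X0_def Q_def \<beta>_def \<gamma>_def U_def W_def c by algebra
    then have "X0 = 0 \<or> Q = 0" using MN nz by simp
    then show ?thesis
    proof
      assume "X0 = 0"
      moreover have "U - W = (k - 1) * X0" unfolding U_def W_def X0_def by algebra
      ultimately show ?thesis using a b by simp
    next
      assume "Q = 0"
      moreover have "A^2 * W ^ 3 - B^2 * U ^ 3 = V * Q"
        unfolding U_def W_def V_def Q_def c by algebra
      ultimately have "A^2 * W ^ 3 = B^2 * U ^ 3" by simp
      then have "A^2 * b ^ 3 = B^2 * a ^ 3" unfolding a b by (simp add: power_mult_distrib)
      then show ?thesis ..
    qed
  qed
qed


section \<open>The face relations, their involution and the two cubics\<close>

definition gf :: "complex \<Rightarrow> complex \<Rightarrow> complex" where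
  "gf t x = (1 - x) * (1 - t * x)"

definition sol :: "complex \<Rightarrow> complex \<Rightarrow> complex \<Rightarrow> complex \<Rightarrow> complex \<Rightarrow> bool" where
  "sol t p q r s \<longleftrightarrow> t \<noteq> 0 \<and> p \<noteq> 0 \<and> q \<noteq> 0 \<and> r \<noteq> 0 \<and> s \<noteq> 0 \<and>
     t * p * s = gf t q * gf t r \<and> p * q * gf t r * gf t s = t * r^2 * s^2 \<and>
     t * q * r = gf t p * gf t s \<and> r * s * gf t p * gf t q = t * p^2 * q^2"

text \<open>The divided difference of the cubic \<open>z * gf t z\<close>: it vanishes when
  \<open>x\<close> and \<open>y\<close> are two roots, with multiplicity, of
  \<open>z * gf t z = const\<close>.\<close>

definition quad :: "complex \<Rightarrow> complex \<Rightarrow> complex \<Rightarrow> complex" where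
  "quad t x y = 1 - (1 + t) * (x + y) + t * (x^2 + x * y + y^2)"

text \<open>By Vieta the third root of the cubic through \<open>p\<close> and \<open>q\<close> is
  \<open>1 + 1 / t - p - q\<close>; the factors in the last equation are \<open>t\<close> times the
  third roots.\<close>

definition compX :: "complex \<Rightarrow> complex \<Rightarrow> complex \<Rightarrow> complex \<Rightarrow> complex \<Rightarrow> bool" where
  "compX t p q r s \<longleftrightarrow> quad t p q = 0 \<and> quad t r s = 0 \<and>
     (1 + t - t * (p + q)) * (1 + t - t * (r + s)) = t"

lemma gf_inverse: "t \<noteq> 0 \<Longrightarrow> x \<noteq> 0 \<Longrightarrow> gf t (1 / (t * x)) = gf t x / (t * x^2)"
  by (simp add: gf_def field_simps power2_eq_square)

lemma sol_gf_nonzero: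
  assumes "sol t p q r s" shows "gf t p \<noteq> 0" "gf t q \<noteq> 0" "gf t r \<noteq> 0" "gf t s \<noteq> 0"
  using assms unfolding sol_def by auto

lemma sol_ratios:
  assumes "sol t p q r s"
  shows "p^2 * q * gf t s = r^2 * s * gf t q" "p * q^2 * gf t r = r * s^2 * gf t p"
proof -
  define G1 G2 G3 G4 where "G1 = gf t p" and "G2 = gf t q" and "G3 = gf t r" and "G4 = gf t s"
  note G = G1_def[symmetric] G2_def[symmetric] G3_def[symmetric] G4_def[symmetric]
  have s: "t \<noteq> 0" "s \<noteq> 0" "r \<noteq> 0" "G3 \<noteq> 0" "t * p * s = G2 * G3" "p * q * G3 * G4 = t * r^2 * s^2" "t * q * r = G1 * G4"
    using assms sol_gf_nonzero[OF assms] unfolding sol_def G by auto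
  have "(t * s * G3) * (p^2 * q * G4) = (t * p * s) * (p * q * G3 * G4)" by (simp add: power2_eq_square)
  also have "\<dots> = (t * s * G3) * (r^2 * s * G2)" unfolding s(5,6) by (simp add: power2_eq_square)
  finally show "p^2 * q * gf t s = r^2 * s * gf t q" using s(1-4) unfolding G by simp
  have "(t * r) * (p * q^2 * G3) = p * q * G3 * (t * q * r)" by (simp add: power2_eq_square)
  also have "\<dots> = (p * q * G3 * G4) * G1" unfolding s(7) by simp
  also have "\<dots> = (t * r) * (r * s^2 * G1)" unfolding s(6) by (simp add: power2_eq_square)
  finally show "p * q^2 * gf t r = r * s^2 * gf t p" using s(1,3) unfolding G by simp
qed

text \<open>\<open>x \<mapsto> 1 / (t * x)\<close> changes \<open>gf t\<close> only by a monomial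
  factor, so the substitution permutes the face relations: the first trades places with the fourth,
  the second with the third.\<close>

lemma sol_sigma:
  assumes "sol t p q r s" shows "sol t (1 / (t * r)) (1 / (t * q)) (1 / (t * p)) (1 / (t * s))"
proof -
  define G1 G2 G3 G4 where "G1 = gf t p" and "G2 = gf t q" and "G3 = gf t r" and "G4 = gf t s"
  note G = G1_def[symmetric] G2_def[symmetric] G3_def[symmetric] G4_def[symmetric]
  have s: "t \<noteq> 0" "p \<noteq> 0" "q \<noteq> 0" "r \<noteq> 0" "s \<noteq> 0"
    "t * p * s = G2 * G3" "p * q * G3 * G4 = t * r^2 * s^2" "t * q * r = G1 * G4"
    "r * s * G1 * G2 = t * p^2 * q^2" "G1 \<noteq> 0" "G2 \<noteq> 0" "G3 \<noteq> 0" "G4 \<noteq> 0"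
    using assms sol_gf_nonzero[OF assms] unfolding sol_def G by auto
  have "t * (1 / (t * r)) * (1 / (t * s)) = G2 / (t * q^2) * (G1 / (t * p^2))"
    using s(1-5,9) by (simp add: field_simps)
  moreover have "1 / (t * r) * (1 / (t * q)) * (G1 / (t * p^2)) * (G4 / (t * s^2)) = t * (1 / (t * p))^2 * (1 / (t * s))^2"
    using s(1-5,8,10-13) by (simp add: field_simps power2_eq_square)
  moreover have "t * (1 / (t * q)) * (1 / (t * p)) = G3 / (t * r^2) * (G4 / (t * s^2))"
    using s(1-5,7) by (simp add: field_simps)
  moreover have "1 / (t * p) * (1 / (t * s)) * (G3 / (t * r^2)) * (G2 / (t * q^2)) = t * (1 / (t * r))^2 * (1 / (t * q))^2"
    using s(1-6,10-13) by (simp add: field_simps power2_eq_square)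
  ultimately show ?thesis
    using s(1-5) unfolding sol_def by (simp add: gf_inverse G)
qed

text \<open>Up to scaling, \<open>A\<close> and \<open>B\<close> are the reciprocals of the proportionality factors
  \<open>gf t q / (q * p\<^sup>2)\<close> and \<open>gf t p / (p * q\<^sup>2)\<close>; in these terms the equations become linear in \<open>A, B, a, b\<close>.\<close>
definition pA where "pA t p q r s = p^2 / (s * gf t q)" for t p q r s :: complex
definition pB where "pB t p q r s = q^2 / (r * gf t p)" for t p q r s :: complex
text \<open>\<open>pa\<close> and \<open>pb\<close> agree exactly when
  \<open>p * gf t p = q * gf t q\<close>, that is, when \<open>p\<close> and \<open>q\<close> have
  the same value under the cubic.\<close>

definition pa where "pa t p q r s = r * s * gf t p / q" for t p q r s :: complex
definition pb where "pb t p q r s = r * s * gf t q / p" for t p q r s :: complex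
definition pk where "pk t p q r s = (p - r) / (q - s)" for t p q r s :: complex

lemma param_nonzero:
  assumes "sol t p q r s"
  shows "pA t p q r s \<noteq> 0" "pB t p q r s \<noteq> 0" "pa t p q r s \<noteq> 0" "pb t p q r s \<noteq> 0"
  using assms sol_gf_nonzero[OF assms] unfolding sol_def pA_def pB_def pa_def pb_def by auto

text \<open>As \<open>A * B = 1 / t\<close>, the number \<open>c\<close> is
  \<open>1 + 1 / t\<close>, the sum of the roots of the cubic, and
  \<open>A * B * gf t x = A * B - c * x + x^2\<close>. The products \<open>p * r = A * b\<close> and
  \<open>q * s = B * a\<close> then remove the nonlinear terms on the left.\<close>

lemma param_system:
  assumes sol: "sol t p q r s"
  defines "A \<equiv> pA t p q r s" and "B \<equiv> pB t p q r s" and "a \<equiv> pa t p q r s" and "b \<equiv> pb t p q r s"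
  defines "c \<equiv> A * B + 1"
  shows "p * r = A * b" "q * s = B * a" "A * B * t = 1"
    "A * s + a * q - c * a = p^2" "A * q + a * s - c * a = r^2"
    "B * r + b * p - c * b = q^2" "B * p + b * r - c * b = s^2"
proof -
  define G1 G2 G3 G4 where "G1 = gf t p" and "G2 = gf t q" and "G3 = gf t r" and "G4 = gf t s"
  note G = G1_def[symmetric] G2_def[symmetric] G3_def[symmetric] G4_def[symmetric]
  have s: "t \<noteq> 0" "p \<noteq> 0" "q \<noteq> 0" "r \<noteq> 0" "s \<noteq> 0" "G1 \<noteq> 0" "G2 \<noteq> 0"
    and F4: "r * s * G1 * G2 = t * p^2 * q^2"
    and ratio: "p^2 * q * G4 = r^2 * s * G2" "p * q^2 * G3 = r * s^2 * G1"
    using sol sol_gf_nonzero[OF sol] sol_ratios[OF sol] unfolding sol_def G by auto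
  have AB: "A = p^2 / (s * G2)" "B = q^2 / (r * G1)" "a = r * s * G1 / q" "b = r * s * G2 / p"
    unfolding A_def B_def a_def b_def pA_def pB_def pa_def pb_def G by simp_all
  have nz: "A \<noteq> 0" "B \<noteq> 0" using s AB by auto
  show e: "p * r = A * b" and f: "q * s = B * a" using s by (simp_all add: AB power2_eq_square)
  show t: "A * B * t = 1" using s F4 by (simp add: AB field_simps)
  have h1: "A * s * G2 = p^2" using s by (simp add: AB)
  have h2: "A * q * G4 = r^2" using s ratio(1) by (simp add: AB field_simps)
  have h3: "B * r * G1 = q^2" using s by (simp add: AB)
  have h4: "B * p * G3 = s^2" using s ratio(2) by (simp add: AB field_simps)
  have key: "A * B * gf t x = A * B - c * x + x^2" for x
    using t unfolding gf_def c_def by algebra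
  have "B * (A * s + a * q - c * a) = s * (A * B * G2)" using f unfolding G2_def key by algebra
  also have "\<dots> = B * p^2" using h1 by algebra
  finally show "A * s + a * q - c * a = p^2" using nz by simp
  have "B * (A * q + a * s - c * a) = q * (A * B * G4)" using f unfolding G4_def key by algebra
  also have "\<dots> = B * r^2" using h2 by algebra
  finally show "A * q + a * s - c * a = r^2" using nz by simp
  have "A * (B * r + b * p - c * b) = r * (A * B * G1)" using e unfolding G1_def key by algebra
  also have "\<dots> = A * q^2" using h3 by algebra
  finally show "B * r + b * p - c * b = q^2" using nz by simp
  have "A * (B * p + b * r - c * b) = p * (A * B * G3)" using e unfolding G3_def key by algebra
  also have "\<dots> = A * s^2" using h4 by algebra
  finally show "B * p + b * r - c * b = s^2" using nz by simp
qed

text \<open>Exchanging \<open>p\<close> with \<open>r\<close> and \<open>q\<close> with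
  \<open>s\<close> swaps the two equations of each pair in \<open>param_system\<close>. Their
  differences are divisible by \<open>q - s\<close> and yield \<open>p + r\<close> and
  \<open>q + s\<close>; inserted into their sums, these leave relations in \<open>A\<close>,
  \<open>B\<close>, \<open>a\<close>, \<open>b\<close>, \<open>k\<close> alone.\<close>

lemma param_relations:
  assumes sol: "sol t p q r s" and ne: "p \<noteq> r" "q \<noteq> s"
  defines "A \<equiv> pA t p q r s" and "B \<equiv> pB t p q r s" and "a \<equiv> pa t p q r s" and "b \<equiv> pb t p q r s"
    and "k \<equiv> pk t p q r s"
  defines "c \<equiv> A * B + 1"
  shows "k \<noteq> 0" "p - r = k * (q - s)" "k * (p + r) = a - A" "q + s = k * (b - B)"
    "k^2 * (b * c + a * B) + k * (A * b - a * B) - (a * c + A * b) = 0"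
    "k ^ 3 * (b - B) * (a + A) - 2 * k^2 * a * c = (a - A)^2 - 2 * k^2 * A * b"
    "(a - A) * (b + B) - 2 * k * b * c = k ^ 3 * (b - B)^2 - 2 * k * B * a"
proof -
  note sys = param_system[OF sol, folded A_def B_def a_def b_def, folded c_def]
  show k: "k \<noteq> 0" "p - r = k * (q - s)" using ne by (simp_all add: k_def pk_def)
  have "(q - s) * (k * (p + r) - (a - A)) = 0" using sys(4,5) k(2) by algebra
  then show E: "k * (p + r) = a - A" using ne by simp
  have "(q - s) * (q + s - k * (b - B)) = 0" using sys(6,7) k(2) by algebra
  then show H: "q + s = k * (b - B)" using ne by simp
  have S1: "(A + a) * (q + s) - 2 * c * a = (p + r)^2 - 2 * A * b" using sys(1,4,5) by algebra
  have S2: "(B + b) * (p + r) - 2 * c * b = (q + s)^2 - 2 * B * a" using sys(2,6,7) by algebra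
  have K: "(p + r)^2 - 4 * A * b = k^2 * ((q + s)^2 - 4 * B * a)" using sys(1,2) k(2) by algebra
  have "2 * (k^2 * (b * c + a * B) + k * (A * b - a * B) - (a * c + A * b)) = 0"
    using S1 S2 K E H by algebra
  then show "k^2 * (b * c + a * B) + k * (A * b - a * B) - (a * c + A * b) = 0" by (rule cancel_two)
  show "k ^ 3 * (b - B) * (a + A) - 2 * k^2 * a * c = (a - A)^2 - 2 * k^2 * A * b"
    using S1 E H by algebra
  show "(a - A) * (b + B) - 2 * k * b * c = k ^ 3 * (b - B)^2 - 2 * k * B * a"
    using S2 E H by algebra
qed


lemma compX_criterion:
  assumes sol: "sol t p q r s" and ne: "p \<noteq> r" "q \<noteq> s"
  defines "A \<equiv> pA t p q r s" and "B \<equiv> pB t p q r s" and "a \<equiv> pa t p q r s" and "k \<equiv> pk t p q r s"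
  defines "c \<equiv> A * B + 1"
  assumes ab: "pb t p q r s = a" and X0: "(k + 1) * c + A + k * B = 0"
    and X1: "a * (k + 1) * (k^2 + k + 1) = A + k ^ 3 * B"
  shows "compX t p q r s"
proof -
  note sys = param_system[OF sol, unfolded ab, folded A_def B_def a_def, folded c_def]
  note rel = param_relations[OF sol ne, unfolded ab, folded A_def B_def a_def k_def, folded c_def]
  have nz: "A \<noteq> 0" "B \<noteq> 0" "a \<noteq> 0" "t \<noteq> 0"
    using param_nonzero[OF sol] sol unfolding A_def B_def a_def sol_def by auto
  define E H n where "E = p + r" and "H = q + s" and "n = q - s"
  note k = rel(1) and m = rel(2)[folded n_def] and kE = rel(3)[folded E_def] and kH = rel(4)[folded H_def]
  \<comment> \<open>Together with \<open>P3\<close> these are the equations of \<open>compX\<close>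
    multiplied by \<open>A * B\<close> or its square. Sum and difference are used because they are
    governed by \<open>E\<close>, \<open>H\<close>, \<open>k\<close> and \<open>n\<close>.\<close>
  define P1 P2 where "P1 = A * B - c * (p + q) + p^2 + p * q + q^2"
    and "P2 = A * B - c * (r + s) + r^2 + r * s + s^2"
  define P3 where "P3 = (c - (p + q)) * (c - (r + s)) - A * B"
  have n: "n^2 = H^2 - 4 * B * a" using sys(2) unfolding n_def H_def by algebra
  have diff: "2 * (P1 - P2) = n * (- 2 * c * (k + 1) + (2 * k + 1) * E + (k + 2) * H)"
    using m unfolding P1_def P2_def E_def H_def n_def by algebra
  have sum: "2 * (P1 + P2) = 4 * A * B - 2 * c * (E + H) + 2 * E^2 - 4 * A * a + 2 * H^2 - 4 * B * a
      + E * H + k * (H^2 - 4 * B * a)"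
    using m n sys(1,2) unfolding P1_def P2_def E_def H_def n_def by algebra
  have P3: "2 * P3 = 2 * c^2 - 2 * c * (E + H) + 2 * A * a + 2 * B * a + E * H - k * (H^2 - 4 * B * a) - 2 * A * B"
    using m n sys(1,2) unfolding P3_def E_def H_def n_def by algebra
  have "k * (- 2 * c * (k + 1) + (2 * k + 1) * E + (k + 2) * H) = 0"
    using X0 X1 kE kH by algebra
  then have d0: "P1 - P2 = 0" using diff k by simp
  have "P1 + P2 = 0 \<and> P3 = 0"
  proof (cases "k = -1")
    case False
    then have k1: "k + 1 \<noteq> 0" by (simp add: eq_neg_iff_add_eq_0)
    have "(k + 1) * k^2 * (2 * (P1 + P2)) = 0" unfolding sum using X0 X1 kE kH by algebra
    moreover have "(k + 1)^2 * k * (2 * P3) = 0" unfolding P3 using X0 X1 kE kH by algebra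
    ultimately have "2 * (P1 + P2) = 0" "2 * P3 = 0" using k k1 mult_eq_0_iff by auto
    then show ?thesis using cancel_two by blast
  next
    case True
    \<comment> \<open>For \<open>k = -1\<close> both \<open>X0\<close> and \<open>X1\<close> say
      only \<open>A = B\<close>, so \<open>a\<close> has to come from the quadratic relation
      instead.\<close>
    have AB: "A = B" using X0 True by simp
    have "2 * a * (a - (2 * A - c)) = 0" using rel(6) True AB by algebra
    then have a: "a = 2 * A - c" using nz by simp
    have E: "E = c - A" and H: "H = c - A" using kE kH True AB a by algebra+
    have "2 * (P1 + P2) = 0" unfolding sum E H True a AB[symmetric] by algebra
    moreover have "2 * P3 = 0" unfolding P3 E H True a AB[symmetric] by algebra
    ultimately show ?thesis using cancel_two by blast
  qed
  then have P: "P1 = 0" "P2 = 0" "P3 = 0" using d0 by (auto simp: eq_neg_iff_add_eq_0)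
  have t: "A * B * t = 1" using sys(3) .
  have "A * B * quad t p q = P1" "A * B * quad t r s = P2"
    using t unfolding quad_def P1_def P2_def c_def by algebra+
  moreover have "(A * B)^2 * ((1 + t - t * (p + q)) * (1 + t - t * (r + s)) - t) = P3"
    using t unfolding P3_def c_def by algebra
  ultimately show ?thesis using P nz unfolding compX_def by auto
qed


text \<open>By these formulas \<open>pa = pb\<close> after the involution reads
  \<open>A^2 * b^3 = B^2 * a^3\<close>, the second alternative of
  \<open>key_alternative\<close>.\<close>

lemma param_sigma:
  assumes sol: "sol t p q r s" and ne: "p \<noteq> r" "q \<noteq> s"
  defines "A \<equiv> pA t p q r s" and "B \<equiv> pB t p q r s" and "a \<equiv> pa t p q r s" and "b \<equiv> pb t p q r s"
    and "k \<equiv> pk t p q r s"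
  defines "p' \<equiv> 1 / (t * r)" and "q' \<equiv> 1 / (t * q)" and "r' \<equiv> 1 / (t * p)" and "s' \<equiv> 1 / (t * s)"
  shows "pA t p' q' r' s' = B^2 * a^2 / (A * b^2)" "pB t p' q' r' s' = A^2 * b^2 / (B * a^2)"
    "pa t p' q' r' s' = B^2 * a / b^2" "pb t p' q' r' s' = A^2 * b / a^2" "pk t p' q' r' s' = - k * B * a / (A * b)"
proof -
  define G1 G2 G3 G4 where "G1 = gf t p" and "G2 = gf t q" and "G3 = gf t r" and "G4 = gf t s"
  note G = G1_def[symmetric] G2_def[symmetric] G3_def[symmetric] G4_def[symmetric]
  have s: "t \<noteq> 0" "p \<noteq> 0" "q \<noteq> 0" "r \<noteq> 0" "s \<noteq> 0" "G1 \<noteq> 0" "G2 \<noteq> 0" "G3 \<noteq> 0"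
    and F4: "r * s * G1 * G2 = t * p^2 * q^2" and ratio: "p * q^2 * G3 = r * s^2 * G1"
    using sol sol_gf_nonzero[OF sol] sol_ratios[OF sol] unfolding sol_def G by auto
  have AB: "A = p^2 / (s * G2)" "B = q^2 / (r * G1)" "a = r * s * G1 / q" "b = r * s * G2 / p" "k = (p - r) / (q - s)"
    unfolding A_def B_def a_def b_def k_def pA_def pB_def pa_def pb_def pk_def G by simp_all
  have T: "t = r * s * G1 * G2 / (p^2 * q^2)" using s F4 by (simp add: field_simps)
  have G3: "G3 = r * s^2 * G1 / (p * q^2)" using s ratio by (simp add: field_simps)
  have gs: "gf t p' = G3 / (t * r^2)" "gf t q' = G2 / (t * q^2)"
    unfolding p'_def q'_def using s by (simp_all add: gf_inverse G)
  have "pA t p' q' r' s' = q^2 * s / (r^2 * G2)"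
    unfolding pA_def gs unfolding p'_def s'_def using s(1-8) by (simp add: field_simps power2_eq_square)
  also have "\<dots> = B^2 * a^2 / (A * b^2)" using s by (simp add: AB field_simps power2_eq_square)
  finally show "pA t p' q' r' s' = B^2 * a^2 / (A * b^2)" .
  have "pB t p' q' r' s' = p * r^2 / (q^2 * G3)"
    unfolding pB_def gs unfolding q'_def r'_def using s(1-8) by (simp add: field_simps power2_eq_square)
  also have "\<dots> = A^2 * b^2 / (B * a^2)" using s(1-7) unfolding G3 by (simp add: AB field_simps power2_eq_square)
  finally show "pB t p' q' r' s' = A^2 * b^2 / (B * a^2)" .
  have "pa t p' q' r' s' = q * G3 / (t^2 * p * s * r^2)"
    unfolding pa_def gs unfolding q'_def r'_def s'_def using s(1-8) by (simp add: field_simps power2_eq_square)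
  also have "\<dots> = B^2 * a / b^2" using s(2-7) unfolding G3 T by (simp add: AB field_simps power2_eq_square)
  finally show "pa t p' q' r' s' = B^2 * a / b^2" .
  have "pb t p' q' r' s' = r * G2 / (t^2 * p * s * q^2)"
    unfolding pb_def gs unfolding p'_def r'_def s'_def using s(1-8) by (simp add: field_simps power2_eq_square)
  also have "\<dots> = A^2 * b / a^2" using s(2-7) unfolding T by (simp add: AB field_simps power2_eq_square)
  finally show "pb t p' q' r' s' = A^2 * b / a^2" .
  have pq': "p' - r' = (p - r) / (t * p * r)" "q' - s' = (s - q) / (t * q * s)"
    unfolding p'_def q'_def r'_def s'_def using s by (simp_all add: field_simps)
  have "pk t p' q' r' s' = ((p - r) / (t * p * r)) / ((s - q) / (t * q * s))"
    unfolding pk_def pq' ..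
  also have "\<dots> = ((p - r) / (s - q)) * (q * s) / (p * r)" using s by simp
  also have "(p - r) / (s - q) = - k" unfolding AB(5) by (metis minus_diff_eq minus_divide_right)
  finally have "pk t p' q' r' s' = - k * (q * s) / (p * r)" .
  moreover have "q * s = B * a" "p * r = A * b" using s by (simp_all add: AB power2_eq_square)
  ultimately show "pk t p' q' r' s' = - k * B * a / (A * b)" by (simp add: mult.assoc)
qed

text \<open>For \<open>a = b\<close> the linear relation splits into \<open>k = 1\<close> and
  \<open>(k + 1) * c + A + k * B = 0\<close>. On either branch the other two relations factor again:
  one factor meets \<open>compX_criterion\<close> directly, the other after the involution.\<close>

lemma coverage_equal:
  assumes sol: "sol t p q r s" and ne: "p \<noteq> r" "q \<noteq> s" and ab: "pb t p q r s = pa t p q r s"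
  shows "compX t p q r s \<or> compX t (1 / (t * r)) (1 / (t * q)) (1 / (t * p)) (1 / (t * s))"
proof -
  define A B a k c where "A = pA t p q r s" and "B = pB t p q r s" and "a = pa t p q r s"
    and "k = pk t p q r s" and "c = A * B + 1"
  note rel = param_relations[OF sol ne, unfolded ab, folded A_def B_def a_def k_def, folded c_def]
  note crit = compX_criterion[OF sol ne, folded A_def B_def a_def k_def, folded c_def, OF ab[folded a_def]]
  have nz: "A \<noteq> 0" "B \<noteq> 0" "a \<noteq> 0" "t \<noteq> 0" "p \<noteq> 0" "q \<noteq> 0" "r \<noteq> 0" "s \<noteq> 0"
    using param_nonzero[OF sol] sol unfolding A_def B_def a_def sol_def by auto
  define p' q' r' s' where "p' = 1 / (t * r)" and "q' = 1 / (t * q)" and "r' = 1 / (t * p)" and "s' = 1 / (t * s)"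
  have sol': "sol t p' q' r' s'" using sol_sigma[OF sol] by (simp add: p'_def q'_def r'_def s'_def)
  have ne': "p' \<noteq> r'" "q' \<noteq> s'" using ne nz by (auto simp: p'_def q'_def r'_def s'_def)
  note sig = param_sigma[OF sol ne, unfolded ab, folded A_def B_def a_def k_def, folded p'_def q'_def r'_def s'_def]
  have sig': "pA t p' q' r' s' = B^2 / A" "pB t p' q' r' s' = A^2 / B" "pa t p' q' r' s' = B^2 / a"
    "pb t p' q' r' s' = A^2 / a" "pk t p' q' r' s' = - k * B / A"
    using sig nz by (simp_all add: power2_eq_square)
  \<comment> \<open>The criterion at the image point. Its premises include \<open>A^2 = B^2\<close>,
    which holds in the two uses because \<open>A = B\<close> and \<open>B = - A\<close>
    respectively.\<close>
  have crit': "compX t p' q' r' s'"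
    if "B^2 / A = A'" "A^2 / B = B'" "B^2 / a = a'" "A^2 / a = a'" "- k * B / A = k'"
      "(k' + 1) * (A' * B' + 1) + A' + k' * B' = 0" "a' * (k' + 1) * (k'^2 + k' + 1) = A' + k' ^ 3 * B'" for A' B' a' k'
  proof -
    note e = sig'[unfolded that(1-5)]
    show ?thesis by (rule compX_criterion[OF sol' ne']) (simp_all only: e that(6,7))
  qed
  have "a * ((k - 1) * ((k + 1) * c + A + k * B)) = 0" using rel(5) by algebra
  then consider "k = 1" | "k \<noteq> 1" "(k + 1) * c + A + k * B = 0" using nz by auto
  then have "compX t p q r s \<or> compX t p' q' r' s'"
  proof cases
    case 1
    have e: "a * (5 * A - B - 2 * c) = A * (A + B)" "a * (5 * B - A - 2 * c) = B * (A + B)"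
      using rel(6,7) 1 by algebra+
    then have "(A - B) * (6 * a - (A + B)) = 0" by algebra
    then consider "A = B" | "6 * a = A + B" by auto
    then show ?thesis
    proof cases
      case AB: 1
      have "2 * (a * (2 * A - c) - A^2) = 0" using e(1) AB by algebra
      then have a': "a * (2 * A - c) = A^2" using cancel_two by force
      have "compX t p' q' r' s'"
        by (rule crit'[of A A "A^2 / a" "-1"]) (use nz AB 1 in \<open>simp_all add: power2_eq_square\<close>)
      then show ?thesis ..
    next
      case 6: 2
      have "a * (A + B + 2 * c) = 0" using e(1) 6 by algebra
      then have "A + B + 2 * c = 0" using nz by simp
      then have "compX t p q r s" using 6 1 by (intro crit) (simp_all add: add_ac)
      then show ?thesis ..
    qed
  next
    case 2
    let ?K = "k^2 + k + 1"
    have "(a * (k + 1) * ?K - (A + k ^ 3 * B)) * (a * (k - 1) + A * (k + 1)) = 0"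
      using rel(6) 2(2) by algebra
    moreover have "(a * (k + 1) * ?K - (A + k ^ 3 * B)) * (a * (k - 1) - B * (k + 1)) = 0"
      using rel(7) 2(2) by algebra
    ultimately consider "a * (k + 1) * ?K = A + k ^ 3 * B"
      | "a * (k - 1) + A * (k + 1) = 0" "a * (k - 1) - B * (k + 1) = 0" by auto
    then show ?thesis
    proof cases
      case X1: 1
      then have "compX t p q r s" using 2 by (intro crit) simp_all
      then show ?thesis ..
    next
      case alt: 2
      have k1: "k + 1 \<noteq> 0" using alt(1) 2(1) nz by auto
      have "(k + 1) * (A + B) = 0" using alt by algebra
      then have B: "B = - A" using k1 by (simp add: add_eq_0_iff)
      have a': "A^2 / a * (k + 1) = - A * (k - 1)"
      proof -
        have "A^2 * (k + 1) = (- A * (k - 1)) * a" using alt(1) by algebra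
        then show ?thesis using nz by (simp add: field_simps)
      qed
      have "compX t p' q' r' s'"
      proof (rule crit'[of A B "A^2 / a" k])
        have "A^2 / a * (k + 1) * ?K = - A * (k - 1) * ?K" unfolding a' by simp
        then show "A^2 / a * (k + 1) * ?K = A + k ^ 3 * B" unfolding B by algebra
        show "(k + 1) * (A * B + 1) + A + k * B = 0" using 2(2) unfolding c_def .
      qed (use nz B in \<open>simp_all add: power2_eq_square\<close>)
      then show ?thesis ..
    qed
  qed
  then show ?thesis by (simp add: p'_def q'_def r'_def s'_def)
qed

text \<open>Where exactly one of \<open>p = r\<close>, \<open>q = s\<close> holds, \<open>pk\<close>
  is zero or has denominator zero. Such solutions turn out to be these points or their images under
  the involution, the other pair being opposite numbers.\<close>

lemma degenerate_compX:
  assumes "t * y^2 = -1" "x = 1 - y^2"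
  shows "compX t x y x (- y)" "compX t y x (- y) x"
  unfolding compX_def quad_def using assms by (intro conjI; algebra)+

lemma degenerate_roots:
  assumes "t * y^2 = -1" "x = (1 - y^2) * gf t x" "x \<noteq> 0"
  shows "x = 1 - y^2 \<or> 1 / (t * x) = 1 - y^2"
proof -
  have "(x - (1 - y^2)) * ((1 - y^2) * x + y^2) = 0" using assms(1,2) unfolding gf_def by algebra
  then consider "x = 1 - y^2" | "(1 - y^2) * x + y^2 = 0" by auto
  then show ?thesis
  proof cases
    case 2
    have "t \<noteq> 0" using assms(1) by auto
    moreover have "1 = (1 - y^2) * (t * x)" using 2 assms(1) by algebra
    ultimately show ?thesis using assms(3) by (simp add: divide_eq_eq)
  qed simp
qed

theorem coverage:
  assumes sol: "sol t p q r s"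
  shows "p = r \<and> q = s \<or> compX t p q r s \<or> compX t (1 / (t * r)) (1 / (t * q)) (1 / (t * p)) (1 / (t * s))"
proof -
  have nz: "t \<noteq> 0" "p \<noteq> 0" "q \<noteq> 0" "r \<noteq> 0" "s \<noteq> 0" using sol unfolding sol_def by auto
  have F: "t * p * s = gf t q * gf t r" "t * q * r = gf t p * gf t s" using sol unfolding sol_def by auto
  note R = sol_ratios[OF sol] and g = sol_gf_nonzero[OF sol]
  consider "p = r" "q = s" | "p = r" "q \<noteq> s" | "p \<noteq> r" "q = s" | "p \<noteq> r" "q \<noteq> s" by blast
  then show ?thesis
  proof cases
    case 2
    have "(p * gf t p) * ((q + s) * (q - s)) = 0" using R(2) unfolding 2(1)[symmetric] by algebra
    then have s: "s = - q" using 2 nz g by (simp add: add_eq_0_iff)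
    have "p^2 * ((q - s) * (1 - t * q * s)) = 0" using R(1) 2(1) unfolding gf_def by algebra
    then have ty: "t * q^2 = -1" using 2 nz s by (simp add: power2_eq_square eq_neg_iff_add_eq_0 mult.assoc add.commute)
    have "q * (p - (1 - q^2) * gf t p) = 0" using F(1) s 2(1) ty unfolding gf_def by algebra
    then have "p = (1 - q^2) * gf t p" using nz by simp
    from degenerate_roots[OF ty this nz(2)] show ?thesis
    proof
      assume "p = 1 - q^2"
      from degenerate_compX(1)[OF ty this] show ?thesis using s 2 by simp
    next
      assume p': "1 / (t * p) = 1 - q^2"
      have "1 / (t * q) = - q" "1 / (t * s) = q" using ty nz s by (auto simp: field_simps power2_eq_square)
      moreover have "compX t (1 / (t * p)) (- q) (1 / (t * p)) (- (- q))"
        by (rule degenerate_compX(1)) (use ty p' in auto)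
      ultimately show ?thesis using 2 by simp
    qed
  next
    case 3
    have "(q * gf t q) * ((p + r) * (p - r)) = 0" using R(1) unfolding 3(2)[symmetric] by algebra
    then have r: "r = - p" using 3 nz g by (simp add: add_eq_0_iff)
    have "q^2 * ((p - r) * (1 - t * p * r)) = 0" using R(2) 3(2) unfolding gf_def by algebra
    then have ty: "t * p^2 = -1" using 3 nz r by (simp add: power2_eq_square eq_neg_iff_add_eq_0 mult.assoc add.commute)
    have "p * (q - (1 - p^2) * gf t q) = 0" using F(2) r 3(2) ty unfolding gf_def by algebra
    then have "q = (1 - p^2) * gf t q" using nz by simp
    from degenerate_roots[OF ty this nz(3)] show ?thesis
    proof
      assume "q = 1 - p^2"
      from degenerate_compX(2)[OF ty this] show ?thesis using r 3 by simp
    next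
      assume q': "1 / (t * q) = 1 - p^2"
      have "1 / (t * r) = p" "1 / (t * p) = - p" using ty nz r by (auto simp: field_simps power2_eq_square)
      moreover have "compX t p (1 / (t * q)) (- p) (1 / (t * q))"
        by (rule degenerate_compX(2)[OF ty q'])
      ultimately show ?thesis using 3 by simp
    qed
  next
    case 4
    define A B a b k c where "A = pA t p q r s" and "B = pB t p q r s" and "a = pa t p q r s"
      and "b = pb t p q r s" and "k = pk t p q r s" and "c = A * B + 1"
    note rel = param_relations[OF sol 4, folded A_def B_def a_def b_def k_def, folded c_def]
    have nz': "A \<noteq> 0" "B \<noteq> 0" "a \<noteq> 0" "b \<noteq> 0"
      using param_nonzero[OF sol] unfolding A_def B_def a_def b_def by auto
    from key_alternative[OF nz'(3,4,1,2) rel(1) c_def rel(5-7)] show ?thesis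
    proof
      assume "a = b"
      then show ?thesis using coverage_equal[OF sol 4] unfolding a_def b_def by simp
    next
      assume eq: "A^2 * b ^ 3 = B^2 * a ^ 3"
      define p' q' r' s' where "p' = 1 / (t * r)" and "q' = 1 / (t * q)" and "r' = 1 / (t * p)" and "s' = 1 / (t * s)"
      have sol': "sol t p' q' r' s'" using sol_sigma[OF sol] by (simp add: p'_def q'_def r'_def s'_def)
      have ne': "p' \<noteq> r'" "q' \<noteq> s'" using 4 nz by (auto simp: p'_def q'_def r'_def s'_def)
      have "A^2 * b / a^2 = B^2 * a / b^2"
        using eq nz' by (simp add: field_simps power2_eq_square power3_eq_cube)
      then have "pb t p' q' r' s' = pa t p' q' r' s'"
        using param_sigma[OF sol 4, folded A_def B_def a_def b_def] unfolding p'_def q'_def r'_def s'_def by simp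
      from coverage_equal[OF sol' ne' this] show ?thesis
        using nz by (auto simp: p'_def q'_def r'_def s'_def)
    qed
  qed auto
qed

subsection \<open>Coordinates on the deformation variety\<close>

text \<open>\<open>rot1\<close> and \<open>rot2\<close> are the rotations of order three relating
  the three cross-ratios at a vertex.\<close>

definition rot1 :: "complex \<Rightarrow> complex" where "rot1 x = 1 / (1 - x)"
definition rot2 :: "complex \<Rightarrow> complex" where "rot2 x = 1 - 1 / x"

definition idx :: "24 \<Rightarrow> nat" where "idx = inv_into {..<24} of_nat"

lemma of_nat_24_surj: "(of_nat :: nat \<Rightarrow> 24) ` {..<24} = UNIV"
proof -
  have "x \<in> of_nat ` {..<24}" for x :: 24
  proof (cases x)
    case (of_int z)
    then have "x = of_nat (nat z)" "nat z < 24" by auto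
    then show ?thesis by blast
  qed
  then show ?thesis by blast
qed

lemma of_nat_24_inj: "inj_on (of_nat :: nat \<Rightarrow> 24) {..<24}"
  by (rule eq_card_imp_inj_on) (simp_all add: of_nat_24_surj)

lemma idx_of_nat: "k < 24 \<Longrightarrow> idx (of_nat k) = k"
  unfolding idx_def by (rule inv_into_f_f[OF of_nat_24_inj]) simp

lemma idx_less: "idx i < 24"
  using inv_into_into[of i of_nat "{..<24}"] of_nat_24_surj unfolding idx_def by auto

lemma of_nat_idx: "of_nat (idx i) = i"
  unfolding idx_def by (rule f_inv_into_f) (simp add: of_nat_24_surj)

definition vec_of_list :: "complex list \<Rightarrow> complex^24" where
  "vec_of_list xs = (\<chi> i. xs ! idx i)"

lemma vec_of_list_nth: "k < 24 \<Longrightarrow> vec_of_list xs $ of_nat k = xs ! k"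
  by (simp add: vec_of_list_def idx_of_nat)

lemma vec_24_eqI:
  assumes "\<And>k. k < 24 \<Longrightarrow> x $ (of_nat k :: 24) = y $ of_nat k" shows "x = y"
  unfolding vec_eq_iff
proof
  fix i
  from assms[OF idx_less[of i]] show "x $ i = y $ i" unfolding of_nat_idx .
qed

text \<open>The order is that of \<open>pidx\<close>. The edge relations make the free coordinates
  \<open>u12\<close>, \<open>u23\<close>, \<open>u34\<close>, \<open>u41\<close> proportional to
  \<open>v31\<close>, \<open>v23\<close>, \<open>v42\<close>, \<open>v14\<close>, which are
  \<open>p\<close>, \<open>q\<close>, \<open>r\<close>, \<open>s\<close>; the common factor is
  \<open>t\<close>.\<close>

definition pt :: "complex \<Rightarrow> complex \<Rightarrow> complex \<Rightarrow> complex \<Rightarrow> complex \<Rightarrow> complex^24" where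
  "pt t p q r s = vec_of_list
     [t * p, rot1 (t * p), rot2 (t * p), rot1 (t * q), t * q, rot2 (t * q),
      rot1 (t * r), rot2 (t * r), t * r, t * s, rot2 (t * s), rot1 (t * s),
      rot1 s, rot2 s, s, rot1 q, q, rot2 q, p, rot1 p, rot2 p, rot1 r, r, rot2 r]"

lemma ucoord_nth:
  "ucoord x 1 2 = x $ of_nat 0" "ucoord x 1 3 = x $ of_nat 1" "ucoord x 1 4 = x $ of_nat 2"
  "ucoord x 2 1 = x $ of_nat 3" "ucoord x 2 3 = x $ of_nat 4" "ucoord x 2 4 = x $ of_nat 5"
  "ucoord x 3 1 = x $ of_nat 6" "ucoord x 3 2 = x $ of_nat 7" "ucoord x 3 4 = x $ of_nat 8"
  "ucoord x 4 1 = x $ of_nat 9" "ucoord x 4 2 = x $ of_nat 10" "ucoord x 4 3 = x $ of_nat 11"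
  unfolding ucoord_def pidx_def by (simp_all add: numeral_2_eq_2 del: of_nat_numeral of_nat_Suc)

lemma vcoord_nth:
  "vcoord x 1 2 = x $ of_nat 12" "vcoord x 1 3 = x $ of_nat 13" "vcoord x 1 4 = x $ of_nat 14"
  "vcoord x 2 1 = x $ of_nat 15" "vcoord x 2 3 = x $ of_nat 16" "vcoord x 2 4 = x $ of_nat 17"
  "vcoord x 3 1 = x $ of_nat 18" "vcoord x 3 2 = x $ of_nat 19" "vcoord x 3 4 = x $ of_nat 20"
  "vcoord x 4 1 = x $ of_nat 21" "vcoord x 4 2 = x $ of_nat 22" "vcoord x 4 3 = x $ of_nat 23"
  unfolding vcoord_def pidx_def by (simp_all del: of_nat_numeral of_nat_Suc)

lemma pt_nth: "k < 24 \<Longrightarrow> pt t p q r s $ of_nat k =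
     [t * p, rot1 (t * p), rot2 (t * p), rot1 (t * q), t * q, rot2 (t * q),
      rot1 (t * r), rot2 (t * r), t * r, t * s, rot2 (t * s), rot1 (t * s),
      rot1 s, rot2 s, s, rot1 q, q, rot2 q, p, rot1 p, rot2 p, rot1 r, r, rot2 r] ! k"
  unfolding pt_def by (rule vec_of_list_nth)

lemma ucoord_pt:
  "ucoord (pt t p q r s) 1 2 = t * p" "ucoord (pt t p q r s) 1 3 = rot1 (t * p)" "ucoord (pt t p q r s) 1 4 = rot2 (t * p)"
  "ucoord (pt t p q r s) 2 1 = rot1 (t * q)" "ucoord (pt t p q r s) 2 3 = t * q" "ucoord (pt t p q r s) 2 4 = rot2 (t * q)"
  "ucoord (pt t p q r s) 3 1 = rot1 (t * r)" "ucoord (pt t p q r s) 3 2 = rot2 (t * r)" "ucoord (pt t p q r s) 3 4 = t * r"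
  "ucoord (pt t p q r s) 4 1 = t * s" "ucoord (pt t p q r s) 4 2 = rot2 (t * s)" "ucoord (pt t p q r s) 4 3 = rot1 (t * s)"
  unfolding ucoord_nth by (subst pt_nth; simp)+

lemma vcoord_pt:
  "vcoord (pt t p q r s) 1 2 = rot1 s" "vcoord (pt t p q r s) 1 3 = rot2 s" "vcoord (pt t p q r s) 1 4 = s"
  "vcoord (pt t p q r s) 2 1 = rot1 q" "vcoord (pt t p q r s) 2 3 = q" "vcoord (pt t p q r s) 2 4 = rot2 q"
  "vcoord (pt t p q r s) 3 1 = p" "vcoord (pt t p q r s) 3 2 = rot1 p" "vcoord (pt t p q r s) 3 4 = rot2 p"
  "vcoord (pt t p q r s) 4 1 = rot1 r" "vcoord (pt t p q r s) 4 2 = r" "vcoord (pt t p q r s) 4 3 = rot2 r"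
  unfolding vcoord_nth by (subst pt_nth; simp)+

lemma less_24_cases:
  assumes "k < (24::nat)"
  shows "k \<in> {0,1,2,3,4,5,6,7,8,9,10,11,12,13,14,15,16,17,18,19,20,21,22,23}"
  using assms by (simp, presburger)

lemma coord_eqI:
  assumes "ucoord x 1 2 = ucoord y 1 2" "ucoord x 1 3 = ucoord y 1 3" "ucoord x 1 4 = ucoord y 1 4"
    "ucoord x 2 1 = ucoord y 2 1" "ucoord x 2 3 = ucoord y 2 3" "ucoord x 2 4 = ucoord y 2 4"
    "ucoord x 3 1 = ucoord y 3 1" "ucoord x 3 2 = ucoord y 3 2" "ucoord x 3 4 = ucoord y 3 4"
    "ucoord x 4 1 = ucoord y 4 1" "ucoord x 4 2 = ucoord y 4 2" "ucoord x 4 3 = ucoord y 4 3"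
    "vcoord x 1 2 = vcoord y 1 2" "vcoord x 1 3 = vcoord y 1 3" "vcoord x 1 4 = vcoord y 1 4"
    "vcoord x 2 1 = vcoord y 2 1" "vcoord x 2 3 = vcoord y 2 3" "vcoord x 2 4 = vcoord y 2 4"
    "vcoord x 3 1 = vcoord y 3 1" "vcoord x 3 2 = vcoord y 3 2" "vcoord x 3 4 = vcoord y 3 4"
    "vcoord x 4 1 = vcoord y 4 1" "vcoord x 4 2 = vcoord y 4 2" "vcoord x 4 3 = vcoord y 4 3"
  shows "x = y"
proof (rule vec_24_eqI)
  fix k :: nat assume "k < 24"
  from less_24_cases[OF this] show "x $ of_nat k = y $ of_nat k"
    using assms unfolding ucoord_nth vcoord_nth by (elim insertE emptyE) (simp_all only:)
qed

definition cyc :: "complex \<Rightarrow> complex \<Rightarrow> complex \<Rightarrow> bool" where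
  "cyc z z' z'' \<longleftrightarrow> z \<noteq> 0 \<and> z \<noteq> 1 \<and> z' = rot1 z \<and> z'' = rot2 z"

lemma cycI: assumes "z * z' - z' + 1 = 0" "z * z'' - z + 1 = 0" shows "cyc z z' z''"
proof -
  have "z \<noteq> 0" using assms(2) by auto
  moreover have "z \<noteq> 1" using assms(1) by auto
  moreover have "z' * (1 - z) = 1" using assms(1) by algebra
  then have "z' = 1 / (1 - z)" using \<open>z \<noteq> 1\<close> by (simp add: eq_divide_eq)
  moreover have "(1 - z'') * z = 1" using assms(2) by algebra
  then have "1 - z'' = 1 / z" using \<open>z \<noteq> 0\<close> by (simp add: eq_divide_eq)
  then have "z'' = 1 - 1 / z" by (metis diff_diff_eq2 diff_add_cancel add_diff_cancel_left')
  ultimately show ?thesis unfolding cyc_def rot1_def rot2_def by simp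
qed

lemma cyc_relations:
  assumes "cyc z z' z''"
  shows "z * z' - z' + 1 = 0" "z * z'' - z + 1 = 0" "z'' * z' - z'' + 1 = 0"
proof -
  have z: "z \<noteq> 0" "z \<noteq> 1" and e: "z' * (1 - z) = 1" "z'' * z = z - 1"
    using assms unfolding cyc_def rot1_def rot2_def by (auto simp: left_diff_distrib)
  show "z * z' - z' + 1 = 0" "z * z'' - z + 1 = 0" using e by algebra+
  have "z * (1 - z) * (z'' * z' - z'' + 1) = 0" using e by algebra
  then show "z'' * z' - z'' + 1 = 0" using z by simp
qed

lemma cyc_rot: assumes "cyc z z' z''" shows "cyc z'' z z'"
  using cyc_relations[OF assms] by (intro cycI) (simp_all add: mult.commute)

lemma cyc_rot12: "z \<noteq> 0 \<Longrightarrow> z \<noteq> 1 \<Longrightarrow> cyc z (rot1 z) (rot2 z)"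
  unfolding cyc_def by simp

lemma internal_rel_iff_u:
  "internal_rel u \<longleftrightarrow> cyc (u 1 2) (u 1 3) (u 1 4) \<and> cyc (u 2 3) (u 2 1) (u 2 4) \<and>
     cyc (u 3 4) (u 3 1) (u 3 2) \<and> cyc (u 4 1) (u 4 3) (u 4 2)"
proof
  assume r: "internal_rel u"
  note r = r[unfolded internal_rel_def]
  have "cyc (u 1 2) (u 1 3) (u 1 4)" using r by (intro cycI) auto
  moreover have "cyc (u 2 1) (u 2 4) (u 2 3)" using r by (intro cycI) auto
  moreover have "cyc (u 3 4) (u 3 1) (u 3 2)" using r by (intro cycI) (simp_all add: mult.commute)
  moreover have "cyc (u 4 3) (u 4 2) (u 4 1)" using r by (intro cycI) (simp_all add: mult.commute)
  ultimately show "cyc (u 1 2) (u 1 3) (u 1 4) \<and> cyc (u 2 3) (u 2 1) (u 2 4) \<and>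
     cyc (u 3 4) (u 3 1) (u 3 2) \<and> cyc (u 4 1) (u 4 3) (u 4 2)" using cyc_rot by blast
next
  assume "cyc (u 1 2) (u 1 3) (u 1 4) \<and> cyc (u 2 3) (u 2 1) (u 2 4) \<and>
     cyc (u 3 4) (u 3 1) (u 3 2) \<and> cyc (u 4 1) (u 4 3) (u 4 2)"
  then have "cyc (u 1 2) (u 1 3) (u 1 4)" "cyc (u 2 1) (u 2 4) (u 2 3)" "cyc (u 3 4) (u 3 1) (u 3 2)"
    "cyc (u 4 3) (u 4 2) (u 4 1)" using cyc_rot by blast+
  note c = cyc_relations[OF this(1)] cyc_relations[OF this(2)] cyc_relations[OF this(3)] cyc_relations[OF this(4)]
  show "internal_rel u" unfolding internal_rel_def using c by (simp add: mult.commute)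
qed

lemma cyc_prod: assumes "cyc z z' z''" shows "z * z' * z'' = -1"
  using cyc_relations[OF assms] by algebra

text \<open>Since \<open>1 - rot2 x = 1 / x\<close>, these are \<open>u\<^sub>1\<^sub>2 / v\<^sub>3\<^sub>1\<close> and its inverse on the deformation variety.\<close>
definition tcoord :: "complex^24 \<Rightarrow> complex" where
  "tcoord x = ucoord x 1 2 * (1 - vcoord x 3 4)"

definition tcoord_inv :: "complex^24 \<Rightarrow> complex" where
  "tcoord_inv x = vcoord x 3 1 * (1 - ucoord x 1 4)"

lemma poly_fun_ucoord: "(\<lambda>x. ucoord x i j) \<in> poly_fun"
  unfolding ucoord_def by (rule pf_coord)

lemma poly_fun_vcoord: "(\<lambda>x. vcoord x i j) \<in> poly_fun"
  unfolding vcoord_def by (rule pf_coord)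

lemma poly_fun_tcoord: "tcoord \<in> poly_fun" "tcoord_inv \<in> poly_fun"
  unfolding tcoord_def[abs_def] tcoord_inv_def[abs_def]
  by (intro pf_mult poly_fun_diff pf_const poly_fun_ucoord poly_fun_vcoord)+

lemmas poly_fun_coords = pf_const poly_fun_ucoord poly_fun_vcoord poly_fun_tcoord
  pf_add pf_mult poly_fun_diff poly_fun_uminus poly_fun_power

lemma zariski_closed_Defor: "zariski_closed Defor_fig8"
  unfolding Defor_fig8_def internal_rel_def gluing_rel_def Collect_conj_eq
  by (intro zariski_closed_Int zariski_closed_zero poly_fun_coords)

lemma rot12: "z \<noteq> 0 \<Longrightarrow> z \<noteq> 1 \<Longrightarrow> rot1 z * rot2 z = - 1 / z"
  unfolding rot1_def rot2_def by (simp add: field_simps)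

lemma rot1_mult: "rot1 (t * x) * rot1 x = 1 / gf t x"
  unfolding rot1_def gf_def by simp

lemma rot2_mult: "t \<noteq> 0 \<Longrightarrow> x \<noteq> 0 \<Longrightarrow> rot2 (t * x) * rot2 x = gf t x / (t * x^2)"
  unfolding rot2_def gf_def by (simp add: field_simps power2_eq_square)

lemma gf_nonzeroD: "gf t x \<noteq> 0 \<Longrightarrow> x \<noteq> 1 \<and> t * x \<noteq> 1"
  unfolding gf_def by auto

text \<open>Each product groups into pairs \<open>rot1 (t * x) * rot1 x\<close> or
  \<open>rot2 (t * x) * rot2 x\<close>, which are monomials times a power of
  \<open>gf t x\<close>.\<close>

lemma face_relations:
  assumes "t \<noteq> 0" "p \<noteq> 0" "q \<noteq> 0" "r \<noteq> 0" "s \<noteq> 0" "gf t p \<noteq> 0" "gf t q \<noteq> 0" "gf t r \<noteq> 0" "gf t s \<noteq> 0"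
  shows "rot1 (t * q) * rot1 (t * r) * (t * s) * rot1 q * p * rot1 r - 1 = 0 \<longleftrightarrow> t * p * s = gf t q * gf t r"
    "t * p * rot2 (t * r) * rot2 (t * s) * rot2 s * q * rot2 r - 1 = 0 \<longleftrightarrow> p * q * gf t r * gf t s = t * r^2 * s^2"
    "rot1 (t * p) * (t * q) * rot1 (t * s) * rot1 s * rot1 p * r - 1 = 0 \<longleftrightarrow> t * q * r = gf t p * gf t s"
    "rot2 (t * p) * rot2 (t * q) * (t * r) * s * rot2 q * rot2 p - 1 = 0 \<longleftrightarrow> r * s * gf t p * gf t q = t * p^2 * q^2"
proof -
  have "rot1 (t * q) * rot1 (t * r) * (t * s) * rot1 q * p * rot1 r
      = (rot1 (t * q) * rot1 q) * (rot1 (t * r) * rot1 r) * (t * p * s)" by (simp add: mult_ac)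
  also have "\<dots> = (t * p * s) / (gf t q * gf t r)" unfolding rot1_mult by simp
  finally show "rot1 (t * q) * rot1 (t * r) * (t * s) * rot1 q * p * rot1 r - 1 = 0 \<longleftrightarrow> t * p * s = gf t q * gf t r"
    using assms by (simp add: divide_eq_eq)
  have "t * p * rot2 (t * r) * rot2 (t * s) * rot2 s * q * rot2 r
      = (rot2 (t * r) * rot2 r) * (rot2 (t * s) * rot2 s) * (t * p * q)" by (simp add: mult_ac)
  also have "\<dots> = (p * q * gf t r * gf t s) / (t * r^2 * s^2)"
    unfolding rot2_mult[OF assms(1,4)] rot2_mult[OF assms(1,5)] using assms(1) by (simp add: mult_ac)
  finally show "t * p * rot2 (t * r) * rot2 (t * s) * rot2 s * q * rot2 r - 1 = 0 \<longleftrightarrow> p * q * gf t r * gf t s = t * r^2 * s^2"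
    using assms by (simp add: divide_eq_eq)
  have "rot1 (t * p) * (t * q) * rot1 (t * s) * rot1 s * rot1 p * r
      = (rot1 (t * p) * rot1 p) * (rot1 (t * s) * rot1 s) * (t * q * r)" by (simp add: mult_ac)
  also have "\<dots> = (t * q * r) / (gf t p * gf t s)" unfolding rot1_mult by simp
  finally show "rot1 (t * p) * (t * q) * rot1 (t * s) * rot1 s * rot1 p * r - 1 = 0 \<longleftrightarrow> t * q * r = gf t p * gf t s"
    using assms by (simp add: divide_eq_eq)
  have "rot2 (t * p) * rot2 (t * q) * (t * r) * s * rot2 q * rot2 p
      = (rot2 (t * p) * rot2 p) * (rot2 (t * q) * rot2 q) * (t * r * s)" by (simp add: mult_ac)
  also have "\<dots> = (r * s * gf t p * gf t q) / (t * p^2 * q^2)"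
    unfolding rot2_mult[OF assms(1,2)] rot2_mult[OF assms(1,3)] using assms(1) by (simp add: mult_ac)
  finally show "rot2 (t * p) * rot2 (t * q) * (t * r) * s * rot2 q * rot2 p - 1 = 0 \<longleftrightarrow> r * s * gf t p * gf t q = t * p^2 * q^2"
    using assms by (simp add: divide_eq_eq)
qed

lemma pt_in_Defor:
  assumes sol: "sol t p q r s" shows "pt t p q r s \<in> Defor_fig8"
proof -
  have nz: "t \<noteq> 0" "p \<noteq> 0" "q \<noteq> 0" "r \<noteq> 0" "s \<noteq> 0" using sol unfolding sol_def by auto
  note g = sol_gf_nonzero[OF sol]
  note ne = g[THEN gf_nonzeroD]
  have "internal_rel (ucoord (pt t p q r s))"
    unfolding internal_rel_iff_u ucoord_pt using nz ne
    by (auto intro!: cyc_rot12)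
  moreover have "internal_rel (vcoord (pt t p q r s))"
  proof -
    have "cyc s (rot1 s) (rot2 s)" "cyc q (rot1 q) (rot2 q)" "cyc p (rot1 p) (rot2 p)" "cyc r (rot1 r) (rot2 r)"
      using nz ne by (auto intro!: cyc_rot12)
    then show ?thesis unfolding internal_rel_iff_u vcoord_pt using cyc_rot by blast
  qed
  moreover have "gluing_rel (ucoord (pt t p q r s)) (vcoord (pt t p q r s))"
  proof -
    have e1: "rot1 (t * p) * rot2 (t * p) * (t * q) * rot1 q * rot2 q * p
        = (rot1 (t * p) * rot2 (t * p)) * (rot1 q * rot2 q) * (t * q * p)" by (simp add: mult_ac)
    have e2: "rot1 (t * r) * rot2 (t * r) * (t * s) * rot1 s * rot2 s * r
        = (rot1 (t * r) * rot2 (t * r)) * (rot1 s * rot2 s) * (t * s * r)" by (simp add: mult_ac)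
    have e3: "rot1 (t * q) * rot2 (t * q) * (t * r) * q * rot1 r * rot2 r
        = (rot1 (t * q) * rot2 (t * q)) * (rot1 r * rot2 r) * (t * r * q)" by (simp add: mult_ac)
    have e4: "t * p * rot2 (t * s) * rot1 (t * s) * s * rot1 p * rot2 p
        = (rot1 (t * s) * rot2 (t * s)) * (rot1 p * rot2 p) * (t * p * s)" by (simp add: mult_ac)
    have "rot1 z * rot2 z = - 1 / z" if "z \<in> {t * p, t * q, t * r, t * s, p, q, r, s}" for z
      using that nz ne by (intro rot12) auto
    then have edges: "rot1 (t * p) * rot2 (t * p) * (t * q) * rot1 q * rot2 q * p - 1 = 0"
      "rot1 (t * r) * rot2 (t * r) * (t * s) * rot1 s * rot2 s * r - 1 = 0"
      "rot1 (t * q) * rot2 (t * q) * (t * r) * q * rot1 r * rot2 r - 1 = 0"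
      "t * p * rot2 (t * s) * rot1 (t * s) * s * rot1 p * rot2 p - 1 = 0"
      unfolding e1 e2 e3 e4 using nz by simp_all
    show ?thesis
      unfolding gluing_rel_def ucoord_pt vcoord_pt face_relations[OF nz g]
      using edges sol unfolding sol_def by blast
  qed
  ultimately show ?thesis unfolding Defor_fig8_def by blast
qed

lemma tcoord_pt: "p \<noteq> 0 \<Longrightarrow> tcoord (pt t p q r s) = t"
  unfolding tcoord_def ucoord_pt vcoord_pt rot2_def by simp

lemma tcoord_inv_pt: "t \<noteq> 0 \<Longrightarrow> p \<noteq> 0 \<Longrightarrow> tcoord_inv (pt t p q r s) = 1 / t"
  unfolding tcoord_inv_def ucoord_pt vcoord_pt rot2_def by simp

text \<open>Three cross-ratios at a vertex have product -1; multiplying the edge relation by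
  \<open>x * y\<close> completes two such triples.\<close>

lemma edge_relation:
  assumes "cyc x x' x''" "cyc y y' y''" "x' * x'' * z * (y' * y'') * w = 1"
  shows "z * w = x * y"
proof -
  have "x * y * (x' * x'' * z * (y' * y'') * w) = (x * x' * x'') * (y * y' * y'') * (z * w)" by (simp add: mult_ac)
  then show ?thesis unfolding cyc_prod[OF assms(1)] cyc_prod[OF assms(2)] assms(3) by simp
qed

lemma Defor_is_pt:
  assumes "x \<in> Defor_fig8"
  defines "t \<equiv> tcoord x" and "p \<equiv> vcoord x 3 1" and "q \<equiv> vcoord x 2 3" and "r \<equiv> vcoord x 4 2" and "s \<equiv> vcoord x 1 4"
  shows "sol t p q r s" "pt t p q r s = x"
proof -
  let ?u = "ucoord x" and ?v = "vcoord x"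
  have glue: "gluing_rel ?u ?v" and u: "internal_rel ?u" and v: "internal_rel ?v"
    using assms(1) unfolding Defor_fig8_def by auto
  have ca: "cyc (?u 1 2) (?u 1 3) (?u 1 4)" and cb: "cyc (?u 2 3) (?u 2 1) (?u 2 4)"
    and cc: "cyc (?u 3 4) (?u 3 1) (?u 3 2)" and cd: "cyc (?u 4 1) (?u 4 3) (?u 4 2)"
    using u unfolding internal_rel_iff_u by auto
  have cs: "cyc s (?v 1 2) (?v 1 3)" and cq: "cyc q (?v 2 1) (?v 2 4)"
    and cp: "cyc p (?v 3 2) (?v 3 4)" and cr: "cyc r (?v 4 1) (?v 4 3)"
    using v cyc_rot unfolding internal_rel_iff_u p_def q_def r_def s_def by blast+
  note G = glue[unfolded gluing_rel_def]
  have nz: "p \<noteq> 0" "q \<noteq> 0" "r \<noteq> 0" "s \<noteq> 0" "?u 1 2 \<noteq> 0"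
    using cp cq cr cs ca unfolding cyc_def by auto
  have "?v 3 4 = rot2 p" using cp unfolding cyc_def by simp
  then have t: "t = ?u 1 2 / p" using nz unfolding t_def tcoord_def rot2_def by simp
  then have t0: "t \<noteq> 0" and a: "?u 1 2 = t * p" using nz by auto
  have "?u 2 3 * p = ?u 1 2 * q" using G by (intro edge_relation[OF ca cq]) (simp add: p_def mult_ac)
  then have b: "?u 2 3 = t * q" using a nz by simp
  have "?u 1 2 * s = ?u 4 1 * p" using G by (intro edge_relation[OF cd cp]) (simp add: s_def mult_ac)
  then have d: "?u 4 1 = t * s" using a nz by simp
  have "?u 4 1 * r = ?u 3 4 * s" using G by (intro edge_relation[OF cc cs]) (simp add: r_def mult_ac)
  then have c: "?u 3 4 = t * r" using d nz by simp
  have U: "?u 1 3 = rot1 (t * p)" "?u 1 4 = rot2 (t * p)" "?u 2 1 = rot1 (t * q)" "?u 2 4 = rot2 (t * q)"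
    "?u 3 1 = rot1 (t * r)" "?u 3 2 = rot2 (t * r)" "?u 4 3 = rot1 (t * s)" "?u 4 2 = rot2 (t * s)"
    using ca cb cc cd unfolding cyc_def a b c d by auto
  have V: "?v 1 2 = rot1 s" "?v 1 3 = rot2 s" "?v 2 1 = rot1 q" "?v 2 4 = rot2 q"
    "?v 3 2 = rot1 p" "?v 3 4 = rot2 p" "?v 4 1 = rot1 r" "?v 4 3 = rot2 r"
    using cp cq cr cs unfolding cyc_def by auto
  have g: "gf t p \<noteq> 0" "gf t q \<noteq> 0" "gf t r \<noteq> 0" "gf t s \<noteq> 0"
    using ca cb cc cd cp cq cr cs unfolding cyc_def a b c d gf_def by auto
  note V' = p_def[symmetric] q_def[symmetric] r_def[symmetric] s_def[symmetric]
  show "sol t p q r s"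
    using G t0 nz face_relations[OF t0 nz(1-4) g] unfolding sol_def a b c d U V V' by blast
  show "pt t p q r s = x"
    by (rule coord_eqI; simp only: ucoord_pt vcoord_pt a b c d U V V')
qed

section \<open>Functions regular along a cover, and polynomial charts of the deformation
  variety\<close>

definition reg :: "complex poly poly \<Rightarrow> (complex \<Rightarrow> complex \<Rightarrow> complex \<Rightarrow> bool) \<Rightarrow>
    (complex \<Rightarrow> complex \<Rightarrow> complex \<Rightarrow> complex) \<Rightarrow> bool" where
  "reg d W h \<longleftrightarrow> (\<exists>g\<in>good d. \<forall>u v w. W u v w \<longrightarrow> h u v w = g u v w)"

lemma reg_good: "h \<in> good d \<Longrightarrow> reg d W h"
  unfolding reg_def by blast

lemma reg_cong: "reg d W k \<Longrightarrow> (\<And>u v w. W u v w \<Longrightarrow> h u v w = k u v w) \<Longrightarrow> reg d W h"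
  unfolding reg_def by fastforce

lemma reg_const: "reg d W (\<lambda>u v w. c)"
  by (intro reg_good good_const)

lemma reg_add: assumes "reg d W h" "reg d W k" shows "reg d W (\<lambda>u v w. h u v w + k u v w)"
proof -
  obtain g g' where "g \<in> good d" "\<And>u v w. W u v w \<Longrightarrow> h u v w = g u v w"
    "g' \<in> good d" "\<And>u v w. W u v w \<Longrightarrow> k u v w = g' u v w" using assms unfolding reg_def by blast
  then show ?thesis unfolding reg_def by (intro bexI[OF _ good_add[of g d g']]) auto
qed

lemma reg_mult: assumes "reg d W h" "reg d W k" shows "reg d W (\<lambda>u v w. h u v w * k u v w)"
proof -
  obtain g g' where "g \<in> good d" "\<And>u v w. W u v w \<Longrightarrow> h u v w = g u v w"
    "g' \<in> good d" "\<And>u v w. W u v w \<Longrightarrow> k u v w = g' u v w" using assms unfolding reg_def by blast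
  then show ?thesis unfolding reg_def by (intro bexI[OF _ good_mult[of g d g']]) auto
qed

lemma reg_diff: "reg d W h \<Longrightarrow> reg d W k \<Longrightarrow> reg d W (\<lambda>u v w. h u v w - k u v w)"
  using reg_add[OF _ reg_mult[OF reg_const[of d W "-1"]], of h k] by simp

lemma reg_gf: "reg d W t \<Longrightarrow> reg d W x \<Longrightarrow> reg d W (\<lambda>u v w. gf (t u v w) (x u v w))"
  unfolding gf_def by (intro reg_mult reg_diff reg_const)

text \<open>The inverse needs to be correct only on \<open>W\<close>, so the equation of the cover
  may be used to find it even when \<open>h\<close> does not divide a power of
  \<open>d\<close>.\<close>

lemma reg_inverse:
  assumes "reg d W k" "\<And>u v w. W u v w \<Longrightarrow> h u v w * k u v w = 1"
  shows "reg d W (\<lambda>u v w. 1 / h u v w)"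
proof (rule reg_cong[OF assms(1)])
  fix u v w assume "W u v w"
  from assms(2)[OF this] have "h u v w * k u v w = 1" .
  moreover from this have "h u v w \<noteq> 0" by auto
  ultimately show "1 / h u v w = k u v w" by (simp add: divide_eq_eq mult.commute)
qed

lemma reg_inverse_divisor:
  assumes "\<And>u v w. W u v w \<Longrightarrow> ev2 d u v \<noteq> 0" "reg d W k"
    and "\<And>u v w. W u v w \<Longrightarrow> h u v w * k u v w = ev2 d u v"
  shows "reg d W (\<lambda>u v w. 1 / h u v w)"
proof (rule reg_inverse[OF reg_mult[OF assms(2) reg_good[OF good_inverse]]])
  fix u v w assume W: "W u v w"
  show "h u v w * (k u v w * inverse (ev2 d u v)) = 1"
    unfolding mult.assoc[symmetric] assms(3)[OF W] using assms(1)[OF W] by simp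
qed

text \<open>On solutions, the face equations express \<open>1 / (1 - x)\<close> and \<open>1 / (1 - t x)\<close> polynomially in
  \<open>t, p, q, r, s\<close> and their inverses.\<close>
lemma reg_pt:
  assumes sol: "\<And>u v w. W u v w \<Longrightarrow> sol (t u v w) (p u v w) (q u v w) (r u v w) (s u v w)"
    and rg: "reg d W t" "reg d W p" "reg d W q" "reg d W r" "reg d W s"
    and ri: "reg d W (\<lambda>u v w. 1 / t u v w)" "reg d W (\<lambda>u v w. 1 / p u v w)" "reg d W (\<lambda>u v w. 1 / q u v w)"
      "reg d W (\<lambda>u v w. 1 / r u v w)" "reg d W (\<lambda>u v w. 1 / s u v w)"
  shows "reg d W (\<lambda>u v w. pt (t u v w) (p u v w) (q u v w) (r u v w) (s u v w) $ i)"
proof -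
  have rot1: "reg d W (\<lambda>u v w. rot1 (x u v w))" "reg d W (\<lambda>u v w. rot1 (t u v w * x u v w))"
    if x: "reg d W x" and y: "reg d W y" and inv: "reg d W (\<lambda>u v w. 1 / e u v w)" "reg d W (\<lambda>u v w. 1 / f u v w)"
      and eq: "\<And>u v w. W u v w \<Longrightarrow> t u v w * e u v w * f u v w = gf (t u v w) (x u v w) * gf (t u v w) (y u v w) \<and>
        e u v w \<noteq> 0 \<and> f u v w \<noteq> 0 \<and> t u v w \<noteq> 0" for x y e f
  proof -
    \<comment> \<open>By the face relation this is \<open>1 / gf t x\<close>. Multiplied by one
      linear factor of \<open>gf t x\<close> it becomes the inverse of the other.\<close>
    let ?k = "\<lambda>u v w. gf (t u v w) (y u v w) * (1 / t u v w) * (1 / e u v w) * (1 / f u v w)"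
    have k: "reg d W ?k" by (intro reg_mult reg_gf rg(1) ri(1) x y inv)
    have key: "gf (t u v w) (x u v w) * ?k u v w = 1" if "W u v w" for u v w
    proof -
      have "gf (t u v w) (x u v w) * ?k u v w
          = (gf (t u v w) (x u v w) * gf (t u v w) (y u v w)) / (t u v w * e u v w * f u v w)" by simp
      also have "\<dots> = (t u v w * e u v w * f u v w) / (t u v w * e u v w * f u v w)"
        using eq[OF that] by (simp only:)
      also have "\<dots> = 1"
      proof (rule divide_self)
        from eq[OF that] have "e u v w \<noteq> 0" "f u v w \<noteq> 0" "t u v w \<noteq> 0" by blast+
        then show "t u v w * e u v w * f u v w \<noteq> 0" by simp
      qed
      finally show ?thesis .
    qed
    show "reg d W (\<lambda>u v w. rot1 (x u v w))" unfolding rot1_def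
    proof (rule reg_inverse)
      show "reg d W (\<lambda>u v w. (1 - t u v w * x u v w) * ?k u v w)"
        by (rule reg_mult[OF reg_diff[OF reg_const reg_mult[OF rg(1) x]] k])
      show "(1 - x u v w) * ((1 - t u v w * x u v w) * ?k u v w) = 1" if "W u v w" for u v w
        using key[OF that] unfolding gf_def mult.assoc .
    qed
    show "reg d W (\<lambda>u v w. rot1 (t u v w * x u v w))" unfolding rot1_def
    proof (rule reg_inverse)
      show "reg d W (\<lambda>u v w. (1 - x u v w) * ?k u v w)"
        by (rule reg_mult[OF reg_diff[OF reg_const x] k])
      show "(1 - t u v w * x u v w) * ((1 - x u v w) * ?k u v w) = 1" if "W u v w" for u v w
        using key[OF that] unfolding gf_def by (simp only: mult_ac)
    qed
  qed
  have rot2: "reg d W (\<lambda>u v w. rot2 (x u v w))" "reg d W (\<lambda>u v w. rot2 (t u v w * x u v w))"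
    if "reg d W (\<lambda>u v w. 1 / x u v w)" for x
  proof -
    show "reg d W (\<lambda>u v w. rot2 (x u v w))" unfolding rot2_def by (intro reg_diff reg_const that)
    show "reg d W (\<lambda>u v w. rot2 (t u v w * x u v w))" unfolding rot2_def
      by (rule reg_cong[OF reg_diff[OF reg_const reg_mult[OF ri(1) that]]]) simp
  qed
  have F: "t u v w * p u v w * s u v w = gf (t u v w) (q u v w) * gf (t u v w) (r u v w)"
    "t u v w * q u v w * r u v w = gf (t u v w) (p u v w) * gf (t u v w) (s u v w)"
    "t u v w \<noteq> 0" "p u v w \<noteq> 0" "q u v w \<noteq> 0" "r u v w \<noteq> 0" "s u v w \<noteq> 0" if "W u v w" for u v w
    using sol[OF that] unfolding sol_def by auto
  have q1: "reg d W (\<lambda>u v w. rot1 (q u v w))" "reg d W (\<lambda>u v w. rot1 (t u v w * q u v w))"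
    using F by (intro rot1[OF rg(3,4) ri(2,5)]; auto)+
  have r1: "reg d W (\<lambda>u v w. rot1 (r u v w))" "reg d W (\<lambda>u v w. rot1 (t u v w * r u v w))"
    using F by (intro rot1[OF rg(4,3) ri(2,5)]; auto simp: mult.commute)+
  have p1: "reg d W (\<lambda>u v w. rot1 (p u v w))" "reg d W (\<lambda>u v w. rot1 (t u v w * p u v w))"
    using F by (intro rot1[OF rg(2,5) ri(3,4)]; auto)+
  have s1: "reg d W (\<lambda>u v w. rot1 (s u v w))" "reg d W (\<lambda>u v w. rot1 (t u v w * s u v w))"
    using F by (intro rot1[OF rg(5,2) ri(3,4)]; auto simp: mult.commute)+
  note all = q1 r1 p1 s1 rot2[OF ri(2)] rot2[OF ri(3)] rot2[OF ri(4)] rot2[OF ri(5)] rg(2-5)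
    reg_mult[OF rg(1) rg(2)] reg_mult[OF rg(1) rg(3)] reg_mult[OF rg(1) rg(4)] reg_mult[OF rg(1) rg(5)]
  have "reg d W (\<lambda>u v w. pt (t u v w) (p u v w) (q u v w) (r u v w) (s u v w) $ (of_nat k :: 24))" if "k < 24" for k
    unfolding pt_nth[OF that]
    using less_24_cases[OF that] all by (elim insertE emptyE) simp_all
  from this[OF idx_less[of i]] show ?thesis unfolding of_nat_idx .
qed

text \<open>Abstracts from whether the involution has been applied to the coordinates. The component
  \<open>SX\<close> is analysed once here; the twisted instance yields its image under the
  involution.\<close>

locale chart =
  fixes pt' :: "complex \<Rightarrow> complex \<Rightarrow> complex \<Rightarrow> complex \<Rightarrow> complex \<Rightarrow> complex^24"
    and T Ti P Q R S :: "complex^24 \<Rightarrow> complex"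
  assumes polys: "T \<in> poly_fun" "Ti \<in> poly_fun" "P \<in> poly_fun" "Q \<in> poly_fun" "R \<in> poly_fun" "S \<in> poly_fun"
    and onto: "\<And>x. x \<in> Defor_fig8 \<Longrightarrow> sol (T x) (P x) (Q x) (R x) (S x) \<and> pt' (T x) (P x) (Q x) (R x) (S x) = x"
    and into: "\<And>t p q r s. sol t p q r s \<Longrightarrow> pt' t p q r s \<in> Defor_fig8"
    and coords: "\<And>t p q r s. sol t p q r s \<Longrightarrow> T (pt' t p q r s) = t \<and> Ti (pt' t p q r s) = 1 / t \<and>
      P (pt' t p q r s) = p \<and> Q (pt' t p q r s) = q \<and> R (pt' t p q r s) = r \<and> S (pt' t p q r s) = s"
    and regular_pt': "\<And>d W t p q r s i.
      (\<And>u v w. W u v w \<Longrightarrow> sol (t u v w) (p u v w) (q u v w) (r u v w) (s u v w)) \<Longrightarrow>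
      reg d W t \<Longrightarrow> reg d W p \<Longrightarrow> reg d W q \<Longrightarrow> reg d W r \<Longrightarrow> reg d W s \<Longrightarrow>
      reg d W (\<lambda>u v w. 1 / t u v w) \<Longrightarrow> reg d W (\<lambda>u v w. 1 / p u v w) \<Longrightarrow> reg d W (\<lambda>u v w. 1 / q u v w) \<Longrightarrow>
      reg d W (\<lambda>u v w. 1 / r u v w) \<Longrightarrow> reg d W (\<lambda>u v w. 1 / s u v w) \<Longrightarrow>
      reg d W (\<lambda>u v w. pt' (t u v w) (p u v w) (q u v w) (r u v w) (s u v w) $ i)"
begin

lemma Ti_eq: "x \<in> Defor_fig8 \<Longrightarrow> Ti x = 1 / T x"
  using onto[of x] coords by metis

end

definition ptY :: "complex \<Rightarrow> complex \<Rightarrow> complex \<Rightarrow> complex \<Rightarrow> complex \<Rightarrow> complex^24" where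
  "ptY t p q r s = pt t (1 / (t * r)) (1 / (t * q)) (1 / (t * p)) (1 / (t * s))"

lemma rot2_compl: "1 - rot2 x = 1 / x" by (simp add: rot2_def)

interpretation std: chart pt tcoord tcoord_inv "\<lambda>x. vcoord x 3 1" "\<lambda>x. vcoord x 2 3" "\<lambda>x. vcoord x 4 2" "\<lambda>x. vcoord x 1 4"
proof
  fix t p q r s assume "sol t p q r s"
  then have "t \<noteq> 0" "p \<noteq> 0" unfolding sol_def by auto
  then show "tcoord (pt t p q r s) = t \<and> tcoord_inv (pt t p q r s) = 1 / t \<and>
      vcoord (pt t p q r s) 3 1 = p \<and> vcoord (pt t p q r s) 2 3 = q \<and> vcoord (pt t p q r s) 4 2 = r \<and>
      vcoord (pt t p q r s) 1 4 = s"
    using tcoord_pt tcoord_inv_pt vcoord_pt by simp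
qed (use Defor_is_pt pt_in_Defor poly_fun_tcoord poly_fun_vcoord reg_pt in \<open>blast+\<close>)

text \<open>Because \<open>1 - rot2 (t * r) = 1 / (t * r)\<close>, the coordinates after the
  involution are again polynomial in the ambient ones.\<close>

interpretation twisted: chart ptY tcoord tcoord_inv "\<lambda>x. 1 - ucoord x 3 2" "\<lambda>x. 1 - ucoord x 2 4"
  "\<lambda>x. 1 - ucoord x 1 4" "\<lambda>x. 1 - ucoord x 4 2"
proof
  fix x assume x: "x \<in> Defor_fig8"
  define t p q r s where "t = tcoord x" and "p = vcoord x 3 1" and "q = vcoord x 2 3" and "r = vcoord x 4 2" and "s = vcoord x 1 4"
  have sol: "sol t p q r s" and xp: "x = pt t p q r s"
    using Defor_is_pt[OF x] unfolding t_def p_def q_def r_def s_def by simp_all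
  have nz: "t \<noteq> 0" "p \<noteq> 0" "q \<noteq> 0" "r \<noteq> 0" "s \<noteq> 0" using sol unfolding sol_def by auto
  have "1 - ucoord x 3 2 = 1 / (t * r)" "1 - ucoord x 2 4 = 1 / (t * q)" "1 - ucoord x 1 4 = 1 / (t * p)"
    "1 - ucoord x 4 2 = 1 / (t * s)" unfolding xp ucoord_pt rot2_compl by simp_all
  then show "sol (tcoord x) (1 - ucoord x 3 2) (1 - ucoord x 2 4) (1 - ucoord x 1 4) (1 - ucoord x 4 2) \<and>
      ptY (tcoord x) (1 - ucoord x 3 2) (1 - ucoord x 2 4) (1 - ucoord x 1 4) (1 - ucoord x 4 2) = x"
    using sol_sigma[OF sol] xp nz unfolding ptY_def t_def[symmetric] by simp
next
  fix t p q r s assume sol: "sol t p q r s"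
  then have nz: "t \<noteq> 0" "p \<noteq> 0" "q \<noteq> 0" "r \<noteq> 0" "s \<noteq> 0" unfolding sol_def by auto
  show "ptY t p q r s \<in> Defor_fig8" unfolding ptY_def by (rule pt_in_Defor[OF sol_sigma[OF sol]])
  show "tcoord (ptY t p q r s) = t \<and> tcoord_inv (ptY t p q r s) = 1 / t \<and> 1 - ucoord (ptY t p q r s) 3 2 = p \<and>
      1 - ucoord (ptY t p q r s) 2 4 = q \<and> 1 - ucoord (ptY t p q r s) 1 4 = r \<and> 1 - ucoord (ptY t p q r s) 4 2 = s"
    unfolding ptY_def ucoord_pt rot2_compl using nz by (simp add: tcoord_pt tcoord_inv_pt)
next
  fix d W i and t p q r s :: "complex \<Rightarrow> complex \<Rightarrow> complex \<Rightarrow> complex"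
  assume sol: "\<And>u v w. W u v w \<Longrightarrow> sol (t u v w) (p u v w) (q u v w) (r u v w) (s u v w)"
    and rg: "reg d W t" "reg d W p" "reg d W q" "reg d W r" "reg d W s"
    and ri: "reg d W (\<lambda>u v w. 1 / t u v w)" "reg d W (\<lambda>u v w. 1 / p u v w)" "reg d W (\<lambda>u v w. 1 / q u v w)"
      "reg d W (\<lambda>u v w. 1 / r u v w)" "reg d W (\<lambda>u v w. 1 / s u v w)"
  have 1: "reg d W (\<lambda>u v w. 1 / (t u v w * x u v w))" if "reg d W (\<lambda>u v w. 1 / x u v w)" for x
    by (rule reg_cong[OF reg_mult[OF ri(1) that]]) simp
  have 2: "reg d W (\<lambda>u v w. 1 / (1 / (t u v w * x u v w)))" if "reg d W x" for x
    by (rule reg_cong[OF reg_mult[OF rg(1) that]]) simp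
  show "reg d W (\<lambda>u v w. ptY (t u v w) (p u v w) (q u v w) (r u v w) (s u v w) $ i)"
    unfolding ptY_def
    by (rule reg_pt) (intro sol_sigma sol rg ri 1 2 | assumption)+
qed (intro poly_fun_coords)+

text \<open>In the factorial ring of complex polynomials \<open>\<beta>^2 dvd h^2\<close> gives
  \<open>\<beta> dvd h\<close>, so a square in the fraction field is already the square of a
  polynomial.\<close>

lemma nonsquareI:
  fixes \<delta> :: "complex poly"
  assumes "\<And>k. k^2 \<noteq> \<delta>" shows "nonsquare \<delta>"
  unfolding nonsquare_def
proof (intro allI impI, rule ccontr)
  fix h \<beta> :: "complex poly" assume eq: "h^2 = \<beta>^2 * \<delta>" and "\<beta> \<noteq> 0"
  then have "\<beta>^2 dvd h^2" by simp
  then have "\<beta> dvd h" by simp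
  then obtain k where "h = \<beta> * k" by blast
  with eq \<open>\<beta> \<noteq> 0\<close> have "k^2 = \<delta>" by (simp add: power_mult_distrib)
  with assms show False by blast
qed

abbreviation U2 :: "complex poly poly" where "U2 \<equiv> [:[:0, 1:]:]"
abbreviation V2 :: "complex poly poly" where "V2 \<equiv> [:0, 1:]"

lemma ev2_UV: "ev2 U2 u v = u" "ev2 V2 u v = v" by simp_all

subsection \<open>The two twisted components\<close>

text \<open>A Bezout identity: the two quintics, to which \<open>smooth_discriminant\<close>
  reduces, generate the constant 84.\<close>

lemma coprime_resultant:
  fixes z :: complex
  assumes "1 + 5 * z + 3 * z^2 - 15 * z ^ 3 - 3 * z ^ 4 + 9 * z ^ 5 = 0"
    and "1 - 4 * z - 15 * z^2 + 15 * z ^ 4 + 6 * z ^ 5 = 0"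
  shows False
proof -
  have "(74 - 192 * z + 30 * z^2 + 507 * z ^ 3 + 222 * z ^ 4) * (1 + 5 * z + 3 * z^2 - 15 * z ^ 3 - 3 * z ^ 4 + 9 * z ^ 5)
    + (10 - 138 * z + 306 * z^2 + 183 * z ^ 3 - 333 * z ^ 4) * (1 - 4 * z - 15 * z^2 + 15 * z ^ 4 + 6 * z ^ 5) = 84"
    by (simp add: eval_nat_numeral algebra_simps)
  then show False unfolding assms by simp
qed

text \<open>With \<open>x = 1 - z\<^sup>2\<close> the discriminant of the double cover factors as \<open>F(z) F(-z)\<close>; it remains to see
  that the curve \<open>F = 0\<close> is smooth.\<close>
lemma smooth_discriminant:
  fixes x p w :: complex
  defines "\<delta> \<equiv> x * (p + x - 1)" and "\<epsilon> \<equiv> p * (p - 1)"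
  assumes nz: "x \<noteq> 0" "x \<noteq> 1" "\<delta> + \<epsilon> \<noteq> 0"
    and a: "2 * w = x * \<delta> + (x - 1) * \<epsilon>" and b: "w^2 = (x * \<delta> + (x - 1) * \<epsilon>) * w + (\<delta> + \<epsilon>) * \<epsilon> * (x - 1)"
    and dx: "(\<delta> + x * (2 * x + p - 1) + \<epsilon>) * w + ((2 * x + p - 1) * \<epsilon> * (x - 1) + (\<delta> + \<epsilon>) * \<epsilon>) = 0"
    and dp: "(x * x + (x - 1) * (2 * p - 1)) * w + ((x + 2 * p - 1) * \<epsilon> * (x - 1) + (\<delta> + \<epsilon>) * (2 * p - 1) * (x - 1)) = 0"
  shows False
proof -
  define f where "f z = (1 + z)^2 * \<delta> + \<epsilon> * z * (z + 2)" for z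
  define z0 where "z0 = csqrt (1 - x)"
  have z0: "x = 1 - z0^2" by (simp add: z0_def)
  have "f z0 * f (- z0) = (x * \<delta> + (x - 1) * \<epsilon>)^2 + 4 * ((\<delta> + \<epsilon>) * \<epsilon> * (x - 1))"
    unfolding f_def using z0 by algebra
  also have "\<dots> = 0" using a b by algebra
  finally have "f z0 = 0 \<or> f (- z0) = 0" by simp
  then obtain z where x: "x = 1 - z^2" and f0: "f z = 0"
    using z0 by (metis power2_minus)
  have z: "z \<noteq> 0" "1 + z \<noteq> 0" "1 - z \<noteq> 0"
  proof -
    have "x = (1 + z) * (1 - z)" using x by algebra
    then show "1 + z \<noteq> 0" "1 - z \<noteq> 0" using nz(1) by auto
    show "z \<noteq> 0" using nz(2) x by auto
  qed
  have "f z - f (- z) = 4 * z * (\<delta> + \<epsilon>)" unfolding f_def by algebra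
  then have fm: "f (- z) \<noteq> 0" using f0 z nz(3) by auto
  \<comment> \<open>\<open>fp\<close> and \<open>2 * (1 + z) * fz\<close> are the partial
    derivatives of \<open>f\<close> by \<open>p\<close> and \<open>z\<close>. Since
    \<open>f (- z)\<close> is nonzero, a critical point of the product is a critical point of
    \<open>f\<close>.\<close>
  define fp where "fp = (1 + z)^2 * (1 - z^2) + (2 * p - 1) * z * (z + 2)"
  define fz where "fz = (1 - z^2) * (p - z^2) - z * (1 + z) * (p - z^2) - z * (1 + z) * (1 - z^2) + p * (p - 1)"
  have f_eq: "f z = (1 + z)^2 * (1 - z^2) * (p - z^2) + p * (p - 1) * z * (z + 2)"
    "f (- z) = (1 - z)^2 * (1 - z^2) * (p - z^2) + p * (p - 1) * z * (z - 2)"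
    unfolding f_def \<delta>_def \<epsilon>_def x by algebra+
  have "fp * f (- z) = 0"
  proof -
    have "fp * f (- z) + f z * ((1 - z)^2 * (1 - z^2) + (2 * p - 1) * z * (z - 2))
        = 2 * (2 * w) * (x * x + (x - 1) * (2 * p - 1))
          + 4 * ((x + 2 * p - 1) * \<epsilon> * (x - 1) + (\<delta> + \<epsilon>) * (2 * p - 1) * (x - 1))"
      unfolding a unfolding f_eq fp_def \<delta>_def \<epsilon>_def x by algebra
    also have "\<dots> = 0" using dp by algebra
    finally show ?thesis using f0 by simp
  qed
  then have fp0: "fp = 0" using fm by simp
  have "2 * (1 + z) * fz * f (- z) = 0"
  proof -
    have "2 * (1 + z) * fz * f (- z)
        + f z * (- 2 * (1 - z) * (1 - z^2) * (p - z^2) - 2 * z * (1 - z)^2 * (p - z^2)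
             - 2 * z * (1 - z)^2 * (1 - z^2) + p * (p - 1) * (2 * z - 2))
        = - 2 * z * (2 * (2 * w) * (\<delta> + x * (2 * x + p - 1) + \<epsilon>)
          + 4 * ((2 * x + p - 1) * \<epsilon> * (x - 1) + (\<delta> + \<epsilon>) * \<epsilon>))"
      unfolding a unfolding f_eq fz_def \<delta>_def \<epsilon>_def x by algebra
    also have "\<dots> = 0" using dx by algebra
    finally show ?thesis using f0 by simp
  qed
  then have "2 * ((1 + z) * (fz * f (- z))) = 0" by (simp only: mult.assoc)
  from cancel_two[OF this] have fz0: "fz = 0" using fm z by simp
  have "z + 2 \<noteq> 0"
  proof
    assume "z + 2 = 0"
    then have "z = - 2" by (simp add: eq_neg_iff_add_eq_0)
    with fp0 show False by (simp add: fp_def)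
  qed
  moreover have "z * (z + 2) * (p^2 - 2 * p * z^2 + z^2) = 0"
    using fp0 f0 unfolding f_eq fp_def by algebra
  ultimately have p2: "p^2 - 2 * p * z^2 + z^2 = 0" using z by simp
  have "z * (p - (- 1 - 3 * z + 2 * z^2 + 3 * z ^ 3)) = 0"
    using fz0 p2 unfolding fz_def by algebra
  then have p: "p = - 1 - 3 * z + 2 * z^2 + 3 * z ^ 3" using z by simp
  have "(1 + z) * (1 + 5 * z + 3 * z^2 - 15 * z ^ 3 - 3 * z ^ 4 + 9 * z ^ 5) = 0"
    using p2 unfolding p by algebra
  moreover have "1 - 4 * z - 15 * z^2 + 15 * z ^ 4 + 6 * z ^ 5 = 0"
    using fp0 unfolding fp_def p by algebra
  ultimately show False using coprime_resultant z by simp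
qed

text \<open>\<open>x\<close> and \<open>y\<close> are the third roots of the two cubics. The
  relations are Vieta's formulas after replacing \<open>1 / t\<close> by \<open>x * y\<close>, which
  makes them symmetric in the two triples.\<close>

lemma compX_symmetric:
  assumes "compX t p q r s" "t \<noteq> 0"
  defines "x \<equiv> 1 + 1 / t - p - q" and "y \<equiv> 1 + 1 / t - r - s"
  shows "x * y = 1 / t" "p * q = x * (x - 1) * (1 - y)" "r * s = y * (y - 1) * (1 - x)"
    "p + q + x = 1 + x * y" "r + s + y = 1 + x * y"
proof -
  define i where "i = 1 / t"
  have i: "t * i = 1" using assms(2) by (simp add: i_def)
  have c: "quad t p q = 0" "quad t r s = 0" "(1 + t - t * (p + q)) * (1 + t - t * (r + s)) = t"
    using assms(1) unfolding compX_def by auto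
  have x: "x = 1 + i - p - q" and y: "y = 1 + i - r - s" by (simp_all add: x_def y_def i_def)
  have "x * y - i = i^2 * ((1 + t - t * (p + q)) * (1 + t - t * (r + s)) - t)"
    unfolding x y using i by algebra
  then have xy: "x * y = i" using c(3) by simp
  then show "x * y = 1 / t" by (simp add: i_def)
  show "p + q + x = 1 + x * y" "r + s + y = 1 + x * y" unfolding xy by (simp_all add: x y)
  show "p * q = x * (x - 1) * (1 - y)"
    using c(1) i xy x unfolding quad_def by algebra
  show "r * s = y * (y - 1) * (1 - x)"
    using c(2) i xy y unfolding quad_def by algebra
qed

text \<open>The cubic takes the value \<open>t * p * q * x\<close> at its three roots, so
  \<open>gf t p = t * q * x\<close> and likewise for the others. The face relations then follow from
  \<open>p * q * y = x * (r * s)\<close> and \<open>t * x * y = 1\<close>.\<close>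

lemma sol_of_xy:
  assumes nz: "x \<noteq> 0" "y \<noteq> 0" "x \<noteq> 1" "y \<noteq> 1" and t: "t = 1 / (x * y)"
    and pq: "p + q + x = 1 + x * y" "p * q = x * (x - 1) * (1 - y)"
    and rs: "r + s + y = 1 + x * y" "r * s = y * (y - 1) * (1 - x)"
  shows "sol t p q r s" "compX t p q r s"
proof -
  have txy: "t * x * y = 1" and t0: "t \<noteq> 0" using nz t by auto
  have "p * q \<noteq> 0" "r * s \<noteq> 0" unfolding pq rs using nz by auto
  then have nz': "p \<noteq> 0" "q \<noteq> 0" "r \<noteq> 0" "s \<noteq> 0" by auto
  have g: "gf t p = t * q * x" "gf t q = t * p * x" "gf t r = t * s * y" "gf t s = t * r * y"
    unfolding gf_def using txy pq rs by algebra+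
  have e: "p * q * y = x * (r * s)" unfolding pq rs by algebra
  have "t * p * s = gf t q * gf t r" "t * q * r = gf t p * gf t s" unfolding g using txy by algebra+
  moreover have "p * q * gf t r * gf t s = t * r^2 * s^2" unfolding g using e txy by algebra
  moreover have "r * s * gf t p * gf t q = t * p^2 * q^2" unfolding g using e txy by algebra
  ultimately show "sol t p q r s" unfolding sol_def using t0 nz' by auto
  have "x * y * quad t p q = 0" "x * y * quad t r s = 0"
    unfolding quad_def using txy pq rs by algebra+
  moreover have "(1 + t - t * (p + q)) * (1 + t - t * (r + s)) = t"
    using txy pq(1) rs(1) by algebra
  ultimately show "compX t p q r s" unfolding compX_def using nz by simp
qed

text \<open>With \<open>u = x\<close> and \<open>v = p\<close>, eliminating \<open>q\<close> from
  the Vieta relations gives \<open>y * del = del + eps\<close>. The remaining quadratic equation for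
  \<open>r\<close> becomes monic for \<open>w = del * r\<close>, with coefficients \<open>aX\<close>
  and \<open>bX\<close>.\<close>

definition pol_del :: "complex poly poly" where "pol_del = U2 * (V2 + U2 - 1)"
definition pol_eps :: "complex poly poly" where "pol_eps = V2 * (V2 - 1)"
definition aX :: "complex poly poly" where "aX = U2 * pol_del + (U2 - 1) * pol_eps"
definition bX :: "complex poly poly" where "bX = (pol_del + pol_eps) * pol_eps * (U2 - 1)"
text \<open>Collects what has to be invertible: \<open>x\<close>, \<open>x - 1\<close>,
  \<open>p\<close>, \<open>p - 1\<close>, the denominator \<open>del\<close> of \<open>y\<close>,
  and its numerator \<open>del + eps\<close>.\<close>

definition dX :: "complex poly poly" where
  "dX = U2 * (U2 - 1) * V2 * (V2 - 1) * (V2 + U2 - 1) * (pol_del + pol_eps)"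

abbreviation del :: "complex \<Rightarrow> complex \<Rightarrow> complex" where "del u v \<equiv> u * (v + u - 1)"
abbreviation eps :: "complex \<Rightarrow> complex" where "eps v \<equiv> v * (v - 1)"

lemma ev2_X:
  "ev2 aX u v = u * del u v + (u - 1) * eps v"
  "ev2 bX u v = (del u v + eps v) * eps v * (u - 1)"
  "ev2 dX u v = u * (u - 1) * v * (v - 1) * (v + u - 1) * (del u v + eps v)"
  unfolding aX_def bX_def dX_def pol_del_def pol_eps_def ev2_simps(2-7) ev2_UV by simp_all

lemma poly_ext: "(\<And>x. poly p x = poly q x) \<Longrightarrow> p = (q :: complex poly)"
  using poly_eq_poly_eq_iff by blast

text \<open>Multiplied by \<open>u^2\<close>, the discriminant is \<open>M^2\<close> plus a linear
  polynomial. Were it a square, that linear polynomial would split into two factors whose difference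
  \<open>2 * M\<close> has degree 4.\<close>

lemma nonsquare_slice_X:
  assumes "v \<noteq> 0" "v \<noteq> 1" shows "nonsquare (poly (aX^2 + 4 * bX) [:v:])"
proof (rule nonsquareI, rule notI)
  fix k assume k: "k^2 = poly (aX^2 + 4 * bX) [:v:]"
  define e where "e = eps v"
  define M where "M = [:- 2 * e, e, e, v - 1, 1:]"
  define f g where "f = [:0, 1:] * k - M" and "g = [:0, 1:] * k + M"
  have e: "e \<noteq> 0" using assms by (simp add: e_def)
  have fg: "f * g = [:- 4 * e^2, 4 * e^2:]"
  proof (rule poly_ext)
    fix u
    have "(poly k u)^2 = (ev2 aX u v)^2 + 4 * ev2 bX u v"
      using arg_cong[OF k, of "\<lambda>p. poly p u"] by (simp add: ev2_def)
    then have "u^2 * (poly k u)^2 = (u * (u * (u * (u + (v - 1)))) + e * (u^2 + u - 2))^2 + 4 * e^2 * (u - 1)"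
      unfolding ev2_X e_def by algebra
    then show "poly (f * g) u = poly [:- 4 * e^2, 4 * e^2:] u"
      unfolding f_def g_def M_def poly_mult poly_diff poly_add poly_pCons poly_0 by algebra
  qed
  have "degree (f * g) = 1" unfolding fg using e by simp
  moreover have "f \<noteq> 0" "g \<noteq> 0" using fg e by auto
  ultimately have "degree f + degree g = 1" by (simp add: degree_mult_eq)
  then have "degree (g - f) \<le> 1" by (intro degree_diff_le) auto
  moreover have "coeff (g - f) 4 = 2" unfolding f_def g_def M_def by (simp add: eval_nat_numeral)
  then have "4 \<le> degree (g - f)" by (intro le_degree) simp
  ultimately show False by simp
qed

abbreviation onX :: "complex \<Rightarrow> complex \<Rightarrow> complex \<Rightarrow> bool" where
  "onX u v w \<equiv> ev2 dX u v \<noteq> 0 \<and> w^2 = ev2 aX u v * w + ev2 bX u v"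

definition yX where "yX u v w = (del u v + eps v) / del u v" for u v w :: complex
definition tX where "tX u v w = 1 / (u * yX u v w)" for u v w :: complex
definition qX where "qX u v w = 1 + u * yX u v w - u - v" for u v w :: complex
definition rX where "rX u v w = w / del u v" for u v w :: complex
definition sX where "sX u v w = 1 + u * yX u v w - yX u v w - rX u v w" for u v w :: complex

lemma onX_nonzero:
  assumes "onX u v w"
  shows "u \<noteq> 0" "u \<noteq> 1" "v \<noteq> 0" "v \<noteq> 1" "del u v \<noteq> 0" "eps v \<noteq> 0" "del u v + eps v \<noteq> 0"
    "yX u v w \<noteq> 0" "yX u v w \<noteq> 1" "yX u v w * del u v = del u v + eps v" "rX u v w * del u v = w"
proof -
  show "u \<noteq> 0" "u \<noteq> 1" "v \<noteq> 0" "v \<noteq> 1" and d: "del u v \<noteq> 0" "del u v + eps v \<noteq> 0" and e: "eps v \<noteq> 0"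
    using assms unfolding ev2_X by auto
  show "yX u v w * del u v = del u v + eps v" "rX u v w * del u v = w"
    unfolding yX_def rX_def using d(1) by simp_all
  show "yX u v w \<noteq> 0" unfolding yX_def using d by (simp only: divide_eq_0_iff) simp
  show "yX u v w \<noteq> 1"
  proof
    assume "yX u v w = 1"
    then have "del u v + eps v = del u v" unfolding yX_def using d(1) by (simp only: divide_eq_1_iff)
    with e show False by simp
  qed
qed

lemma onX_relations:
  assumes W: "onX u v w"
  shows "v + qX u v w + u = 1 + u * yX u v w" "v * qX u v w = u * (u - 1) * (1 - yX u v w)"
    "rX u v w + sX u v w + yX u v w = 1 + u * yX u v w"
    "rX u v w * sX u v w = yX u v w * (yX u v w - 1) * (1 - u)"
proof -
  note nz = onX_nonzero[OF W]
  define y r e D where "y = yX u v w" and "r = rX u v w" and "e = eps v" and "D = del u v"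
  have yd: "y * D = D + e" and rd: "r * D = w" and d: "D \<noteq> 0"
    using nz unfolding y_def r_def e_def D_def by auto
  show "v + qX u v w + u = 1 + u * yX u v w" unfolding qX_def by simp
  show "rX u v w + sX u v w + yX u v w = 1 + u * yX u v w" unfolding sX_def by simp
  have "v * (1 + u * y - u - v) = u * (u - 1) * (1 - y)"
    using yd unfolding D_def e_def by algebra
  then show "v * qX u v w = u * (u - 1) * (1 - yX u v w)" unfolding qX_def y_def .
  have "w^2 = (u * D + (u - 1) * e) * w + (D + e) * e * (u - 1)"
    using W unfolding ev2_X e_def D_def by blast
  then have "D * D * (r * (1 + u * y - y - r) - y * (y - 1) * (1 - u)) = 0"
    using yd rd by algebra
  then have "r * (1 + u * y - y - r) = y * (y - 1) * (1 - u)" using d by simp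
  then show "rX u v w * sX u v w = yX u v w * (yX u v w - 1) * (1 - u)" unfolding sX_def y_def r_def .
qed

lemma onX_sol:
  assumes W: "onX u v w"
  shows "sol (tX u v w) v (qX u v w) (rX u v w) (sX u v w)" "compX (tX u v w) v (qX u v w) (rX u v w) (sX u v w)"
  using sol_of_xy[OF onX_nonzero(1)[OF W] onX_nonzero(8)[OF W] onX_nonzero(2)[OF W] onX_nonzero(9)[OF W]
      tX_def onX_relations[OF W]] by auto

lemma reg_X:
  shows "reg dX onX tX" "reg dX onX (\<lambda>u v w. v)" "reg dX onX qX" "reg dX onX rX" "reg dX onX sX"
    "reg dX onX (\<lambda>u v w. 1 / tX u v w)" "reg dX onX (\<lambda>u v w. 1 / v)" "reg dX onX (\<lambda>u v w. 1 / qX u v w)"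
    "reg dX onX (\<lambda>u v w. 1 / rX u v w)" "reg dX onX (\<lambda>u v w. 1 / sX u v w)"
proof -
  have u: "reg dX onX (\<lambda>u v w. u)" and v: "reg dX onX (\<lambda>u v w. v)" and w: "reg dX onX (\<lambda>u v w. w)"
    by (intro reg_good good_u good_v good_w)+
  note R = reg_mult reg_add reg_diff reg_const u v w
  have inv: "reg dX onX (\<lambda>u v w. 1 / h u v w)"
    if "reg dX onX k" "\<And>u v w. onX u v w \<Longrightarrow> h u v w * k u v w = ev2 dX u v" for h k
    by (rule reg_inverse_divisor[OF _ that]) auto
  have id_del: "reg dX onX (\<lambda>u v w. 1 / del u v)"
    by (rule inv[of "\<lambda>u v w. (u - 1) * v * (v - 1) * (del u v + eps v)"], intro R) (simp only: ev2_X mult_ac)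
  have id_N: "reg dX onX (\<lambda>u v w. 1 / (del u v + eps v))"
    by (rule inv[of "\<lambda>u v w. (u - 1) * v * (v - 1) * del u v"], intro R) (simp only: ev2_X mult_ac)
  have id_eps: "reg dX onX (\<lambda>u v w. 1 / eps v)"
    by (rule inv[of "\<lambda>u v w. (u - 1) * del u v * (del u v + eps v)"], intro R) (simp only: ev2_X mult_ac)
  have id_u: "reg dX onX (\<lambda>u v w. 1 / u)"
    by (rule inv[of "\<lambda>u v w. (u - 1) * v * (v - 1) * (v + u - 1) * (del u v + eps v)"], intro R) (simp only: ev2_X mult_ac)
  have id_u1: "reg dX onX (\<lambda>u v w. 1 / (u - 1))"
    by (rule inv[of "\<lambda>u v w. v * (v - 1) * del u v * (del u v + eps v)"], intro R) (simp only: ev2_X mult_ac)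
  show rv: "reg dX onX (\<lambda>u v w. v)" "reg dX onX (\<lambda>u v w. 1 / v)"
    by (rule v, rule inv[of "\<lambda>u v w. (u - 1) * (v - 1) * del u v * (del u v + eps v)"], intro R) (simp only: ev2_X mult_ac)
  have y: "reg dX onX yX"
    by (rule reg_cong[OF reg_mult[OF reg_add[OF _ _] id_del, of "\<lambda>u v w. del u v" "\<lambda>u v w. eps v"]])
       (intro R | simp add: yX_def)+
  have iy: "reg dX onX (\<lambda>u v w. 1 / yX u v w)"
    by (rule reg_cong[OF reg_mult[OF _ id_N, of "\<lambda>u v w. del u v"]]) (intro R | simp add: yX_def)+
  have iy1: "reg dX onX (\<lambda>u v w. 1 / (yX u v w - 1))"
  proof (rule reg_cong[OF reg_mult[OF _ id_eps, of "\<lambda>u v w. del u v"]])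
    show "reg dX onX (\<lambda>u v w. del u v)" by (intro R)
    fix u v w assume W: "onX u v w"
    have "yX u v w - 1 = eps v / del u v"
      unfolding yX_def add_divide_distrib using onX_nonzero(5)[OF W] by simp
    then show "1 / (yX u v w - 1) = del u v * (1 / eps v)" by simp
  qed
  show t: "reg dX onX tX"
    by (rule reg_cong[OF reg_mult[OF id_u iy]]) (simp add: tX_def)
  show "reg dX onX (\<lambda>u v w. 1 / tX u v w)"
    by (rule reg_cong[OF reg_mult[OF u y]]) (simp add: tX_def)
  show q: "reg dX onX qX" unfolding qX_def[abs_def] by (intro R y)
  show r: "reg dX onX rX"
    by (rule reg_cong[OF reg_mult[OF w id_del]]) (simp add: rX_def)
  show s: "reg dX onX sX" unfolding sX_def[abs_def] by (intro R y r)
  show "reg dX onX (\<lambda>u v w. 1 / qX u v w)"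
  proof (rule reg_inverse[where k = "\<lambda>u v w. - 1 * v * (1 / u) * (1 / (u - 1)) * (1 / (yX u v w - 1))"])
    show "reg dX onX (\<lambda>u v w. - 1 * v * (1 / u) * (1 / (u - 1)) * (1 / (yX u v w - 1)))"
      by (intro R id_u id_u1 iy1)
    fix u v w assume W: "onX u v w"
    note nz = onX_nonzero[OF W]
    have "qX u v w * (- 1 * v * (1 / u) * (1 / (u - 1)) * (1 / (yX u v w - 1)))
        = - (v * qX u v w) / (u * (u - 1) * (yX u v w - 1))" by simp
    also have "- (v * qX u v w) = u * (u - 1) * (yX u v w - 1)" unfolding onX_relations(2)[OF W] by algebra
    finally show "qX u v w * (- 1 * v * (1 / u) * (1 / (u - 1)) * (1 / (yX u v w - 1))) = 1" using nz by simp
  qed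
  have rs: "rX u v w * sX u v w * (- 1 * (1 / yX u v w) * (1 / (yX u v w - 1)) * (1 / (u - 1))) = 1" if W: "onX u v w" for u v w
  proof -
    note nz = onX_nonzero[OF W]
    have "rX u v w * sX u v w * (- 1 * (1 / yX u v w) * (1 / (yX u v w - 1)) * (1 / (u - 1)))
        = - (rX u v w * sX u v w) / (yX u v w * (yX u v w - 1) * (u - 1))" by simp
    also have "- (rX u v w * sX u v w) = yX u v w * (yX u v w - 1) * (u - 1)"
      unfolding onX_relations(4)[OF W] by algebra
    finally show ?thesis using nz by simp
  qed
  show "reg dX onX (\<lambda>u v w. 1 / rX u v w)"
  proof (rule reg_inverse)
    show "reg dX onX (\<lambda>u v w. sX u v w * (- 1 * (1 / yX u v w) * (1 / (yX u v w - 1)) * (1 / (u - 1))))"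
      by (intro R s iy iy1 id_u1)
  qed (use rs in \<open>simp only: mult.assoc\<close>)
  show "reg dX onX (\<lambda>u v w. 1 / sX u v w)"
  proof (rule reg_inverse)
    show "reg dX onX (\<lambda>u v w. rX u v w * (- 1 * (1 / yX u v w) * (1 / (yX u v w - 1)) * (1 / (u - 1))))"
      by (intro R r iy iy1 id_u1)
  qed (use rs in \<open>simp only: mult.assoc mult.left_commute\<close>)
qed

lemma zariski_closed_compX:
  assumes "T \<in> poly_fun" "P \<in> poly_fun" "Q \<in> poly_fun" "R \<in> poly_fun" "S \<in> poly_fun"
  shows "zariski_closed {z. compX (T z) (P z) (Q z) (R z) (S z)}"
proof -
  have eq: "{z. compX (T z) (P z) (Q z) (R z) (S z)} = {z. quad (T z) (P z) (Q z) = 0} \<inter> {z. quad (T z) (R z) (S z) = 0}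
      \<inter> {z. (1 + T z - T z * (P z + Q z)) * (1 + T z - T z * (R z + S z)) - T z = 0}"
    unfolding compX_def by auto
  show ?thesis unfolding eq quad_def
    by (intro zariski_closed_Int zariski_closed_zero pf_add pf_mult poly_fun_diff poly_fun_power pf_const assms)
qed

context chart
begin

text \<open>The third root \<open>x\<close>; \<open>Ti\<close> replaces \<open>1 / T\<close> to keep
  it polynomial.\<close>

definition xC :: "complex^24 \<Rightarrow> complex" where "xC z = 1 + Ti z - P z - Q z"
definition zC :: "complex^24 \<Rightarrow> complex" where "zC z = del (xC z) (P z) * R z"
definition phiX :: "complex \<Rightarrow> complex \<Rightarrow> complex \<Rightarrow> complex^24" where
  "phiX u v w = pt' (tX u v w) v (qX u v w) (rX u v w) (sX u v w)"
definition SX :: "(complex^24) set" where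
  "SX = Defor_fig8 \<inter> {z. compX (T z) (P z) (Q z) (R z) (S z)}"

lemma SX_param:
  assumes "z \<in> SX" shows "onX (xC z) (P z) (zC z)" "phiX (xC z) (P z) (zC z) = z"
proof -
  have D: "z \<in> Defor_fig8" and c: "compX (T z) (P z) (Q z) (R z) (S z)" using assms unfolding SX_def by auto
  define t p q r s where "t = T z" and "p = P z" and "q = Q z" and "r = R z" and "s = S z"
  have sol: "sol t p q r s" and z: "pt' t p q r s = z"
    using onto[OF D] unfolding t_def p_def q_def r_def s_def by auto
  have nz: "t \<noteq> 0" "p \<noteq> 0" "q \<noteq> 0" "r \<noteq> 0" "s \<noteq> 0" using sol unfolding sol_def by auto
  have p1: "p \<noteq> 1" using sol_gf_nonzero(1)[OF sol] gf_nonzeroD by blast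
  define x y where "x = 1 + 1 / t - p - q" and "y = 1 + 1 / t - r - s"
  have xC: "xC z = x" unfolding xC_def Ti_eq[OF D] x_def t_def p_def q_def ..
  note sym = compX_symmetric[OF c[folded t_def p_def q_def r_def s_def] nz(1), folded x_def y_def]
  have x0: "x \<noteq> 0" "y \<noteq> 0" using sym(1) nz by auto
  have x1: "x \<noteq> 1" "y \<noteq> 1" using sym(2) nz by auto
  have yd: "y * del x p = del x p + eps p" using sym(2,4) by algebra
  have e0: "eps p \<noteq> 0" using nz p1 by simp
  have d0: "del x p \<noteq> 0" using yd e0 by auto
  have N0: "del x p + eps p \<noteq> 0" unfolding yd[symmetric] using d0 x0 by simp
  have w: "(del x p * r)^2 = (x * del x p + (x - 1) * eps p) * (del x p * r) + (del x p + eps p) * eps p * (x - 1)"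
  proof -
    define D e where "D = del x p" and "e = eps p"
    have "y * D = D + e" using yd unfolding D_def e_def .
    then have "(D * r)^2 = (x * D + (x - 1) * e) * (D * r) + (D + e) * e * (x - 1)"
      using sym(3,5) by algebra
    then show ?thesis unfolding D_def e_def .
  qed
  have zC: "zC z = del x p * r" unfolding zC_def xC p_def r_def ..
  show W: "onX (xC z) (P z) (zC z)"
    unfolding xC zC p_def[symmetric] ev2_X using w d0 N0 x0 x1 nz p1 by auto
  have yX: "yX x p (del x p * r) = y" unfolding yX_def using yd d0 by (metis nonzero_mult_div_cancel_right)
  have "tX x p (del x p * r) = t" unfolding tX_def yX sym(1) by simp
  moreover have "qX x p (del x p * r) = q" unfolding qX_def yX using sym(4) by algebra
  moreover have rX: "rX x p (del x p * r) = r" unfolding rX_def using d0 by (rule nonzero_mult_div_cancel_left)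
  moreover have "sX x p (del x p * r) = s" unfolding sX_def yX rX using sym(5) by algebra
  ultimately show "phiX (xC z) (P z) (zC z) = z" unfolding phiX_def xC zC p_def[symmetric] using z by simp
qed

lemma phiX_coords:
  assumes W: "onX u v w"
  shows "phiX u v w \<in> SX" "xC (phiX u v w) = u" "P (phiX u v w) = v" "zC (phiX u v w) = w"
proof -
  note c = coords[OF onX_sol(1)[OF W], folded phiX_def]
  show "phiX u v w \<in> SX"
    unfolding SX_def using into[OF onX_sol(1)[OF W], folded phiX_def] c onX_sol(2)[OF W] by simp
  show P: "P (phiX u v w) = v" using c by simp
  have "xC (phiX u v w) = 1 + 1 / tX u v w - v - qX u v w" unfolding xC_def using c by simp
  also have "\<dots> = u" unfolding tX_def qX_def by simp
  finally show x: "xC (phiX u v w) = u" .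
  show "zC (phiX u v w) = w" unfolding zC_def x P using c onX_nonzero(11)[OF W] by (simp add: mult.commute)
qed

lemma double_plane_SX: "double_plane aX bX dX SX phiX xC P zC"
proof (unfold_locales, goal_cases)
  case 1
  show ?case unfolding SX_def by (intro zariski_closed_Int zariski_closed_Defor zariski_closed_compX polys)
next
  case 2
  show ?case unfolding xC_def[abs_def] by (intro pf_add poly_fun_diff pf_const polys)
next
  case 3
  show ?case by (rule polys)
next
  case 4
  show ?case unfolding zC_def[abs_def] xC_def[abs_def] by (intro pf_add pf_mult poly_fun_diff pf_const polys)
next
  case (5 z)
  then show ?case using SX_param by blast
next
  case (6 u v w)
  then show ?case using phiX_coords by blast
next
  case (7 u v w)
  then show ?case using phiX_coords by blast
next
  case (8 i)
  have "reg dX onX (\<lambda>u v w. phiX u v w $ i)"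
    unfolding phiX_def by (rule regular_pt'[OF onX_sol(1) reg_X])
  then show ?case unfolding reg_def by blast
next
  case 9
  have "UNIV - {0, 1} \<subseteq> {v. nonsquare (poly (aX^2 + 4 * bX) [:v:])}" using nonsquare_slice_X by blast
  moreover have "infinite (UNIV - {0, 1 :: complex})" by (simp add: infinite_UNIV_char_0)
  ultimately show ?case using infinite_super by blast
next
  case 10
  have "ev2 dX 2 2 \<noteq> 0" unfolding ev2_X by simp
  then show ?case by auto
next
  case (11 u v w au av bu bv)
  have W: "onX u v w" using 11(1) .
  note nz = onX_nonzero[OF W]
  have au: "au = del u v + u * (2 * u + v - 1) + eps v"
    by (rule DERIV_unique[OF 11(3)]) (unfold ev2_X, auto intro!: derivative_eq_intros simp: algebra_simps)
  have av: "av = u * u + (u - 1) * (2 * v - 1)"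
    by (rule DERIV_unique[OF 11(4)]) (unfold ev2_X, auto intro!: derivative_eq_intros simp: algebra_simps)
  have bu: "bu = (2 * u + v - 1) * eps v * (u - 1) + (del u v + eps v) * eps v"
    by (rule DERIV_unique[OF 11(5)]) (unfold ev2_X, auto intro!: derivative_eq_intros simp: algebra_simps)
  have bv: "bv = (u + 2 * v - 1) * eps v * (u - 1) + (del u v + eps v) * (2 * v - 1) * (u - 1)"
    by (rule DERIV_unique[OF 11(6)]) (unfold ev2_X, auto intro!: derivative_eq_intros simp: algebra_simps)
  show ?case
    using smooth_discriminant[OF nz(1,2,7)] W 11(2) unfolding au av bu bv ev2_X by blast
qed

theorem SX_properties:
  "irreducible_variety SX" "smooth_variety_dim SX 2" "connected SX"
proof -
  interpret double_plane aX bX dX SX phiX xC P zC onX by (rule double_plane_SX)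
  show "irreducible_variety SX" "smooth_variety_dim SX 2" by (rule irreducible, rule smooth_variety)
  \<comment> \<open>A branch point with \<open>u = - 3\<close>: there \<open>z = 2\<close> in the
    factorisation behind \<open>smooth_discriminant\<close>, and the factor becomes
    \<open>8 * p^2 - 35 * p + 108\<close>, of discriminant -2231.\<close>
  define c where "c = csqrt (- 2231)"
  define p where "p = (35 + c) / 16"
  have "c^2 = - 2231" unfolding c_def by (rule power2_csqrt)
  then have p: "8 * p^2 - 35 * p + 108 = 0" unfolding p_def by (simp add: power2_eq_square field_simps)
  have ne: "p \<noteq> 0" "p \<noteq> 1" "p \<noteq> 4" using p by auto
  show "connected SX"
  proof (rule connected_S)
    have "del (- 3) p + eps p \<noteq> 0"
    proof
      assume "del (- 3) p + eps p = 0"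
      then have "p^2 - 4 * p + 12 = 0" by algebra
      then have "p = - 4" using p by algebra
      with p show False by simp
    qed
    moreover have "p + - 3 - 1 \<noteq> 0" using ne(3) by simp
    moreover have "- 3 \<noteq> (0 :: complex)" "- 3 - 1 \<noteq> (0 :: complex)" "p - 1 \<noteq> 0" using ne by simp_all
    ultimately show "ev2 dX (- 3) p \<noteq> 0" unfolding ev2_X mult_eq_0_iff using ne(1) by blast
    show "ev2 (aX^2 + 4 * bX) (- 3) p = 0" unfolding ev2_simps ev2_X using p by algebra
  qed
qed

end

subsection \<open>The symmetric component\<close>

text \<open>For \<open>p = r\<close>, \<open>q = s\<close> the face relations collapse to
  \<open>t * p * q = gf t p * gf t q\<close>, quadratic in \<open>t\<close> with leading coefficient
  \<open>dV\<close>. The equation becomes monic for \<open>w = dV * t\<close>.\<close>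

definition aV :: "complex poly poly" where "aV = (U2 + V2) * (1 - U2) * (1 - V2) + U2 * V2"
definition bV :: "complex poly poly" where "bV = - (U2 * V2 * (1 - U2)^2 * (1 - V2)^2)"
definition dV :: "complex poly poly" where "dV = U2 * V2 * (1 - U2) * (1 - V2)"

lemma ev2_V:
  "ev2 aV u v = (u + v) * (1 - u) * (1 - v) + u * v"
  "ev2 bV u v = - (u * v * (1 - u)^2 * (1 - v)^2)"
  "ev2 dV u v = u * v * (1 - u) * (1 - v)"
  unfolding aV_def bV_def dV_def ev2_simps(2-7) ev2_UV by simp_all

abbreviation onV :: "complex \<Rightarrow> complex \<Rightarrow> complex \<Rightarrow> bool" where
  "onV u v w \<equiv> ev2 dV u v \<noteq> 0 \<and> w^2 = ev2 aV u v * w + ev2 bV u v"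

lemma degree_le_2_explicit:
  assumes "degree p \<le> 2" shows "p = [:coeff p 0, coeff p 1, coeff p 2:]"
proof (rule poly_eqI)
  fix n
  consider "n = 0" | "n = 1" | "n = 2" | m where "n = Suc (Suc (Suc m))"
    by (metis One_nat_def Suc_1 not0_implies_Suc)
  then show "coeff p n = coeff [:coeff p 0, coeff p 1, coeff p 2:] n"
    using assms by cases (auto simp: numeral_2_eq_2 coeff_eq_0)
qed

text \<open>Compare the discriminant with the square of \<open>x + y * u + z * u^2\<close>. The
  outer coefficients give \<open>x * z\<close> up to sign; eliminating \<open>y\<close> from the two
  odd coefficients forces \<open>v = 0\<close> for one sign and \<open>s * (1 + v) = 0\<close> for
  the other.\<close>

lemma nonsquare_slice_V:
  assumes "v \<noteq> 0" "v \<noteq> 1" "v \<noteq> - 1" shows "nonsquare (poly (aV^2 + 4 * bV) [:v:])"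
proof (rule nonsquareI, rule notI)
  fix k assume k: "k^2 = poly (aV^2 + 4 * bV) [:v:]"
  define s where "s = 1 - v"
  have s: "s \<noteq> 0" "v + s = 1" using assms by (simp_all add: s_def)
  define d1 d2 d3 where "d1 = 2 * v * s * (s^2 + v) - 4 * v * s^2"
    and "d2 = (s^2 + v)^2 + 6 * v * s^2" and "d3 = - 2 * s * (s^2 + v) - 4 * v * s^2"
  have kd: "k^2 = [:v^2 * s^2, d1, d2, d3, s^2:]"
  proof (rule poly_ext)
    fix u
    have "poly (k^2) u = (ev2 aV u v)^2 + 4 * ev2 bV u v"
      using arg_cong[OF k, of "\<lambda>p. poly p u"] by (simp add: ev2_def)
    also have "\<dots> = poly [:v^2 * s^2, d1, d2, d3, s^2:] u"
      unfolding ev2_V d1_def d2_def d3_def s_def poly_pCons poly_0 by algebra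
    finally show "poly (k^2) u = poly [:v^2 * s^2, d1, d2, d3, s^2:] u" .
  qed
  have "degree (k^2) = 4" unfolding kd using s by simp
  moreover have "degree (k^2) = degree k + degree k"
    by (cases "k = 0") (simp_all add: power2_eq_square degree_mult_eq)
  ultimately have "degree k \<le> 2" by simp
  then obtain x y z where "k = [:x, y, z:]" using degree_le_2_explicit by blast
  with kd have e: "x^2 = v^2 * s^2" "2 * (x * y) = d1" "2 * (y * z) = d3" "z^2 = s^2"
    by (simp_all add: power2_eq_square algebra_simps)
  have "(x * z - v * s^2) * (x * z + v * s^2) = 0" using e(1,4) by algebra
  then obtain \<sigma> where \<sigma>: "x * z = \<sigma> * (v * s^2)" "\<sigma> = 1 \<or> \<sigma> = -1"
    by (metis add_eq_0_iff2 eq_iff_diff_eq_0 mult_1 mult_eq_0_iff mult_minus1)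
  have "d1 * (x * z) = d3 * x^2" unfolding e(2,3)[symmetric] by algebra
  then have "(v^2 * s ^ 3) * (2 * (\<sigma> * ((s^2 + v) - 2 * s) + (s^2 + v) + 2 * v * s)) = 0"
    unfolding \<sigma>(1) e(1) d1_def d3_def by algebra
  then have "2 * (\<sigma> * ((s^2 + v) - 2 * s) + (s^2 + v) + 2 * v * s) = 0"
    using s(1) assms(1) by (simp only: mult_eq_0_iff power_eq_0_iff) simp
  from cancel_two[OF this] have *: "\<sigma> * ((s^2 + v) - 2 * s) + (s^2 + v) + 2 * v * s = 0" .
  from \<sigma>(2) show False
  proof
    assume "\<sigma> = 1"
    then have "2 * v = 0" using * s(2) by algebra
    then show False using assms(1) by simp
  next
    assume "\<sigma> = -1"
    then have "2 * (s * (1 + v)) = 0" using * by algebra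
    from cancel_two[OF this] show False using s(1) assms(3) by (simp add: add_eq_0_iff)
  qed
qed

text \<open>In terms of \<open>t = w / d\<close>, vanishing of the gradient means \<open>t u\<^sup>2 = t v\<^sup>2 = 1\<close>.\<close>
lemma smooth_V:
  fixes u v w :: complex
  defines "d \<equiv> u * v * (1 - u) * (1 - v)" and "a \<equiv> (u + v) * (1 - u) * (1 - v) + u * v"
  assumes d0: "d \<noteq> 0" and W: "w^2 = a * w - u * v * (1 - u)^2 * (1 - v)^2" and a: "2 * w = a"
    and du: "((1 - v) * (1 - 2 * u - v) + v) * w - v * (1 - v)^2 * (1 - u) * (1 - 3 * u) = 0"
    and dv: "((1 - u) * (1 - 2 * v - u) + u) * w - u * (1 - u)^2 * (1 - v) * (1 - 3 * v) = 0"
  shows False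
proof -
  have nz: "u \<noteq> 0" "v \<noteq> 0" "1 - u \<noteq> 0" "1 - v \<noteq> 0" using d0 unfolding d_def by auto
  \<comment> \<open>With \<open>t = w / d\<close> these are \<open>d * (1 - t * v)\<close> and
    \<open>d * (1 - t * u)\<close>; a zero would make \<open>gf t v\<close> or \<open>gf t u\<close>
    vanish, and with it \<open>t * u * v\<close>.\<close>
  have ne: "d - w * v \<noteq> 0" "d - w * u \<noteq> 0"
  proof -
    show "d - w * v \<noteq> 0"
    proof
      assume "d - w * v = 0"
      then have "v * (w - u * (1 - u) * (1 - v)) = 0" unfolding d_def by algebra
      then have "w = u * (1 - u) * (1 - v)" using nz by simp
      then have "u * (1 - u) * (1 - v) * (u * v) = 0" using W unfolding a_def by algebra
      then show False using nz by simp
    qed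
    show "d - w * u \<noteq> 0"
    proof
      assume "d - w * u = 0"
      then have "u * (w - v * (1 - u) * (1 - v)) = 0" unfolding d_def by algebra
      then have "w = v * (1 - u) * (1 - v)" using nz by simp
      then have "v * (1 - u) * (1 - v) * (u * v) = 0" using W unfolding a_def by algebra
      then show False using nz by simp
    qed
  qed
  have "(w * u^2 - d) * (1 - v) * (d - w * v) = 0"
    using W a du unfolding d_def a_def by algebra
  then have wu: "w * u^2 = d" using ne nz by simp
  have "(w * v^2 - d) * (1 - u) * (d - w * u) = 0"
    using W a dv unfolding d_def a_def by algebra
  then have wv: "w * v^2 = d" using ne nz by simp
  have w0: "w \<noteq> 0" using wu d0 by auto
  have "w * ((u - v) * (u + v)) = w * u^2 - w * v^2" by algebra
  then have "w * ((u - v) * (u + v)) = 0" using wu wv by simp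
  then consider "v = u" | "v = - u" using w0 by (auto simp: add_eq_0_iff)
  then show False
  proof cases
    case 1
    have "u^2 * (w - (1 - u)^2) = 0" using wu unfolding d_def 1 by algebra
    then have w: "w = (1 - u)^2" using nz by simp
    have W2: "w^2 = u * v * (1 - u)^2 * (1 - v)^2" using W a by algebra
    have "(1 - u) ^ 4 * ((u - 1) * (u + 1)) = 0" using W2 unfolding w 1 by algebra
    then have "u = - 1" using nz by (auto simp: eq_neg_iff_add_eq_0)
    with a w 1 show False unfolding a_def by simp
  next
    case 2
    have "u^2 * (w + (1 - u^2)) = 0" using wu unfolding d_def 2 by algebra
    then have "w + (1 - u^2) = 0" using nz by simp
    then have w: "w = - (1 - u^2)" by (simp only: eq_neg_iff_add_eq_0)
    have W2: "w^2 = u * v * (1 - u)^2 * (1 - v)^2" using W a by algebra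
    have "((1 - u) * (1 - v))^2 * (u^2 + 1) = 0" using W2 unfolding w 2 by algebra
    then have u2: "u^2 = - 1" using nz by (simp add: eq_neg_iff_add_eq_0)
    have "2 * (- (1 - u^2)) = - u\<^sup>2" using a w unfolding a_def 2 by algebra
    then show False unfolding u2 by simp
  qed
qed

definition tV where "tV u v w = w / (u * v * (1 - u) * (1 - v))" for u v w :: complex
definition phiV where "phiV u v w = pt (tV u v w) u v u v"
definition zV where "zV z = ev2 dV (vcoord z 3 1) (vcoord z 2 3) * tcoord z"
definition SV :: "(complex^24) set" where
  "SV = Defor_fig8 \<inter> {z. vcoord z 3 1 - vcoord z 4 2 = 0} \<inter> {z. vcoord z 2 3 - vcoord z 1 4 = 0}"

lemma sol_diag_iff:
  "sol t p q p q \<longleftrightarrow> t \<noteq> 0 \<and> p \<noteq> 0 \<and> q \<noteq> 0 \<and> t * p * q = gf t p * gf t q"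
proof
  assume "t \<noteq> 0 \<and> p \<noteq> 0 \<and> q \<noteq> 0 \<and> t * p * q = gf t p * gf t q"
  then have nz: "t \<noteq> 0" "p \<noteq> 0" "q \<noteq> 0" and e: "t * p * q = gf t p * gf t q" by auto
  have "p * q * (gf t p * gf t q) = t * p^2 * q^2" unfolding e[symmetric] by (simp add: power2_eq_square)
  then show "sol t p q p q" unfolding sol_def using nz e by (simp add: mult_ac)
qed (auto simp: sol_def mult_ac)

lemma onV_nonzero:
  assumes "onV u v w" shows "u \<noteq> 0" "v \<noteq> 0" "1 - u \<noteq> 0" "1 - v \<noteq> 0" "w \<noteq> 0" "tV u v w * ev2 dV u v = w"
proof -
  show nz: "u \<noteq> 0" "v \<noteq> 0" "1 - u \<noteq> 0" "1 - v \<noteq> 0" using assms unfolding ev2_V by auto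
  show "w \<noteq> 0" using assms nz unfolding ev2_V by auto
  show "tV u v w * ev2 dV u v = w" unfolding tV_def ev2_V using nz by simp
qed

lemma onV_sol:
  assumes W: "onV u v w" shows "sol (tV u v w) u v u v"
proof -
  note nz = onV_nonzero[OF W]
  define t where "t = tV u v w"
  have w: "w = t * (u * v * (1 - u) * (1 - v))" using nz(6) unfolding t_def ev2_V by simp
  have "w^2 = ((u + v) * (1 - u) * (1 - v) + u * v) * w - u * v * (1 - u)^2 * (1 - v)^2"
    using W unfolding ev2_V by simp
  then have "(u * v * (1 - u) * (1 - v)) * (t * u * v - gf t u * gf t v) = 0" unfolding w gf_def by algebra
  then have "t * u * v = gf t u * gf t v" using nz by simp
  moreover have "t \<noteq> 0" using w nz(5) by auto
  ultimately show ?thesis unfolding sol_diag_iff t_def[symmetric] using nz by simp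
qed

lemma reg_V:
  shows "reg dV onV tV" "reg dV onV (\<lambda>u v w. u)" "reg dV onV (\<lambda>u v w. v)"
    "reg dV onV (\<lambda>u v w. 1 / tV u v w)" "reg dV onV (\<lambda>u v w. 1 / u)" "reg dV onV (\<lambda>u v w. 1 / v)"
proof -
  show u: "reg dV onV (\<lambda>u v w. u)" and v: "reg dV onV (\<lambda>u v w. v)" by (intro reg_good good_u good_v)+
  have w: "reg dV onV (\<lambda>u v w. w)" and id: "reg dV onV (\<lambda>u v w. inverse (ev2 dV u v))"
    by (intro reg_good good_w good_inverse)+
  note R = reg_mult reg_add reg_diff reg_const u v w id
  show "reg dV onV tV"
    by (rule reg_cong[OF reg_mult[OF w id]]) (simp add: tV_def ev2_V divide_inverse)
  show "reg dV onV (\<lambda>u v w. 1 / u)"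
    by (rule reg_inverse_divisor[of _ _ "\<lambda>u v w. v * (1 - u) * (1 - v)"], simp, intro R) (simp only: ev2_V mult_ac)
  show "reg dV onV (\<lambda>u v w. 1 / v)"
    by (rule reg_inverse_divisor[of _ _ "\<lambda>u v w. u * (1 - u) * (1 - v)"], simp, intro R) (simp only: ev2_V mult_ac)
  show "reg dV onV (\<lambda>u v w. 1 / tV u v w)"
  proof (rule reg_inverse)
    \<comment> \<open>The inverse comes from the other root \<open>a - w\<close>:
      \<open>w * (a - w) = - b\<close>, and \<open>- b * u * v\<close> is the square of
      \<open>dV\<close>.\<close>
    show "reg dV onV (\<lambda>u v w. ((u + v) * (1 - u) * (1 - v) + u * v - w) * u * v * inverse (ev2 dV u v))"
      by (intro R)
    fix u v w assume W: "onV u v w"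
    define D where "D = ev2 dV u v"
    have D: "D \<noteq> 0" "D = u * v * (1 - u) * (1 - v)" using W unfolding D_def ev2_V by auto
    have t: "tV u v w = w * inverse D" unfolding tV_def D(2) divide_inverse ..
    have "w^2 = ((u + v) * (1 - u) * (1 - v) + u * v) * w - u * v * (1 - u)^2 * (1 - v)^2"
      using W unfolding ev2_V by simp
    then have "w * (((u + v) * (1 - u) * (1 - v) + u * v - w) * u * v) = D * D" unfolding D(2) by algebra
    note * = this
    have "tV u v w * (((u + v) * (1 - u) * (1 - v) + u * v - w) * u * v * inverse D)
        = (w * (((u + v) * (1 - u) * (1 - v) + u * v - w) * u * v)) * (inverse D * inverse D)"
      unfolding t by (simp only: mult_ac)
    also have "\<dots> = 1" unfolding * using D(1) by (simp add: field_simps)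
    finally show "tV u v w * (((u + v) * (1 - u) * (1 - v) + u * v - w) * u * v * inverse (ev2 dV u v)) = 1"
      unfolding D_def .
  qed
qed

lemma SV_param:
  assumes "z \<in> SV"
  shows "onV (vcoord z 3 1) (vcoord z 2 3) (zV z)" "phiV (vcoord z 3 1) (vcoord z 2 3) (zV z) = z"
proof -
  define t p q where "t = tcoord z" and "p = vcoord z 3 1" and "q = vcoord z 2 3"
  have D: "z \<in> Defor_fig8" "vcoord z 4 2 = p" "vcoord z 1 4 = q" using assms unfolding SV_def p_def q_def by auto
  have sol: "sol t p q p q" and z: "pt t p q p q = z"
    using Defor_is_pt[OF D(1)] unfolding D(2,3) t_def p_def q_def by auto
  have nz: "t \<noteq> 0" "p \<noteq> 0" "q \<noteq> 0" "t * p * q = gf t p * gf t q" using sol unfolding sol_diag_iff by auto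
  have ne: "1 - p \<noteq> 0" "1 - q \<noteq> 0" using sol_gf_nonzero(1,2)[OF sol] gf_nonzeroD by auto
  have zV: "zV z = p * q * (1 - p) * (1 - q) * t" unfolding zV_def ev2_V t_def p_def q_def ..
  have "(p * q * (1 - p) * (1 - q) * t)^2 = ((p + q) * (1 - p) * (1 - q) + p * q) * (p * q * (1 - p) * (1 - q) * t)
      - p * q * (1 - p)^2 * (1 - q)^2"
    using nz(4) unfolding gf_def by algebra
  then show "onV (vcoord z 3 1) (vcoord z 2 3) (zV z)"
    unfolding p_def[symmetric] q_def[symmetric] zV ev2_V using nz ne by simp
  show "phiV (vcoord z 3 1) (vcoord z 2 3) (zV z) = z"
    unfolding p_def[symmetric] q_def[symmetric] zV phiV_def tV_def using nz ne z by simp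
qed

lemma phiV_coords:
  assumes W: "onV u v w"
  shows "phiV u v w \<in> SV" "vcoord (phiV u v w) 3 1 = u" "vcoord (phiV u v w) 2 3 = v" "zV (phiV u v w) = w"
proof -
  note nz = onV_nonzero[OF W]
  show "phiV u v w \<in> SV" "vcoord (phiV u v w) 3 1 = u" "vcoord (phiV u v w) 2 3 = v"
    unfolding SV_def phiV_def using pt_in_Defor[OF onV_sol[OF W]]
    by (simp_all add: vcoord_pt del: One_nat_def)
  show "zV (phiV u v w) = w"
    unfolding zV_def phiV_def vcoord_pt tcoord_pt[OF nz(1)] using nz(6) by (simp add: mult.commute)
qed

lemma double_plane_SV: "double_plane aV bV dV SV phiV (\<lambda>z. vcoord z 3 1) (\<lambda>z. vcoord z 2 3) zV"
proof (unfold_locales, goal_cases)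
  case 1
  show ?case unfolding SV_def
    by (intro zariski_closed_Int zariski_closed_Defor zariski_closed_zero poly_fun_coords)
next
  case 4
  show ?case unfolding zV_def[abs_def] by (intro pf_mult poly_fun_ev2 poly_fun_coords)
next
  case (5 z)
  then show ?case using SV_param by blast
next
  case (6 u v w)
  then show ?case using phiV_coords by blast
next
  case (7 u v w)
  then show ?case using phiV_coords by blast
next
  case (8 i)
  have "reg dV onV (\<lambda>u v w. phiV u v w $ i)"
    unfolding phiV_def by (rule reg_pt[OF onV_sol reg_V(1,2,3,2,3) reg_V(4,5,6,5,6)])
  then show ?case unfolding reg_def by blast
next
  case 9
  have "UNIV - {0, 1, - 1} \<subseteq> {v. nonsquare (poly (aV^2 + 4 * bV) [:v:])}" using nonsquare_slice_V by blast
  moreover have "infinite (UNIV - {0, 1, - 1 :: complex})" by (simp add: infinite_UNIV_char_0)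
  ultimately show ?case using infinite_super by blast
next
  case 10
  have "ev2 dV 2 2 \<noteq> 0" unfolding ev2_V by simp
  then show ?case by auto
next
  case (11 u v w au av bu bv)
  have W: "onV u v w" using 11(1) .
  have au: "au = (1 - v) * (1 - 2 * u - v) + v"
    by (rule DERIV_unique[OF 11(3)]) (unfold ev2_V, auto intro!: derivative_eq_intros simp: algebra_simps)
  have av: "av = (1 - u) * (1 - 2 * v - u) + u"
    by (rule DERIV_unique[OF 11(4)]) (unfold ev2_V, auto intro!: derivative_eq_intros simp: algebra_simps)
  have bu: "bu = - (v * (1 - v)^2 * (1 - u) * (1 - 3 * u))"
    by (rule DERIV_unique[OF 11(5)])
       (unfold ev2_V, auto intro!: derivative_eq_intros simp: algebra_simps power2_eq_square)
  have bv: "bv = - (u * (1 - u)^2 * (1 - v) * (1 - 3 * v))"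
    by (rule DERIV_unique[OF 11(6)])
       (unfold ev2_V, auto intro!: derivative_eq_intros simp: algebra_simps power2_eq_square)
  show ?case
    using smooth_V[of u v w] W 11(2) unfolding au av bu bv ev2_V by (metis add_uminus_conv_diff)
qed (intro poly_fun_coords)+

theorem SV_properties:
  "irreducible_variety SV" "smooth_variety_dim SV 2" "connected SV"
proof -
  interpret double_plane aV bV dV SV phiV "\<lambda>z. vcoord z 3 1" "\<lambda>z. vcoord z 2 3" zV onV
    by (rule double_plane_SV)
  show "irreducible_variety SV" "smooth_variety_dim SV 2" by (rule irreducible, rule smooth_variety)
  \<comment> \<open>On the diagonal \<open>u = v = z\<close> the discriminant is
    \<open>z^3 * (4 * z^2 - 7 * z + 4)\<close>; a root of the quadratic factor gives the branch
    point.\<close>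
  define c where "c = csqrt (- 15)"
  define z where "z = (7 + c) / 8"
  have "c^2 = - 15" unfolding c_def by (rule power2_csqrt)
  then have z: "4 * z^2 - 7 * z + 4 = 0" unfolding z_def by (simp add: power2_eq_square field_simps)
  have ne: "z \<noteq> 0" "z \<noteq> 1" using z by auto
  show "connected SV"
  proof (rule connected_S)
    show "ev2 dV z z \<noteq> 0" unfolding ev2_V using ne by simp
    show "ev2 (aV^2 + 4 * bV) z z = 0" unfolding ev2_simps ev2_V using z by algebra
  qed
qed

section \<open>Covering, distinctness and intersections of the three components\<close>

theorem theorem3p1:
  shows "(\<exists>V1 V2 V3 :: (complex^24) set.
            V1 \<noteq> V2 \<and> V1 \<noteq> V3 \<and> V2 \<noteq> V3 \<and>
            irreducible_variety V1 \<and> irreducible_variety V2 \<and> irreducible_variety V3 \<and>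
            smooth_variety_dim V1 2 \<and> smooth_variety_dim V2 2 \<and> smooth_variety_dim V3 2 \<and>
            Defor_fig8 = V1 \<union> V2 \<union> V3)
         \<and> connected Defor_fig8"
proof -
  let ?X = std.SX and ?Y = twisted.SX
  have cover: "Defor_fig8 = SV \<union> ?X \<union> ?Y"
  proof (intro set_eqI iffI)
    fix z assume z: "z \<in> Defor_fig8"
    define t p q r s where "t = tcoord z" and "p = vcoord z 3 1" and "q = vcoord z 2 3"
      and "r = vcoord z 4 2" and "s = vcoord z 1 4"
    have sol: "sol t p q r s" and zp: "pt t p q r s = z"
      using Defor_is_pt[OF z] unfolding t_def p_def q_def r_def s_def by auto
    have tw: "1 - ucoord z 3 2 = 1 / (t * r)" "1 - ucoord z 2 4 = 1 / (t * q)" "1 - ucoord z 1 4 = 1 / (t * p)"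
      "1 - ucoord z 4 2 = 1 / (t * s)" unfolding zp[symmetric] ucoord_pt rot2_compl by simp_all
    have "z \<in> SV \<longleftrightarrow> p = r \<and> q = s" unfolding SV_def p_def q_def r_def s_def using z by simp
    moreover have "z \<in> ?X \<longleftrightarrow> compX t p q r s"
      unfolding std.SX_def t_def p_def q_def r_def s_def using z by simp
    moreover have "z \<in> ?Y \<longleftrightarrow> compX t (1 / (t * r)) (1 / (t * q)) (1 / (t * p)) (1 / (t * s))"
      unfolding twisted.SX_def tw[symmetric] unfolding t_def using z by simp
    ultimately show "z \<in> SV \<union> ?X \<union> ?Y" using coverage[OF sol] by blast
  qed (auto simp: SV_def std.SX_def twisted.SX_def simp del: One_nat_def)
  \<comment> \<open>For \<open>t = 1\<close> and both third roots equal to -1, Vieta gives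
    \<open>p + q = 3\<close> and \<open>p * q = 4\<close>. This point lies on the symmetric
    component and on \<open>?X\<close> but not on \<open>?Y\<close>; its image under the involution
    lies on the symmetric component and on \<open>?Y\<close> but not on \<open>?X\<close>. The two
    points prove both distinctness and connectedness.\<close>
  define c p q where "c = csqrt (- 7)" and "p = (3 + c) / 2" and "q = (3 - c) / 2"
  have "c^2 = - 7" unfolding c_def by (rule power2_csqrt)
  then have pq: "p + q = 3" "p * q = 4" unfolding p_def q_def by (simp_all add: power2_eq_square field_simps)
  then have nz: "p \<noteq> 0" "q \<noteq> 0" by auto
  have "gf 1 p * gf 1 q = (1 - (p + q) + p * q)^2" unfolding gf_def by algebra
  then have sol: "sol 1 p q p q" unfolding sol_diag_iff using nz pq by simp
  have sol': "sol 1 (1 / p) (1 / q) (1 / p) (1 / q)" using sol_sigma[OF sol] by simp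
  have "quad 1 p q = 1 - 2 * (p + q) + (p + q)^2 - p * q" unfolding quad_def by algebra
  then have in_X: "compX 1 p q p q" unfolding compX_def using pq by simp
  have sums: "1 / p + 1 / q = 3 / 4" "(1 / p) * (1 / q) = 1 / 4"
    using pq nz by (simp_all add: add_divide_eq_iff field_simps)
  have "quad 1 (1 / p) (1 / q) = 1 - 2 * (1 / p + 1 / q) + (1 / p + 1 / q)^2 - (1 / p) * (1 / q)"
    unfolding quad_def by algebra
  also have "\<dots> \<noteq> 0" unfolding sums by (simp add: power2_eq_square)
  finally have not_Y: "\<not> compX 1 (1 / p) (1 / q) (1 / p) (1 / q)" unfolding compX_def by simp
  define z z' where "z = pt 1 p q p q" and "z' = pt 1 (1 / p) (1 / q) (1 / p) (1 / q)"
  have D: "z \<in> Defor_fig8" "z' \<in> Defor_fig8" unfolding z_def z'_def using sol sol' pt_in_Defor by blast+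
  have SV: "z \<in> SV" "z' \<in> SV" using D unfolding SV_def by (auto simp: z_def z'_def vcoord_pt simp del: One_nat_def)
  have X: "z \<in> ?X" "z' \<notin> ?X"
    using D in_X not_Y nz unfolding std.SX_def by (auto simp: z_def z'_def vcoord_pt tcoord_pt simp del: One_nat_def)
  have Y: "z \<notin> ?Y" "z' \<in> ?Y"
    using D in_X not_Y nz unfolding twisted.SX_def
    by (auto simp: z_def z'_def ucoord_pt tcoord_pt rot2_compl simp del: One_nat_def)
  have conn: "connected (SV \<union> ?X)"
    by (rule connected_Un[OF SV_properties(3) std.SX_properties(3)]) (use SV(1) X(1) in blast)
  have "connected (SV \<union> ?X \<union> ?Y)"
    by (rule connected_Un[OF conn twisted.SX_properties(3)]) (use SV(2) Y(2) in blast)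
  moreover have "SV \<noteq> ?X" "SV \<noteq> ?Y" "?X \<noteq> ?Y" using SV X Y by blast+
  ultimately show ?thesis
    using SV_properties(1,2) std.SX_properties(1,2) twisted.SX_properties(1,2) cover by metis
qed

end
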